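(* Let $\mathbb{K}$ be a field with $\mathrm{char}\,\mathbb{K}=0$, $n\ge 1$, $\alpha,\beta\in\mathbb{K}$, $\phi\in\mathbb{K}[t_1,\dots,t_n]$, and assume that the quadratic equation $x^{2}-\alpha x-\beta=0$ has two roots $r,s$ in $\mathbb{K}$ (counted with multiplicity, so $r+s=\alpha$ and $rs=-\beta$). Then the center $Z(\mathcal{A})$ of $\mathcal{A}=\mathcal{A}(\alpha,\beta,\phi)$ is described as follows. (1) If $r=s$ is a primitive root of unity of order $m\geq 2$, then $Z(\mathcal{A})=\mathbb{K}[(du-rud+\frac{\phi}{r-1})^{m},t_{1},\dots,t_{n}]$. If $\phi=0$, then $m=1$ is also allowed. (2) If $\alpha=2$, $\beta=-1$ and $\phi\neq 0$, then $Z(\mathcal{A})=\mathbb{K}[(du-ud)^{2}-\phi(du+ud),t_{1},\dots,t_{n}]$. (3) If $r$ is a primitive root of unity of order $m>1$ and $s$ is not a root of unity, then $Z(\mathcal{A})=\mathbb{K}[(du-sud+\frac{\phi}{r-1})^{m},t_{1},\dots,t_{n}]$. The case $m=1$ is also allowed when $\phi=0$. (4) If $s$ is a primitive root of unity of order $m>1$ and $r$ is not a root of unity, then $Z(\mathcal{A})=\mathbb{K}[(du-rud+\frac{\phi}{s-1})^{m},t_{1},\dots,t_{n}]$. The case $m=1$ is also allowed when $\phi=0$. (5) If $r\neq s$ and neither $r$ nor $s$ is a root of unity, then $Z(\mathcal{A})$ is the $\mathbb{K}$-subalgebra generated by $t_1,\dots,t_n$ and all elements $(du-rud+\frac{\phi}{s-1})^{j}(du-sud+\frac{\phi}{r-1})^{i}$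 with $i,j\ge 0$ and $r^{i}s^{j}=1$. (6) If $r\neq s$ and $r,s$ are both primitive roots of unity, of orders $m_{1}>1$ and $m_{2}>1$ respectively, and $m$ is the least common multiple of $m_1,m_2$, then $Z(\mathcal{A})$ is the $\mathbb{K}$-subalgebra generated by $d^{m},u^{m},t_{1},\dots,t_{n}$ and all elements $(du-rud+\frac{\phi}{s-1})^{i}(du-sud+\frac{\phi}{r-1})^{j}$ with $i,j\ge 0$ and $s^{i}r^{j}=1$. The cases $m_{1}=1$ or $m_{2}=1$ are also allowed when $\phi=0$. (7) If $\phi\neq 0$, $r=1$ and $s$ is a primitive root of unity of order $m>1$, then $Z(\mathcal{A})=\mathbb{K}[(du-rud+\frac{\phi}{s-1})^{m},t_{1},\dots,t_{n}]$. (8) If $\phi\neq 0$, $s=1$ and $r$ is a primitive root of unity of order $m>1$, then $Z(\mathcal{A})=\mathbb{K}[(du-sud+\frac{\phi}{r-1})^{m},t_{1},\dots,t_{n}]$. (9) Otherwise, $Z(\mathcal{A})=\mathbb{K}[t_{1},\dots,t_{n}]$.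
   Context: $\mathcal{A}(\alpha,\beta,\phi)$ denotes the (unital associative) $\mathbb{K}$-algebra generated by $u,d,t_1,\dots,t_n$ subject to the relations $t_it_j=t_jt_i$, $t_iu=ut_i$, $t_id=dt_i$ for all $i,j\in\{1,\dots,n\}$, together with $d^{2}u=\alpha\, dud+\beta\, ud^{2}+\phi(t_1,\dots,t_n)d$ and $du^{2}=\alpha\, udu+\beta\, u^{2}d+u\phi(t_1,\dots,t_n)$. For elements $a_1,\dots,a_k$ of $\mathcal{A}$, $\mathbb{K}[a_1,\dots,a_k]$ denotes the $\mathbb{K}$-subalgebra they generate. When $\phi=0$, the terms $\frac{\phi}{r-1}$ and $\frac{\phi}{s-1}$ are understood to be $0$, even if $r=1$ or $s=1$. The convention $0^0=1$ is used. *)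

theory Defs
  imports
    "HOL-Library.Poly_Mapping"
    "HOL-Algebra.QuotRing"
    "HOL-Algebra.Generated_Rings"
    "HOL-Algebra.Algebraic_Closure_Type"
begin

section \<open>The free associative algebra\<close>

text \<open>Words are written additively because \<^type>\<open>poly_mapping\<close> forms the monoid algebra over an
  additive monoid of exponents: \<open>'g fword \<Rightarrow>\<^sub>0 'k\<close> is the free unital associative \<open>'k\<close>-algebra
  on \<open>'g\<close>. A separate type of words avoids a global arithmetic instance for lists.\<close>

datatype 'g fword = Word (letters: "'g list")

instantiation fword :: (type) monoid_add
begin

definition zero_fword :: "'a fword" where "zero_fword = Word []"

definition plus_fword :: "'a fword \<Rightarrow> 'a fword \<Rightarrow> 'a fword"
  where "plus_fword v w = Word (letters v @ letters w)"

instance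
  by standard (simp_all add: zero_fword_def plus_fword_def)

end

datatype gen = Gu | Gd | Gt nat

definition gens :: "nat \<Rightarrow> gen set"
  where "gens n = {Gu, Gd} \<union> Gt ` {1..n}"

type_synonym 'k free = "gen fword \<Rightarrow>\<^sub>0 'k"

text \<open>The type \<open>'k free\<close> has infinitely many letters \<^term>\<open>Gt i\<close>; only those of
  \<^term>\<open>gens n\<close> occur in the carrier.\<close>

definition free_alg :: "nat \<Rightarrow> 'k::field free ring"
  where "free_alg n =
    ring_of_type_algebra\<lparr>carrier := {f. \<forall>w\<in>Poly_Mapping.keys f. set (letters w) \<subseteq> gens n}\<rparr>"

definition scal :: "'k::field \<Rightarrow> 'k free"
  where "scal c = Poly_Mapping.single 0 c"

definition gen_elt :: "gen \<Rightarrow> 'k::field free"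
  where "gen_elt g = Poly_Mapping.single (Word [g]) 1"

abbreviation fu :: "'k::field free" where "fu \<equiv> gen_elt Gu"
abbreviation fd :: "'k::field free" where "fd \<equiv> gen_elt Gd"
abbreviation ft :: "nat \<Rightarrow> 'k::field free" where "ft i \<equiv> gen_elt (Gt i)"
abbreviation fts :: "nat \<Rightarrow> 'k::field free set" where "fts n \<equiv> ft ` {1..n}"

section \<open>Polynomials in \<open>t\<^sub>1, \<dots>, t\<^sub>n\<close>\<close>

type_synonym 'k mpol = "(nat \<Rightarrow>\<^sub>0 nat) \<Rightarrow>\<^sub>0 'k"

definition mpols :: "nat \<Rightarrow> 'k::field mpol set"
  where "mpols n = {p. \<forall>e\<in>Poly_Mapping.keys p. Poly_Mapping.keys e \<subseteq> {1..n}}"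

text \<open>The letters \<^term>\<open>ft i\<close> do not commute in the free algebra, so a monomial is evaluated in
  increasing order of the indices. Modulo the relations below the order is irrelevant.\<close>

definition mpol_eval :: "nat \<Rightarrow> 'k::field mpol \<Rightarrow> 'k free"
  where "mpol_eval n p =
    (\<Sum>e\<in>Poly_Mapping.keys p.
       scal (Poly_Mapping.lookup p e) * (\<Prod>i\<leftarrow>[1..<Suc n]. ft i ^ Poly_Mapping.lookup e i))"

section \<open>The algebra \<open>A(\<alpha>, \<beta>, \<phi>)\<close>\<close>

definition relators :: "nat \<Rightarrow> 'k::field \<Rightarrow> 'k \<Rightarrow> 'k mpol \<Rightarrow> 'k free set"
  where "relators n \<alpha> \<beta> \<phi> =
      {ft i * ft j - ft j * ft i | i j. i \<in> {1..n} \<and> j \<in> {1..n}}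
    \<union> {ft i * fu - fu * ft i | i. i \<in> {1..n}}
    \<union> {ft i * fd - fd * ft i | i. i \<in> {1..n}}
    \<union> {fd^2 * fu - (scal \<alpha> * fd * fu * fd + scal \<beta> * fu * fd^2 + mpol_eval n \<phi> * fd),
       fd * fu^2 - (scal \<alpha> * fu * fd * fu + scal \<beta> * fu^2 * fd + fu * mpol_eval n \<phi>)}"

definition rel_ideal :: "nat \<Rightarrow> 'k::field \<Rightarrow> 'k \<Rightarrow> 'k mpol \<Rightarrow> 'k free set"
  where "rel_ideal n \<alpha> \<beta> \<phi> = genideal (free_alg n) (relators n \<alpha> \<beta> \<phi>)"

definition gdu_alg :: "nat \<Rightarrow> 'k::field \<Rightarrow> 'k \<Rightarrow> 'k mpol \<Rightarrow> 'k free set ring"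
  where "gdu_alg n \<alpha> \<beta> \<phi> = free_alg n Quot rel_ideal n \<alpha> \<beta> \<phi>"

definition cls :: "nat \<Rightarrow> 'k::field \<Rightarrow> 'k \<Rightarrow> 'k mpol \<Rightarrow> 'k free \<Rightarrow> 'k free set"
  where "cls n \<alpha> \<beta> \<phi> x = rel_ideal n \<alpha> \<beta> \<phi> +>\<^bsub>free_alg n\<^esub> x"

definition ring_center :: "('a, 'b) ring_scheme \<Rightarrow> 'a set"
  where "ring_center R =
    {z \<in> carrier R. \<forall>x\<in>carrier R. z \<otimes>\<^bsub>R\<^esub> x = x \<otimes>\<^bsub>R\<^esub> z}"

text \<open>The \<open>'k\<close>-subalgebra of \<^term>\<open>gdu_alg n \<alpha> \<beta> \<phi>\<close> generated by the residue classes of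
  the elements of \<open>S\<close>.\<close>

definition subalg_gen ::
    "nat \<Rightarrow> 'k::field \<Rightarrow> 'k \<Rightarrow> 'k mpol \<Rightarrow> 'k free set \<Rightarrow> 'k free set set"
  where "subalg_gen n \<alpha> \<beta> \<phi> S =
    generate_ring (gdu_alg n \<alpha> \<beta> \<phi>) (cls n \<alpha> \<beta> \<phi> ` (range scal \<union> S))"

text \<open>A representative of \<open>du - a ud + \<phi>/(b - 1)\<close>. If \<open>\<phi> = 0\<close>, the last summand is \<open>0\<close> for every
  \<open>b\<close>, including \<open>b = 1\<close>.\<close>

definition du_elt :: "nat \<Rightarrow> 'k::field mpol \<Rightarrow> 'k \<Rightarrow> 'k \<Rightarrow> 'k free"
  where "du_elt n \<phi> a b =
    fd * fu - scal a * fu * fd + scal (1 / (b - 1)) * mpol_eval n \<phi>"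

section \<open>The cases for the roots \<open>r\<close> and \<open>s\<close>\<close>

definition primitive_root :: "nat \<Rightarrow> 'k::field \<Rightarrow> bool"
  where "primitive_root m x \<longleftrightarrow> m > 0 \<and> x ^ m = 1 \<and> (\<forall>k. 0 < k \<and> k < m \<longrightarrow> x ^ k \<noteq> 1)"

definition root_of_unity :: "'k::field \<Rightarrow> bool"
  where "root_of_unity x \<longleftrightarrow> (\<exists>k>0. x ^ k = 1)"

definition case1 :: "'k::field mpol \<Rightarrow> 'k \<Rightarrow> 'k \<Rightarrow> nat \<Rightarrow> bool"
  where "case1 \<phi> r s m \<longleftrightarrow>
    r = s \<and> primitive_root m r \<and> (m \<ge> 2 \<or> m = 1 \<and> \<phi> = 0)"

definition case2 :: "'k::field \<Rightarrow> 'k \<Rightarrow> 'k mpol \<Rightarrow> bool"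
  where "case2 \<alpha> \<beta> \<phi> \<longleftrightarrow> \<alpha> = 2 \<and> \<beta> = -1 \<and> \<phi> \<noteq> 0"

definition case3 :: "'k::field mpol \<Rightarrow> 'k \<Rightarrow> 'k \<Rightarrow> nat \<Rightarrow> bool"
  where "case3 \<phi> r s m \<longleftrightarrow>
    primitive_root m r \<and> \<not> root_of_unity s \<and> (m > 1 \<or> m = 1 \<and> \<phi> = 0)"

definition case4 :: "'k::field mpol \<Rightarrow> 'k \<Rightarrow> 'k \<Rightarrow> nat \<Rightarrow> bool"
  where "case4 \<phi> r s m \<longleftrightarrow>
    primitive_root m s \<and> \<not> root_of_unity r \<and> (m > 1 \<or> m = 1 \<and> \<phi> = 0)"

definition case5 :: "'k::field \<Rightarrow> 'k \<Rightarrow> bool"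
  where "case5 r s \<longleftrightarrow> r \<noteq> s \<and> \<not> root_of_unity r \<and> \<not> root_of_unity s"

definition case6 :: "'k::field mpol \<Rightarrow> 'k \<Rightarrow> 'k \<Rightarrow> nat \<Rightarrow> nat \<Rightarrow> bool"
  where "case6 \<phi> r s m1 m2 \<longleftrightarrow>
    r \<noteq> s \<and> primitive_root m1 r \<and> primitive_root m2 s \<and>
    (m1 > 1 \<or> m1 = 1 \<and> \<phi> = 0) \<and> (m2 > 1 \<or> m2 = 1 \<and> \<phi> = 0)"

definition case7 :: "'k::field mpol \<Rightarrow> 'k \<Rightarrow> 'k \<Rightarrow> nat \<Rightarrow> bool"
  where "case7 \<phi> r s m \<longleftrightarrow> \<phi> \<noteq> 0 \<and> r = 1 \<and> primitive_root m s \<and> m > 1"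

definition case8 :: "'k::field mpol \<Rightarrow> 'k \<Rightarrow> 'k \<Rightarrow> nat \<Rightarrow> bool"
  where "case8 \<phi> r s m \<longleftrightarrow> \<phi> \<noteq> 0 \<and> s = 1 \<and> primitive_root m r \<and> m > 1"

section \<open>Well-formedness\<close>

lemma free_alg_simps [simp]:
  "carrier (free_alg n) = {f. \<forall>w\<in>Poly_Mapping.keys f. set (letters w) \<subseteq> gens n}"
  "x \<otimes>\<^bsub>free_alg n\<^esub> y = x * y" "x \<oplus>\<^bsub>free_alg n\<^esub> y = x + y"
  "\<one>\<^bsub>free_alg n\<^esub> = 1" "\<zero>\<^bsub>free_alg n\<^esub> = 0"
  by (simp_all add: free_alg_def ring_of_type_algebra_def)

lemma free_alg_closed:
  fixes x y :: "'k::field free"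
  shows
  "1 \<in> carrier (free_alg n :: 'k free ring)" "0 \<in> carrier (free_alg n :: 'k free ring)"
  "scal c \<in> carrier (free_alg n)" "g \<in> gens n \<Longrightarrow> gen_elt g \<in> carrier (free_alg n :: 'k free ring)"
  "x \<in> carrier (free_alg n) \<Longrightarrow> - x \<in> carrier (free_alg n)"
  "x \<in> carrier (free_alg n) \<Longrightarrow> y \<in> carrier (free_alg n) \<Longrightarrow> x + y \<in> carrier (free_alg n)"
  "x \<in> carrier (free_alg n) \<Longrightarrow> y \<in> carrier (free_alg n) \<Longrightarrow> x - y \<in> carrier (free_alg n)"
  "x \<in> carrier (free_alg n) \<Longrightarrow> y \<in> carrier (free_alg n) \<Longrightarrow> x * y \<in> carrier (free_alg n)"
proof -
  show "1 \<in> carrier (free_alg n :: 'k free ring)" "0 \<in> carrier (free_alg n :: 'k free ring)"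
    "scal c \<in> carrier (free_alg n)"
    "g \<in> gens n \<Longrightarrow> gen_elt g \<in> carrier (free_alg n :: 'k free ring)"
    by (auto simp: scal_def gen_elt_def zero_fword_def single_one[symmetric] simp del: single_one)
  show "x \<in> carrier (free_alg n) \<Longrightarrow> - x \<in> carrier (free_alg n)"
    by (auto simp: in_keys_iff)
  show "x \<in> carrier (free_alg n) \<Longrightarrow> y \<in> carrier (free_alg n) \<Longrightarrow> x + y \<in> carrier (free_alg n)"
    using keys_add[of x y] by auto
  show "x \<in> carrier (free_alg n) \<Longrightarrow> y \<in> carrier (free_alg n) \<Longrightarrow> x - y \<in> carrier (free_alg n)"
    using keys_diff[of x y] by auto
  show "x * y \<in> carrier (free_alg n)" if "x \<in> carrier (free_alg n)" "y \<in> carrier (free_alg n)"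
  proof -
    have "set (letters w) \<subseteq> gens n" if "w \<in> Poly_Mapping.keys (x * y)" for w
    proof -
      from that keys_mult[of x y] obtain a b where "w = a + b"
        "a \<in> Poly_Mapping.keys x" "b \<in> Poly_Mapping.keys y" by blast
      with \<open>x \<in> _\<close> \<open>y \<in> _\<close> show ?thesis by (auto simp: plus_fword_def)
    qed
    then show ?thesis by simp
  qed
qed

lemma free_alg_power_closed:
  "(x :: 'k::field free) \<in> carrier (free_alg n) \<Longrightarrow> x ^ k \<in> carrier (free_alg n)"
  by (induction k) (simp_all add: free_alg_closed del: free_alg_simps(1))

lemma ring_free_alg: "ring (free_alg n :: 'k::field free ring)"
proof (rule ringI)
  show "abelian_group (free_alg n :: 'k free ring)"
  proof (rule abelian_groupI)
    fix x :: "'k free" assume "x \<in> carrier (free_alg n)"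
    then show "\<exists>y\<in>carrier (free_alg n). y \<oplus>\<^bsub>free_alg n\<^esub> x = \<zero>\<^bsub>free_alg n\<^esub>"
      by (intro bexI[of _ "- x"] free_alg_closed) (simp_all add: free_alg_closed)
  qed (simp_all add: free_alg_closed ac_simps del: free_alg_simps(1))
  show "monoid (free_alg n :: 'k free ring)"
    by (rule monoidI) (simp_all add: free_alg_closed ac_simps del: free_alg_simps(1))
qed (simp_all add: algebra_simps del: free_alg_simps(1))

lemma mpol_eval_closed: "mpol_eval n p \<in> carrier (free_alg n :: 'k::field free ring)"
proof -
  have prod: "(\<Prod>i\<leftarrow>xs. ft i ^ h i :: 'k free) \<in> carrier (free_alg n)" if "set xs \<subseteq> {1..n}" for xs h
    using that
    by (induction xs)
      (simp_all add: free_alg_closed free_alg_power_closed gens_def del: free_alg_simps(1))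
  have "(\<Sum>e\<in>E. scal (c e) * (\<Prod>i\<leftarrow>[1..<Suc n]. ft i ^ Poly_Mapping.lookup e i) :: 'k free)
      \<in> carrier (free_alg n)" if "finite E" for E and c :: "(nat \<Rightarrow>\<^sub>0 nat) \<Rightarrow> 'k"
    using that
  proof induction
    case (insert e E)
    have "(\<Prod>i\<leftarrow>[1..<Suc n]. ft i ^ Poly_Mapping.lookup e i :: 'k free) \<in> carrier (free_alg n)"
      by (rule prod) auto
    then have "scal (c e) * (\<Prod>i\<leftarrow>[1..<Suc n]. ft i ^ Poly_Mapping.lookup e i)
        + (\<Sum>e\<in>E. scal (c e) * (\<Prod>i\<leftarrow>[1..<Suc n]. ft i ^ Poly_Mapping.lookup e i))
        \<in> carrier (free_alg n)"
      by (intro free_alg_closed insert.IH)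
    then show ?case
      by (simp only: sum.insert[OF insert.hyps])
  qed (simp add: free_alg_closed)
  then show ?thesis
    unfolding mpol_eval_def using finite_keys by blast
qed

lemma relators_closed: "relators n \<alpha> \<beta> \<phi> \<subseteq> carrier (free_alg n)"
  unfolding relators_def
  by (auto simp del: free_alg_simps(1)
      intro!: free_alg_closed free_alg_power_closed mpol_eval_closed simp: gens_def)

lemma ideal_rel_ideal: "ideal (rel_ideal n \<alpha> \<beta> \<phi>) (free_alg n)"
  unfolding rel_ideal_def by (rule ring.genideal_ideal[OF ring_free_alg relators_closed])

lemma ring_gdu_alg: "ring (gdu_alg n \<alpha> \<beta> \<phi>)"
  unfolding gdu_alg_def by (rule ideal.quotient_is_ring[OF ideal_rel_ideal])

end

theory Submission
  imports Defs "HOL-Computational_Algebra.Polynomial" "HOL-Library.Function_Algebras"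
begin

text \<open>Put \<open>P = K[t\<^sub>1, \<dots>, t\<^sub>n]\<close>, \<open>h = ud\<close> and \<open>w = du - r ud\<close>. The relations say that \<open>h\<close> and \<open>w\<close> commute
  and that \<open>d p = \<sigma>(p) d\<close> and \<open>p u = u \<sigma>(p)\<close> for \<open>p \<in> P[w, h]\<close>, where \<open>\<sigma>\<close> is the endomorphism over \<open>P\<close>
  with \<open>\<sigma>(w) = s w + \<phi>\<close> and \<open>\<sigma>(h) = du = w + r h\<close> (lemmas \<open>D_ev\<close> and \<open>ev_U\<close>). So the algebra is a
  generalised Weyl algebra, possibly degenerate, and its centre is governed by \<open>\<sigma>\<close>.

  If \<open>\<beta> \<noteq> 0\<close>, then \<open>\<sigma>\<close> is an automorphism and every element is uniquely a sum of terms \<open>u\<^sup>k p\<close> and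
  \<open>d\<^sup>k p\<close>. A central element commutes with \<open>P[w, h]\<close>, which forces \<open>\<sigma>\<^sup>k = id\<close> whenever the \<open>k\<close>-th
  coefficient is not zero, and with \<open>u\<close>, which forces the coefficients to be \<open>\<sigma>\<close>-invariant
  (\<open>central_normal_form\<close>). If \<open>\<beta> = 0\<close>, one may assume \<open>r = 0\<close>; the normal forms are then sums of
  \<open>u\<^sup>i p(w) d\<^sup>k\<close>, and only invariant elements of \<open>P[w]\<close> are central
  (\<open>central_normal_form_degenerate\<close>). In both cases uniqueness of the normal form comes from an explicit
  module. Hence the centre is generated over \<open>P\<close> by the invariants of \<open>\<sigma>\<close> and by the powers \<open>u\<^sup>k\<close>, \<open>d\<^sup>k\<close>
  with \<open>\<sigma>\<^sup>k = id\<close> (\<open>center_generated\<close>).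

  The rest is commutative algebra in characteristic zero. The elements \<open>X = w + \<phi>/(s - 1)\<close> and
  \<open>Y = w + (r - s) h + \<phi>/(r - 1) = du - s ud + \<phi>/(r - 1)\<close> satisfy \<open>\<sigma>(X) = s X\<close> and \<open>\<sigma>(Y) = r Y\<close>
  whenever the fractions make sense.
  \<^item> If \<open>r \<noteq> s\<close> and both exist, the invariants are spanned by the monomials \<open>X\<^sup>i Y\<^sup>j\<close> with
    \<open>s\<^sup>i r\<^sup>j = 1\<close>, and \<open>\<sigma>\<close> has finite order exactly if \<open>r\<close> and \<open>s\<close> are roots of unity
    (\<open>invariants_semisimple\<close>).
  \<^item> If \<open>s = 1 \<noteq> r\<close> and \<open>\<phi> \<noteq> 0\<close>, then \<open>w\<close> is translated by \<open>\<phi>\<close> and only powers of \<open>Y\<close> are left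
    (\<open>invariants_translation\<close>); the case \<open>r = 1 \<noteq> s\<close> follows by exchanging the roots.
  \<^item> If \<open>r = s\<close> and \<open>X\<close> exists, the Jordan block leaves only powers of \<open>X\<close> (\<open>invariants_jordan\<close>).
  \<^item> If \<open>r = s = 1\<close> and \<open>\<phi> \<noteq> 0\<close>, the invariants are the polynomials in
    \<open>w\<^sup>2 - \<phi> w - 2 \<phi> h\<close> (\<open>invariants_unipotent\<close>).

  In the last three situations no positive power of \<open>\<sigma>\<close> is the identity, so no positive powers of \<open>u\<close>
  and \<open>d\<close> are central.\<close>

section \<open>Ring homomorphisms out of monoid algebras and polynomial rings\<close>

definition rhom :: "('a::ring_1 \<Rightarrow> 'b::ring_1) \<Rightarrow> bool"
  where "rhom h \<longleftrightarrow> h 1 = 1 \<and> (\<forall>x y. h (x + y) = h x + h y) \<and> (\<forall>x y. h (x * y) = h x * h y)"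

lemma rhomI:
  "h 1 = 1 \<Longrightarrow> (\<And>x y. h (x + y) = h x + h y) \<Longrightarrow> (\<And>x y. h (x * y) = h x * h y) \<Longrightarrow> rhom h"
  by (simp add: rhom_def)

lemma rhom_one: "rhom h \<Longrightarrow> h 1 = 1"
  and rhom_add: "rhom h \<Longrightarrow> h (x + y) = h x + h y"
  and rhom_mult: "rhom h \<Longrightarrow> h (x * y) = h x * h y"
  by (simp_all add: rhom_def)

lemma rhom_zero: "rhom h \<Longrightarrow> h 0 = 0"
  using rhom_add[of h 0 0] by simp

lemma rhom_minus: "rhom h \<Longrightarrow> h (- x) = - h x"
  using rhom_add[of h x "- x"] rhom_zero[of h] by (simp add: eq_neg_iff_add_eq_0 add.commute)

lemma rhom_diff: "rhom h \<Longrightarrow> h (x - y) = h x - h y"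
  using rhom_add[of h x "- y"] rhom_minus[of h y] by simp

lemma rhom_sum: "rhom h \<Longrightarrow> h (\<Sum>i\<in>A. f i) = (\<Sum>i\<in>A. h (f i))"
  by (induction A rule: infinite_finite_induct) (simp_all add: rhom_zero rhom_add)

lemma rhom_power: "rhom h \<Longrightarrow> h (x ^ k) = h x ^ k"
  by (induction k) (simp_all add: rhom_one rhom_mult)

lemma rhom_prod_list: "rhom h \<Longrightarrow> h (prod_list xs) = prod_list (map h xs)"
  by (induction xs) (simp_all add: rhom_one rhom_mult)

lemma rhom_comp: "rhom f \<Longrightarrow> rhom g \<Longrightarrow> rhom (\<lambda>x. f (g x))"
  by (simp add: rhom_def)

lemma rhom_funpow: "rhom (h :: 'a::ring_1 \<Rightarrow> 'a) \<Longrightarrow> rhom (h ^^ k)"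
  by (induction k) (simp_all add: rhom_def)

lemmas rhom_simps = rhom_one rhom_zero rhom_add rhom_mult rhom_minus rhom_diff rhom_power

text \<open>The linear extension to a monoid algebra of a map \<open>m\<close> on the monoid. Free algebras and
  polynomial rings in the \<open>t\<^sub>i\<close> are both of this form, so that one lemma yields the homomorphisms
  out of either.\<close>

definition mlift :: "('k::zero \<Rightarrow> 'e) \<Rightarrow> ('m \<Rightarrow> 'e) \<Rightarrow> ('m \<Rightarrow>\<^sub>0 'k) \<Rightarrow> 'e::ring_1"
  where "mlift \<kappa> m f = (\<Sum>w\<in>Poly_Mapping.keys f. \<kappa> (Poly_Mapping.lookup f w) * m w)"

lemma mlift_superset:
  assumes "rhom \<kappa>" "finite A" "Poly_Mapping.keys f \<subseteq> A"
  shows "mlift \<kappa> m f = (\<Sum>w\<in>A. \<kappa> (Poly_Mapping.lookup f w) * m w)"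
  unfolding mlift_def using assms
  by (intro sum.mono_neutral_left) (auto simp: in_keys_iff rhom_zero)

lemma mlift_add:
  assumes "rhom \<kappa>" shows "mlift \<kappa> m (f + g) = mlift \<kappa> m f + mlift \<kappa> m g"
proof -
  let ?A = "Poly_Mapping.keys f \<union> Poly_Mapping.keys g"
  have "mlift \<kappa> m (f + g) = (\<Sum>w\<in>?A. \<kappa> (Poly_Mapping.lookup (f + g) w) * m w)"
    by (rule mlift_superset[OF assms]) (auto simp: keys_add)
  also have "\<dots> = (\<Sum>w\<in>?A. \<kappa> (Poly_Mapping.lookup f w) * m w)
      + (\<Sum>w\<in>?A. \<kappa> (Poly_Mapping.lookup g w) * m w)"
    by (simp add: lookup_add rhom_add[OF assms] distrib_right sum.distrib)
  also have "\<dots> = mlift \<kappa> m f + mlift \<kappa> m g"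
    by (subst (1 2) mlift_superset[OF assms, of ?A]) auto
  finally show ?thesis .
qed

lemma mlift_single: "rhom \<kappa> \<Longrightarrow> mlift \<kappa> m (Poly_Mapping.single w c) = \<kappa> c * m w"
  by (subst mlift_superset[of _ "{w}"]) auto

lemma mlift_zero: "rhom \<kappa> \<Longrightarrow> mlift \<kappa> m 0 = 0"
  by (simp add: mlift_def)

text \<open>Bilinear identities in a monoid algebra thereby reduce to single terms.\<close>

lemma poly_mapping_single_induct [case_names zero single add]:
  assumes "P 0" "\<And>w c. P (Poly_Mapping.single w c)" "\<And>f g. P f \<Longrightarrow> P g \<Longrightarrow> P (f + g)"
  shows "P (f :: 'm \<Rightarrow>\<^sub>0 'k::comm_monoid_add)"
proof (induction f rule: update_induct)
  case const
  then show ?case by (rule assms)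
next
  case (update f a b)
  have "Poly_Mapping.update a b f = f + Poly_Mapping.single a b"
    using update(1) by (intro poly_mapping_eqI)
      (auto simp: lookup_update lookup_add lookup_single in_keys_iff when_def)
  then show ?case using update assms by simp
qed

lemma rhom_mlift:
  fixes \<kappa> :: "'k::ring_1 \<Rightarrow> 'e::ring_1" and m :: "'m::monoid_add \<Rightarrow> 'e"
  assumes \<kappa>: "rhom \<kappa>" and m: "m 0 = 1" "\<And>v w. m (v + w) = m v * m w"
    and comm: "\<And>c w. \<kappa> c * m w = m w * \<kappa> c"
  shows "rhom (mlift \<kappa> m)"
proof (rule rhomI)
  show "mlift \<kappa> m 1 = 1"
    unfolding single_one[symmetric] by (simp add: mlift_single[OF \<kappa>] m rhom_one[OF \<kappa>] del: single_one)
  show "mlift \<kappa> m (f + g) = mlift \<kappa> m f + mlift \<kappa> m g" for f g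
    by (rule mlift_add[OF \<kappa>])
  have single: "mlift \<kappa> m (Poly_Mapping.single v c * g)
      = mlift \<kappa> m (Poly_Mapping.single v c) * mlift \<kappa> m g" for v c g
  proof (induction g rule: poly_mapping_single_induct)
    case (single w d)
    have "\<kappa> c * \<kappa> d * (m v * m w) = \<kappa> c * m v * (\<kappa> d * m w)"
      by (metis comm mult.assoc)
    then show ?case
      by (simp add: mult_single mlift_single[OF \<kappa>] rhom_mult[OF \<kappa>] m)
  qed (simp_all add: mlift_zero[OF \<kappa>] mlift_add[OF \<kappa>] distrib_left)
  show "mlift \<kappa> m (f * g) = mlift \<kappa> m f * mlift \<kappa> m g" for f g
    by (induction f rule: poly_mapping_single_induct)
      (simp_all add: mlift_zero[OF \<kappa>] mlift_add[OF \<kappa>] distrib_right single)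
qed

lemma rhom_mlift_comp:
  assumes "rhom h" shows "h (mlift \<kappa> m f) = mlift (\<lambda>c. h (\<kappa> c)) (\<lambda>w. h (m w)) f"
  unfolding mlift_def by (simp add: rhom_sum[OF assms] rhom_mult[OF assms])

text \<open>Horner evaluation with the powers of \<open>a\<close> on the left of the coefficients. In a noncommutative
  ring it is additive in any case, and multiplicative as soon as \<open>a\<close> commutes with the image of \<open>\<kappa>\<close>.\<close>

definition pev :: "('c::comm_ring_1 \<Rightarrow> 'e) \<Rightarrow> 'e \<Rightarrow> 'c poly \<Rightarrow> 'e::ring_1"
  where "pev \<kappa> a p = fold_coeffs (\<lambda>c y. \<kappa> c + a * y) p 0"

lemma pev_0: "pev \<kappa> a 0 = 0"
  by (simp add: pev_def)

lemma pev_pCons': "\<kappa> 0 = 0 \<Longrightarrow> pev \<kappa> a (pCons c p) = \<kappa> c + a * pev \<kappa> a p"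
  by (cases "p = 0"; cases "c = 0") (simp_all add: pev_def)

lemma pev_pCons: "rhom \<kappa> \<Longrightarrow> pev \<kappa> a (pCons c p) = \<kappa> c + a * pev \<kappa> a p"
  by (rule pev_pCons') (rule rhom_zero)

lemma pev_add:
  assumes "\<kappa> 0 = 0" "\<And>c d. \<kappa> (c + d) = \<kappa> c + \<kappa> d"
  shows "pev \<kappa> a (p + q) = pev \<kappa> a p + pev \<kappa> a q"
proof (induction p arbitrary: q)
  case (pCons c p)
  obtain d q' where q: "q = pCons d q'" by (cases q)
  have "pev \<kappa> a (pCons c p + q) = (\<kappa> c + \<kappa> d) + (a * pev \<kappa> a p + a * pev \<kappa> a q')"
    by (simp add: q pev_pCons'[of \<kappa>] assms pCons.IH distrib_left)
  then show ?case
    by (simp add: q pev_pCons'[of \<kappa>] assms add_ac)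
qed (simp add: pev_0)

lemma rhom_pev:
  assumes \<kappa>: "rhom \<kappa>" and comm: "\<And>c. \<kappa> c * a = a * \<kappa> c"
  shows "rhom (pev \<kappa> a)"
proof (rule rhomI)
  show "pev \<kappa> a 1 = 1"
    by (simp add: one_pCons pev_pCons[OF \<kappa>] pev_0 rhom_one[OF \<kappa>])
  show add: "pev \<kappa> a (p + q) = pev \<kappa> a p + pev \<kappa> a q" for p q
    by (rule pev_add) (simp_all add: rhom_zero[OF \<kappa>] rhom_add[OF \<kappa>])
  have smult: "pev \<kappa> a (smult c p) = \<kappa> c * pev \<kappa> a p" for c p
  proof (induction p)
    case (pCons d p)
    have "a * (\<kappa> c * pev \<kappa> a p) = \<kappa> c * (a * pev \<kappa> a p)"
      by (metis comm mult.assoc)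
    then show ?case
      by (simp add: pev_pCons[OF \<kappa>] pCons rhom_mult[OF \<kappa>] distrib_left)
  qed (simp add: pev_0)
  show "pev \<kappa> a (p * q) = pev \<kappa> a p * pev \<kappa> a q" for p q
    by (induction p)
      (simp_all add: pev_0 pev_pCons[OF \<kappa>] add smult distrib_right rhom_zero[OF \<kappa>] mult.assoc)
qed

lemma rhom_pev_comp: "rhom h \<Longrightarrow> \<kappa> 0 = 0 \<Longrightarrow> h (pev \<kappa> a p) = pev (\<lambda>c. h (\<kappa> c)) (h a) p"
  by (induction p) (simp_all add: pev_0 pev_pCons' rhom_zero rhom_add rhom_mult)

lemma pev_const: "rhom \<kappa> \<Longrightarrow> pev \<kappa> a [:c:] = \<kappa> c"
  by (simp add: pev_pCons pev_0)

lemma pev_var: "rhom \<kappa> \<Longrightarrow> pev \<kappa> a [:0, 1:] = a"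
  by (simp add: pev_pCons pev_0 rhom_one rhom_zero)

text \<open>Statements that are stable under sums and products need only be checked on constants and on
  variables. This replaces an explicit expansion whenever two homomorphisms, or a homomorphism and a
  conjugation, are compared.\<close>

lemma poly_ring_induct [case_names const var add mult]:
  fixes f :: "'c::comm_ring_1 poly"
  assumes "\<And>c. Q [:c:]" "Q [:0, 1:]" "\<And>f g. Q f \<Longrightarrow> Q g \<Longrightarrow> Q (f + g)" "\<And>f g. Q f \<Longrightarrow> Q g \<Longrightarrow> Q (f * g)"
  shows "Q f"
proof (induction f)
  case 0
  then show ?case using assms(1)[of 0] by simp
next
  case (pCons c p)
  have "pCons c p = [:c:] + [:0, 1:] * p" by simp
  then show ?case using assms pCons by metis
qed

lemma poly2_ring_induct [case_names const inner outer add mult]: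
  fixes f :: "'c::comm_ring_1 poly poly"
  assumes "\<And>c. Q [:[:c:]:]" "Q [:[:0, 1:]:]" "Q [:0, 1:]"
    and add: "\<And>f g. Q f \<Longrightarrow> Q g \<Longrightarrow> Q (f + g)" and mult: "\<And>f g. Q f \<Longrightarrow> Q g \<Longrightarrow> Q (f * g)"
  shows "Q f"
proof (induction f rule: poly_ring_induct)
  case (const c)
  show ?case
  proof (induction c rule: poly_ring_induct)
    case (add f g)
    then show ?case using assms(4)[of "[:f:]" "[:g:]"] by simp
  next
    case (mult f g)
    then show ?case using assms(5)[of "[:f:]" "[:g:]"] by (simp add: mult.commute)
  qed (use assms in auto)
qed (use assms in auto)

section \<open>The ring of additive endomorphisms\<close>

text \<open>Endomorphisms supply rings that are types although they depend on parameters: an algebra acting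
  faithfully on an abelian group becomes a set of elements of one \<^class>\<open>ring_1\<close>. The class
  \<^class>\<open>zero_neq_one\<close> only ensures that the group is not trivial.\<close>

typedef (overloaded) 'v endo = "{f :: 'v::{ab_group_add, zero_neq_one} \<Rightarrow> 'v. \<forall>x y. f (x + y) = f x + f y}"
  morphisms app Endo
  by (rule exI[of _ "\<lambda>x. x"]) simp

setup_lifting type_definition_endo

instantiation endo :: ("{ab_group_add, zero_neq_one}") ring_1
begin
lift_definition zero_endo :: "'a endo" is "\<lambda>_. 0" by simp
lift_definition one_endo :: "'a endo" is "\<lambda>x. x" by simp
lift_definition plus_endo :: "'a endo \<Rightarrow> 'a endo \<Rightarrow> 'a endo" is "\<lambda>f g x. f x + g x" by simp
lift_definition minus_endo :: "'a endo \<Rightarrow> 'a endo \<Rightarrow> 'a endo" is "\<lambda>f g x. f x - g x" by simp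
lift_definition uminus_endo :: "'a endo \<Rightarrow> 'a endo" is "\<lambda>f x. - f x" by simp
lift_definition times_endo :: "'a endo \<Rightarrow> 'a endo \<Rightarrow> 'a endo" is "\<lambda>f g x. f (g x)" by simp
instance proof
  show "(0 :: 'a endo) \<noteq> 1" 
    by transfer (metis zero_neq_one)
qed (transfer; force simp: algebra_simps fun_eq_iff)+
end

lemma endo_eqI: "(\<And>v k. app f v k = app g v k) \<Longrightarrow> f = g" for f g :: "('i \<Rightarrow> 'c::{ab_group_add,zero_neq_one}) endo"
  by (intro app_inject[THEN iffD1] ext)

section \<open>A faithful representation of the algebra\<close>

text \<open>Let \<open>p\<close> be a linear projection with kernel \<open>J\<close>. The quotient by \<open>J\<close> is isomorphic to the range
  of \<open>p\<close>, on which \<open>a\<close> acts by \<open>f \<mapsto> p (a f)\<close>. To obtain a unital action on the whole space, the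
  complement \<open>J\<close> is acted upon through the character \<open>e\<close> of the quotient.\<close>

lemma quotient_rep:
  fixes J :: "('m::monoid_add \<Rightarrow>\<^sub>0 'k::field) set" and e :: "('m \<Rightarrow>\<^sub>0 'k) \<Rightarrow> 'k"
  assumes J0: "0 \<in> J" and Jadd: "\<And>x y. x \<in> J \<Longrightarrow> y \<in> J \<Longrightarrow> x + y \<in> J"
    and Jl: "\<And>a x. x \<in> J \<Longrightarrow> a * x \<in> J" and Jr: "\<And>a x. x \<in> J \<Longrightarrow> x * a \<in> J"
    and e: "rhom e" and eJ: "\<And>x. x \<in> J \<Longrightarrow> e x = 0"
  obtains \<Phi> :: "('m \<Rightarrow>\<^sub>0 'k) \<Rightarrow> ('m \<Rightarrow>\<^sub>0 'k) endo"
  where "rhom \<Phi>" "\<And>a. \<Phi> a = 0 \<longleftrightarrow> a \<in> J"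
proof -
  define S :: "'k \<Rightarrow> 'm \<Rightarrow>\<^sub>0 'k" where "S c = Poly_Mapping.single 0 c" for c
  have S: "S (a + b) = S a + S b" "S (a * b) = S a * S b" "S 1 = 1" for a b
    by (simp_all add: S_def single_add mult_single)
  interpret vector_space "\<lambda>c f. S c * f"
    by standard (simp_all add: S algebra_simps)
  interpret vector_space_pair "\<lambda>c f. S c * f" "\<lambda>c f. S c * f" ..
  have "subspace J"
    by (simp add: subspace_def J0 Jadd Jl)
  obtain g where g: "range g \<subseteq> J" "Vector_Spaces.linear (\<lambda>c f. S c * f) (\<lambda>c f. S c * f) g"
    "\<forall>x\<in>J. g (id x) = x"
    using linear_exists_left_inverse_on[OF linear_id \<open>subspace J\<close> inj_on_id] by blast
  have gJ: "g x \<in> J" and gid: "x \<in> J \<Longrightarrow> g x = x" for x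
    using g(1,3) by auto
  interpret g: Vector_Spaces.linear "\<lambda>c f. S c * f" "\<lambda>c f. S c * f" g by (fact g(2))
  define p where "p f = f - g f" for f
  have p_add: "p (x + y) = p x + p y" and p_diff: "p (x - y) = p x - p y" for x y
    by (simp_all add: p_def g.add g.diff)
  have pJ: "p x = 0" if "x \<in> J" for x
    using gid[OF that] by (simp add: p_def)
  have gp: "g (p x) = 0" for x
    by (simp add: p_def g.diff gid[OF gJ])
  have pp: "p (p x) = p x" for x
    using gp[of x] p_def by simp
  \<comment> \<open>Since \<open>J\<close> is a left ideal, \<open>a\<close> may be applied to any representative.\<close>
  have pmult: "p (a * p x) = p (a * x)" for a x
  proof -
    have "p (a * x) = p (a * p x) + p (a * g x)"
      by (simp add: p_def[of x] p_diff flip: p_add) (simp add: algebra_simps)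
    then show ?thesis using pJ[OF Jl[OF gJ]] by simp
  qed
  define act where "act a f = p (a * p f) + S (e a) * g f" for a f
  have act_add: "act a (x + y) = act a x + act a y" for a x y
    by (simp add: act_def p_add g.add distrib_left add_ac)
  have app_act: "app (Endo (act a)) = act a" for a
    by (rule Endo_inverse) (simp add: act_add)
  have act_act: "act a (act b f) = act (a * b) f" for a b f
  proof -
    have g: "g (act b f) = S (e b) * g f"
      by (simp add: act_def g.add gp gid[OF Jl[OF gJ]])
    have "p (act b f) = act b f - g (act b f)"
      by (rule p_def)
    also have "\<dots> = p (b * p f)"
      unfolding g by (simp add: act_def)
    finally have "p (act b f) = p (b * p f)" .
    then have "act a (act b f) = p (a * p (b * p f)) + S (e a) * (S (e b) * g f)"
      by (simp only: act_def[of a] g)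
    then show ?thesis
      by (simp add: pmult act_def[of "a * b"] rhom_mult[OF e] S(2) flip: mult.assoc)
  qed
  have "rhom (\<lambda>a. Endo (act a))"
  proof (rule rhomI)
    show "Endo (act 1) = 1"
      by (intro app_inject[THEN iffD1] ext)
        (simp add: app_act one_endo.rep_eq, simp add: act_def rhom_one[OF e] S pp, simp add: p_def)
    show "Endo (act (x + y)) = Endo (act x) + Endo (act y)" for x y
      by (intro app_inject[THEN iffD1] ext)
        (simp add: app_act plus_endo.rep_eq,
         simp add: act_def rhom_add[OF e] S p_add distrib_right add_ac)
    show "Endo (act (x * y)) = Endo (act x) * Endo (act y)" for x y
      by (intro app_inject[THEN iffD1] ext) (simp add: app_act times_endo.rep_eq act_act)
  qed
  moreover have "Endo (act a) = 0 \<longleftrightarrow> a \<in> J" for a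
  proof
    assume "Endo (act a) = 0"
    then have "app (Endo (act a)) 1 = 0"
      by (simp only: zero_endo.rep_eq)
    then have "act a 1 = 0"
      by (simp only: app_act)
    then have a: "p (a * p 1) + S (e a) * g 1 = 0"
      by (simp add: act_def)
    then have "g (p (a * p 1) + S (e a) * g 1) = 0"
      by (simp only: g.zero)
    then have "S (e a) * g 1 = 0"
      by (simp add: g.add gp gid[OF Jl[OF gJ]])
    with a pmult[of a 1] have "p a = 0" by simp
    then have "g a = a" unfolding p_def by (metis eq_iff_diff_eq_0)
    then show "a \<in> J" using gJ by metis
  next
    assume "a \<in> J"
    then have "act a = (\<lambda>_. 0)"
      by (simp add: act_def fun_eq_iff eJ pJ Jr S_def)
    then show "Endo (act a) = 0"
      by (simp add: zero_endo_def)
  qed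
  ultimately show thesis
    using that by blast
qed

lemma scal_commute: "scal c * f = f * scal (c::'k::field)"
  by (induction f rule: poly_mapping_single_induct)
    (simp_all add: scal_def distrib_left distrib_right mult_single mult.commute)

lemma rhom_scal: "rhom (scal :: 'k::field \<Rightarrow> 'k free)"
  by (rule rhomI) (simp_all add: scal_def single_add mult_single)

text \<open>The kernel of \<open>h\<close> meets the free algebra in an ideal, and \<^const>\<open>rel_ideal\<close> is the least ideal
  that contains the relators.\<close>

lemma kills_rel_ideal:
  fixes h :: "'k::field free \<Rightarrow> 'e::ring_1"
  assumes h: "rhom h" and rel: "\<And>x. x \<in> relators n \<alpha> \<beta> \<phi> \<Longrightarrow> h x = 0"
    and x: "x \<in> rel_ideal n \<alpha> \<beta> \<phi>"
  shows "h x = 0"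
proof -
  let ?F = "free_alg n :: 'k free ring"
  interpret ring ?F by (rule ring_free_alg)
  define N where "N = {x \<in> carrier ?F. h x = 0}"
  have neg: "\<ominus>\<^bsub>?F\<^esub> a = - a" if "a \<in> carrier ?F" for a
    using that by (intro minus_equality) (simp_all del: free_alg_simps(1) add: free_alg_closed)
  have "ideal N ?F"
  proof (rule idealI[OF ring_free_alg])
    show "subgroup N (add_monoid ?F)"
    proof
      fix a assume "a \<in> N"
      then show "inv\<^bsub>add_monoid ?F\<^esub> a \<in> N"
        using neg[of a] unfolding a_inv_def[symmetric]
        by (simp add: N_def free_alg_closed rhom_minus[OF h] del: free_alg_simps(1))
    qed (auto simp add: N_def free_alg_closed rhom_add[OF h] rhom_zero[OF h]
        simp del: free_alg_simps(1))
  qed (auto simp: N_def free_alg_closed rhom_mult[OF h] simp del: free_alg_simps(1))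
  moreover have "relators n \<alpha> \<beta> \<phi> \<subseteq> N"
    using relators_closed rel unfolding N_def by blast
  ultimately have "rel_ideal n \<alpha> \<beta> \<phi> \<subseteq> N"
    unfolding rel_ideal_def by (rule genideal_minimal)
  with x show ?thesis by (auto simp: N_def)
qed

lemma poly_mapping_as_sum: "(f :: 'm \<Rightarrow>\<^sub>0 'k::comm_monoid_add)
    = (\<Sum>w\<in>Poly_Mapping.keys f. Poly_Mapping.single w (Poly_Mapping.lookup f w))"
  by (rule poly_mapping_eqI)
    (auto simp: lookup_sum lookup_single when_def in_keys_iff)

text \<open>Sending the letters outside \<^term>\<open>gens n\<close> to zero retracts the free algebra on all letters
  onto \<^term>\<open>free_alg n\<close>.\<close>

definition restr :: "nat \<Rightarrow> 'k::field free \<Rightarrow> 'k free"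
  where "restr n = mlift scal (\<lambda>w. if set (letters w) \<subseteq> gens n then Poly_Mapping.single w 1 else 0)"

lemma rhom_restr: "rhom (restr n :: 'k::field free \<Rightarrow> _)"
proof -
  have "Poly_Mapping.single (Word []) 1 = (1 :: 'k free)"
    by (simp flip: zero_fword_def)
  then show ?thesis
    unfolding restr_def
    by (intro rhom_mlift[OF rhom_scal])
      (auto simp: scal_commute zero_fword_def plus_fword_def mult_single)
qed

lemma restr_single: "restr n (Poly_Mapping.single w c)
    = (if set (letters w) \<subseteq> gens n then Poly_Mapping.single w c else 0)"
  by (simp add: restr_def mlift_single[OF rhom_scal]) (simp add: scal_def mult_single)

lemma restr_closed: "restr n f \<in> carrier (free_alg n)"
proof (induction f rule: poly_mapping_single_induct)
  case (single w c)
  then show ?case by (auto simp: restr_single)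
next
  case (add f g)
  then show ?case
    by (simp add: rhom_add[OF rhom_restr] free_alg_closed del: free_alg_simps(1))
qed (simp add: rhom_zero[OF rhom_restr])

lemma restr_id: assumes "f \<in> carrier (free_alg n)" shows "restr n f = f"
proof -
  have "restr n f = (\<Sum>w\<in>Poly_Mapping.keys f. restr n (Poly_Mapping.single w (Poly_Mapping.lookup f w)))"
    by (subst poly_mapping_as_sum) (rule rhom_sum[OF rhom_restr])
  also have "\<dots> = (\<Sum>w\<in>Poly_Mapping.keys f. Poly_Mapping.single w (Poly_Mapping.lookup f w))"
    using assms by (intro sum.cong) (auto simp: restr_single)
  finally show ?thesis by (simp flip: poly_mapping_as_sum)
qed

text \<open>The character needed for the quotient: it sends every generator to \<open>0\<close>, and no relator has a
  constant term.\<close>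

definition augm :: "'k::field free \<Rightarrow> 'k"
  where "augm = mlift (\<lambda>c. c) (\<lambda>w. if w = 0 then 1 else 0)"

lemma rhom_augm: "rhom (augm :: 'k::field free \<Rightarrow> 'k)"
  unfolding augm_def
  by (rule rhom_mlift) (auto simp: zero_fword_def plus_fword_def rhom_def fword.expand)

lemma augm_single: "augm (Poly_Mapping.single w c) = (if w = 0 then c else 0)"
  by (simp add: augm_def mlift_single rhom_def)

lemma augm_gen: "augm (gen_elt g) = 0"
  by (simp add: gen_elt_def augm_single zero_fword_def)

lemma augm_restr: "augm (restr n f) = augm f"
proof (induction f rule: poly_mapping_single_induct)
  case (single w c)
  then show ?case by (auto simp: restr_single augm_single zero_fword_def rhom_zero[OF rhom_augm])
qed (simp_all add: rhom_zero[OF rhom_restr] rhom_add[OF rhom_restr] rhom_add[OF rhom_augm])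

lemma augm_relators: "x \<in> relators n \<alpha> \<beta> \<phi> \<Longrightarrow> augm x = 0"
  by (auto simp: relators_def rhom_simps[OF rhom_augm] augm_gen)

text \<open>The elements of the quotient ring are cosets, which are awkward to compute with. The image of
  \<open>\<Phi>\<close> is a copy of the quotient inside a \<^class>\<open>ring_1\<close>; all computations take place there.\<close>

lemma faithful_rep:
  fixes \<alpha> \<beta> :: "'k::field" and \<phi> :: "'k mpol"
  obtains \<Phi> :: "'k free \<Rightarrow> 'k free endo"
  where "rhom \<Phi>" "\<And>x. x \<in> carrier (free_alg n) \<Longrightarrow> \<Phi> x = 0 \<longleftrightarrow> x \<in> rel_ideal n \<alpha> \<beta> \<phi>"
    "\<And>x. \<Phi> (restr n x) = \<Phi> x"
proof -
  let ?I = "rel_ideal n \<alpha> \<beta> \<phi>"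
  interpret I: ideal ?I "free_alg n" by (rule ideal_rel_ideal)
  define J where "J = {x. restr n x \<in> ?I}"
  note r = rhom_simps[OF rhom_restr]
  obtain \<Phi> :: "'k free \<Rightarrow> 'k free endo" where \<Phi>: "rhom \<Phi>" "\<And>a. \<Phi> a = 0 \<longleftrightarrow> a \<in> J"
  proof (rule quotient_rep[of J augm])
    show "0 \<in> J" using additive_subgroup.zero_closed[OF I.is_additive_subgroup] by (simp add: J_def r)
    show "x + y \<in> J" if "x \<in> J" "y \<in> J" for x y
      using that additive_subgroup.a_closed[OF I.is_additive_subgroup] by (simp add: J_def r)
    show "a * x \<in> J" "x * a \<in> J" if "x \<in> J" for a x
    proof -
      from that have x: "restr n x \<in> ?I" by (simp add: J_def)
      have "restr n a \<otimes>\<^bsub>free_alg n\<^esub> restr n x \<in> ?I" "restr n x \<otimes>\<^bsub>free_alg n\<^esub> restr n a \<in> ?I"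
        by (rule I.I_l_closed[OF x restr_closed], rule I.I_r_closed[OF x restr_closed])
      then show "a * x \<in> J" "x * a \<in> J"
        by (simp_all add: J_def r)
    qed
    show "augm x = 0" if "x \<in> J" for x
      using that kills_rel_ideal[OF rhom_augm augm_relators] augm_restr[of n x]
      unfolding J_def by fastforce
  qed (use rhom_augm in auto)
  show thesis
  proof (rule that[OF \<Phi>(1)])
    show "\<Phi> x = 0 \<longleftrightarrow> x \<in> ?I" if "x \<in> carrier (free_alg n)" for x
      using that by (simp add: \<Phi>(2) J_def restr_id del: free_alg_simps(1))
    have "restr n x - x \<in> J" for x
      using additive_subgroup.zero_closed[OF I.is_additive_subgroup] by (simp add: J_def r restr_id[OF restr_closed])
    then show "\<Phi> (restr n x) = \<Phi> x" for x
      using \<Phi>(2)[of "restr n x - x"] by (simp add: rhom_diff[OF \<Phi>(1)])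
  qed
qed

section \<open>The twisting endomorphism\<close>

text \<open>Throughout, \<open>P = K[t\<^sub>1, \<dots>]\<close> is the type \<^typ>\<open>'k mpol\<close>, and \<^typ>\<open>'k mpol poly poly\<close> is
  \<open>P[w][h]\<close>: the outer variable \<open>h\<close> stands for \<open>ud\<close> and the inner variable \<open>w\<close> for
  \<open>du - r ud\<close>. With this choice the endomorphism \<open>\<sigma>\<close> defined by \<open>d p = \<sigma>(p) d\<close> is triangular:
  \<open>w \<mapsto> s w + \<phi>\<close> and \<open>h \<mapsto> w + r h\<close>, because \<open>\<sigma>(ud) = du\<close> and \<open>w\<close> spans the eigenline of the
  linear part for \<open>s\<close>.\<close>

definition cst :: "'k::field \<Rightarrow> 'k mpol"
  where "cst c = Poly_Mapping.single 0 c"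

lemma rhom_cst: "rhom cst"
  by (rule rhomI) (simp_all add: cst_def single_add mult_single)

lemma cst_eq_0 [simp]: "cst c = 0 \<longleftrightarrow> c = 0"
  by (metis cst_def lookup_single_eq lookup_zero single_zero)

lemma cst_0 [simp]: "cst 0 = 0" and cst_1 [simp]: "cst 1 = 1"
  by (simp_all add: cst_def)

definition twist1 :: "'k::field mpol \<Rightarrow> 'k \<Rightarrow> 'k mpol poly \<Rightarrow> 'k mpol poly"
  where "twist1 \<phi> s = pev (\<lambda>c. [:c:]) [:\<phi>, cst s:]"

definition twist :: "'k::field mpol \<Rightarrow> 'k \<Rightarrow> 'k \<Rightarrow> 'k mpol poly poly \<Rightarrow> 'k mpol poly poly"
  where "twist \<phi> r s = pev (\<lambda>p. [:twist1 \<phi> s p:]) [:[:0, 1:], [:cst r:]:]"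

lemma rhom_pconst: "rhom (\<lambda>c :: 'c::comm_ring_1. [:c:])"
  by (rule rhomI) (simp_all add: one_pCons mult.commute)

lemma rhom_twist1: "rhom (twist1 \<phi> s)"
  unfolding twist1_def by (rule rhom_pev[OF rhom_pconst]) (rule mult.commute)

lemma twist1_const: "twist1 \<phi> s [:c:] = [:c:]"
  and twist1_var: "twist1 \<phi> s [:0, 1:] = [:\<phi>, cst s:]"
  by (simp_all only: twist1_def pev_const[OF rhom_pconst] pev_var[OF rhom_pconst])

lemma rhom_twist: "rhom (twist \<phi> r s)"
  unfolding twist_def
  by (rule rhom_pev[OF rhom_comp[OF rhom_pconst rhom_twist1]]) (rule mult.commute)

lemma twist_inner: "twist \<phi> r s [:p:] = [:twist1 \<phi> s p:]"
  and twist_outer: "twist \<phi> r s [:0, 1:] = [:[:0, 1:], [:cst r:]:]"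
  by (simp_all only: twist_def pev_const[OF rhom_comp[OF rhom_pconst rhom_twist1]]
      pev_var[OF rhom_comp[OF rhom_pconst rhom_twist1]])

lemmas twist_simps = twist_inner twist_outer twist1_const twist1_var

section \<open>Representations of the algebra\<close>

definition tmon :: "nat \<Rightarrow> (nat \<Rightarrow> 'e) \<Rightarrow> (nat \<Rightarrow>\<^sub>0 nat) \<Rightarrow> 'e::monoid_mult"
  where "tmon n t e = (\<Prod>i\<leftarrow>[1..<Suc n]. t i ^ Poly_Mapping.lookup e i)"

lemma commute_power: "a * b = b * a \<Longrightarrow> a * b ^ k = b ^ k * (a :: 'e::monoid_mult)"
  by (metis power_commuting_commutes)

lemma commute_prod_list:
  assumes "\<And>x. x \<in> set xs \<Longrightarrow> a * x = x * a"
  shows "a * prod_list xs = prod_list xs * (a :: 'e::monoid_mult)"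
  using assms
proof (induction xs)
  case (Cons x xs)
  have "a * (x * prod_list xs) = x * (a * prod_list xs)"
    using Cons.prems[of x] by (simp flip: mult.assoc)
  with Cons show ?case by (simp add: mult.assoc)
qed simp

lemma commute_tmon:
  assumes "\<And>i. i \<in> {1..n} \<Longrightarrow> a * t i = t i * a"
  shows "a * tmon n t e = tmon n t e * a"
  unfolding tmon_def by (rule commute_prod_list) (auto intro!: commute_power assms)

lemma tmon_0: "tmon n t 0 = 1"
  unfolding tmon_def lookup_zero power_0 by (simp add: map_replicate_const del: upt_Suc)

lemma tmon_add:
  assumes comm: "\<And>i j. i \<in> {1..n} \<Longrightarrow> j \<in> {1..n} \<Longrightarrow> t i * t j = t j * t i"
  shows "tmon n t (e + f) = tmon n t e * tmon n t f"
proof -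
  have prod: "(\<Prod>i\<leftarrow>xs. t i ^ (a i + b i)) = (\<Prod>i\<leftarrow>xs. t i ^ a i) * (\<Prod>i\<leftarrow>xs. t i ^ b i)"
    if "set xs \<subseteq> {1..n}" for xs and a b :: "nat \<Rightarrow> nat"
    using that
  proof (induction xs)
    case (Cons x xs)
    have "t x ^ b x * t i ^ a i = t i ^ a i * t x ^ b x" if "i \<in> set xs" for i
      by (intro commute_power, intro commute_power[symmetric] comm) (use Cons.prems that in auto)
    then have "t x ^ b x * (\<Prod>i\<leftarrow>xs. t i ^ a i) = (\<Prod>i\<leftarrow>xs. t i ^ a i) * t x ^ b x"
      by (intro commute_prod_list) auto
    then show ?case
      using Cons by (simp add: power_add mult.assoc) (simp flip: mult.assoc)
  qed simp
  show ?thesis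
    unfolding tmon_def lookup_add by (rule prod) auto
qed

lemma commute_mlift:
  assumes "\<And>c. a * \<kappa> c = \<kappa> c * a" "\<And>w. a * m w = m w * a"
  shows "a * mlift \<kappa> m f = mlift \<kappa> m f * a"
proof -
  have "a * (\<kappa> c * m w) = \<kappa> c * m w * a" for c w
    by (metis assms mult.assoc)
  then show ?thesis
    unfolding mlift_def by (simp add: sum_distrib_left sum_distrib_right)
qed

lemma commute_pev:
  assumes "rhom \<kappa>" "\<And>c. a * \<kappa> c = \<kappa> c * a" "a * b = b * a"
  shows "a * pev \<kappa> b p = pev \<kappa> b p * a"
proof (induction p)
  case (pCons c p)
  have "a * (b * pev \<kappa> b p) = b * (a * pev \<kappa> b p)"
    using assms(3) by (simp flip: mult.assoc)
  then show ?case
    by (simp add: pev_pCons[OF assms(1)] distrib_left distrib_right assms(2) pCons.IH mult.assoc)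
qed (simp add: pev_0)

lemma mpol_eval_mlift: "mpol_eval n p = mlift scal (tmon n ft) p"
  by (simp add: mpol_eval_def mlift_def tmon_def)

lemma free_generated [case_names scal gen add mult]:
  assumes "\<And>c. Q (scal c)" "\<And>g. Q (gen_elt g)"
    and "\<And>x y. Q x \<Longrightarrow> Q y \<Longrightarrow> Q (x + y)" "\<And>x y. Q x \<Longrightarrow> Q y \<Longrightarrow> Q (x * y)"
  shows "Q (x :: 'k::field free)"
proof (induction x rule: poly_mapping_single_induct)
  case zero
  then show ?case using assms(1)[of 0] by (simp add: scal_def)
next
  case (single w c)
  have "Q (Poly_Mapping.single (Word xs) c)" for xs
  proof (induction xs rule: rev_induct)
    case Nil
    then show ?case using assms(1)[of c] by (simp add: scal_def zero_fword_def)
  next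
    case (snoc g xs)
    have "Poly_Mapping.single (Word (xs @ [g])) c = Poly_Mapping.single (Word xs) c * gen_elt g"
      by (simp add: gen_elt_def mult_single plus_fword_def)
    then show ?case using assms snoc by metis
  qed
  then show ?case by (cases w) metis
qed (use assms in auto)

text \<open>A homomorphism that kills the relators and the superfluous letters, that is, a representation of
  the algebra. The facts below hold for the faithful representation and for the concrete modules
  that serve to prove linear independence.\<close>

locale gdu_rep =
  fixes n :: nat and \<alpha> \<beta> r s :: "'k::field_char_0" and \<phi> :: "'k mpol"
    and h :: "'k free \<Rightarrow> 'e::ring_1"
  assumes h: "rhom h"
    and relators: "\<And>x. x \<in> relators n \<alpha> \<beta> \<phi> \<Longrightarrow> h x = 0"
    and restr: "\<And>x. h (restr n x) = h x"
    and roots: "r + s = \<alpha>" "r * s = - \<beta>"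
begin

abbreviation "U \<equiv> h fu"
abbreviation "D \<equiv> h fd"
abbreviation "t i \<equiv> h (ft i)"
abbreviation "C c \<equiv> h (scal c)"
abbreviation "T p \<equiv> h (mpol_eval n p)"
abbreviation "W \<equiv> D * U - C r * U * D"
abbreviation "H \<equiv> U * D"
abbreviation "\<sigma> \<equiv> twist \<phi> r s"

lemma rhom_C: "rhom (\<lambda>c. C c)"
  by (rule rhom_comp[OF h rhom_scal])

lemma C_commute: "C c * h x = h x * C c"
  by (metis h rhom_mult scal_commute)

lemma tt: "i \<in> {1..n} \<Longrightarrow> j \<in> {1..n} \<Longrightarrow> t i * t j = t j * t i"
  using relators[of "ft i * ft j - ft j * ft i"] unfolding relators_def
  by (auto simp: rhom_simps[OF h])

lemma tU: "i \<in> {1..n} \<Longrightarrow> t i * U = U * t i"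
  using relators[of "ft i * fu - fu * ft i"] unfolding relators_def
  by (auto simp: rhom_simps[OF h])

lemma tD: "i \<in> {1..n} \<Longrightarrow> t i * D = D * t i"
  using relators[of "ft i * fd - fd * ft i"] unfolding relators_def
  by (auto simp: rhom_simps[OF h])

lemma DDU: "D * D * U = C \<alpha> * D * U * D + C \<beta> * U * D * D + T \<phi> * D"
proof -
  have "fd^2 * fu - (scal \<alpha> * fd * fu * fd + scal \<beta> * fu * fd^2 + mpol_eval n \<phi> * fd)
      \<in> relators n \<alpha> \<beta> \<phi>"
    unfolding relators_def by blast
  from relators[OF this] show ?thesis
    by (simp only: rhom_simps[OF h] power2_eq_square mult.assoc right_minus_eq)
qed

lemma DUU: "D * U * U = C \<alpha> * U * D * U + C \<beta> * U * U * D + U * T \<phi>"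
proof -
  have "fd * fu^2 - (scal \<alpha> * fu * fd * fu + scal \<beta> * fu^2 * fd + fu * mpol_eval n \<phi>)
      \<in> relators n \<alpha> \<beta> \<phi>"
    unfolding relators_def by blast
  from relators[OF this] show ?thesis
    by (simp only: rhom_simps[OF h] power2_eq_square mult.assoc right_minus_eq)
qed

lemma T_mlift: "T p = mlift (\<lambda>c. C c) (tmon n (\<lambda>i. t i)) p"
proof -
  have "h (tmon n ft e) = tmon n (\<lambda>i. t i) e" for e
    by (simp add: tmon_def rhom_prod_list[OF h] rhom_power[OF h] o_def del: upt_Suc)
  then show ?thesis
    unfolding mpol_eval_mlift rhom_mlift_comp[OF h] by simp
qed

lemma T_commute_gen:
  assumes "\<And>i. i \<in> {1..n} \<Longrightarrow> h x * t i = t i * h x"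
  shows "h x * T p = T p * h x"
  unfolding T_mlift by (intro commute_mlift commute_tmon C_commute[symmetric] assms)

lemma TU: "U * T p = T p * U" and TD: "D * T p = T p * D"
  by (rule T_commute_gen, simp add: tU tD)+

lemma rhom_T: "rhom (\<lambda>p. T p)"
  unfolding T_mlift
  by (intro rhom_mlift rhom_C tmon_0 tmon_add tt commute_tmon C_commute)

lemma T_cst: "T (cst c) = C c"
  unfolding T_mlift cst_def by (simp add: mlift_single[OF rhom_C] tmon_0)

text \<open>Oriented commutation rules that move scalars and polynomials in the \<open>t\<^sub>i\<close> to the left.\<close>

lemma move_left:
  "U * C c = C c * U" "U * (C c * z) = C c * (U * z)"
  "D * C c = C c * D" "D * (C c * z) = C c * (D * z)"
  "T p * C c = C c * T p" "T p * (C c * z) = C c * (T p * z)"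
  "U * T p = T p * U" "U * (T p * z) = T p * (U * z)"
  "D * T p = T p * D" "D * (T p * z) = T p * (D * z)"
proof -
  show "U * C c = C c * U" "D * C c = C c * D" "T p * C c = C c * T p"
    "U * T p = T p * U" "D * T p = T p * D"
    by (rule C_commute[symmetric] TU TD)+
  then show "U * (C c * z) = C c * (U * z)" "D * (C c * z) = C c * (D * z)"
    "T p * (C c * z) = C c * (T p * z)"
    "U * (T p * z) = T p * (U * z)" "D * (T p * z) = T p * (D * z)"
    by (simp_all flip: mult.assoc)
qed

lemma C_alpha: "C \<alpha> = C r + C s"
  by (simp only: roots(1)[symmetric] rhom_add[OF rhom_C])

lemma C_beta: "C \<beta> = - (C r * C s)"
proof -
  have "\<beta> = - (r * s)" using roots by simp
  then show ?thesis by (simp only: rhom_simps[OF rhom_C])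
qed

lemma CC: "C c * C d = C d * C c" "C c * (C d * z) = C d * (C c * z)"
  by (rule C_commute, metis C_commute mult.assoc)

text \<open>In terms of the roots and fully reassociated, the two relations become rewrite rules that move
  \<open>d\<close> to the right of \<open>u\<close>.\<close>

lemma DDU': "D * (D * U) = C r * (D * (U * D)) + C s * (D * (U * D)) - C r * (C s * (U * (D * D))) + T \<phi> * D"
  using DDU by (simp add: C_alpha C_beta algebra_simps)

lemma DUU': "D * (U * U) = C r * (U * (D * U)) + C s * (U * (D * U)) - C r * (C s * (U * (U * D))) + T \<phi> * U"
  using DUU by (simp add: C_alpha C_beta algebra_simps TU)

lemma DUUz: "D * (U * (U * z)) = (C r * (U * (D * U)) + C s * (U * (D * U)) - C r * (C s * (U * (U * D))) + T \<phi> * U) * z"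
  by (simp only: DUU'[symmetric] mult.assoc)

text \<open>The combination \<open>w = du - r ud\<close> is chosen so that \<open>d w = (\<phi> + s w) d\<close>: the terms with \<open>r\<close>
  cancel by \<open>r + s = \<alpha>\<close> and \<open>r s = - \<beta>\<close>.\<close>

lemma DW: "D * W = (T \<phi> + C s * W) * D"
  by (simp add: algebra_simps move_left DDU' CC)

lemma WU: "W * U = U * (T \<phi> + C s * W)"
  by (simp add: algebra_simps move_left DUU' CC)

text \<open>Both \<open>(ud) (du)\<close> and \<open>(du) (ud)\<close> reduce to the same element, one by the first and the other by
  the second relation. This is what makes \<open>P[w][h]\<close> act.\<close>

lemma HW: "H * W = W * H"
  by (simp add: algebra_simps move_left DUU' DDU' DUUz CC)

definition ev1 :: "'k mpol poly \<Rightarrow> 'e"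
  where "ev1 = pev (\<lambda>p. T p) W"

definition ev :: "'k mpol poly poly \<Rightarrow> 'e"
  where "ev = pev ev1 H"

lemma TW: "T p * W = W * T p"
  by (simp add: algebra_simps move_left)

lemma TH: "T p * H = H * T p"
  by (simp add: algebra_simps move_left)

lemma rhom_ev1: "rhom ev1"
  unfolding ev1_def by (rule rhom_pev[OF rhom_T TW])

lemma ev1_H: "H * ev1 p = ev1 p * H"
  unfolding ev1_def by (rule commute_pev[OF rhom_T TH[symmetric] HW])

lemma rhom_ev: "rhom ev"
  unfolding ev_def by (rule rhom_pev[OF rhom_ev1 ev1_H[symmetric]])

lemma ev_commute: "ev p * ev q = ev q * ev p"
  by (simp only: rhom_mult[OF rhom_ev, symmetric] mult.commute)

lemma ev_inner: "ev [:p:] = ev1 p" and ev_outer: "ev [:0, 1:] = H"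
  by (simp_all add: ev_def pev_const[OF rhom_ev1] pev_var[OF rhom_ev1])

lemma ev1_const: "ev1 [:p:] = T p" and ev1_var: "ev1 [:0, 1:] = W"
  by (simp_all add: ev1_def pev_const[OF rhom_T] pev_var[OF rhom_T])

lemma ev1_lin: "ev1 [:p, q:] = T p + W * T q"
  by (simp add: ev1_def pev_pCons[OF rhom_T] pev_0)

lemma ev_lin: "ev [:p, q:] = ev1 p + H * ev1 q"
  by (simp add: ev_def pev_pCons[OF rhom_ev1] pev_0)

lemma twist_T: "\<sigma> [:[:c:]:] = [:[:c:]:]"
  by (simp add: twist_simps)

lemma ev_twist_inner: "ev (\<sigma> [:[:0, 1:]:]) = T \<phi> + C s * W"
proof -
  have "ev (\<sigma> [:[:0, 1:]:]) = T \<phi> + W * C s"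
    by (simp only: twist_simps ev_inner ev1_lin T_cst)
  then show ?thesis by (simp only: C_commute[of s "fd * fu - scal r * fu * fd", unfolded rhom_simps[OF h]])
qed

lemma DU_ev: "D * U = ev (\<sigma> [:0, 1:])"
proof -
  have "ev (\<sigma> [:0, 1:]) = W + H * C r"
    by (simp only: twist_simps ev_lin ev1_var ev1_const T_cst)
  then show ?thesis by (simp add: move_left mult.assoc)
qed

text \<open>The commutation rules of a generalised Weyl algebra; only the generators of \<open>P[w][h]\<close> require a
  computation.\<close>

lemma D_ev: "D * ev p = ev (\<sigma> p) * D"
proof (induction p rule: poly2_ring_induct)
  case (const c)
  then show ?case by (simp add: twist_T ev_inner ev1_const TD)
next
  case inner
  show ?case
    by (simp only: ev_twist_inner ev_inner ev1_var DW)
next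
  case outer
  show ?case
    by (simp only: DU_ev[symmetric] ev_outer mult.assoc)
next
  case (mult f g)
  have "D * (ev f * ev g) = ev (\<sigma> f) * (D * ev g)"
    by (simp add: mult(1) flip: mult.assoc)
  then show ?case
    by (simp add: mult(2) rhom_mult[OF rhom_ev] rhom_mult[OF rhom_twist] mult.assoc)
qed (simp add: rhom_add[OF rhom_ev] rhom_add[OF rhom_twist] algebra_simps)

lemma ev_U: "ev p * U = U * ev (\<sigma> p)"
proof (induction p rule: poly2_ring_induct)
  case (const c)
  show ?case by (simp only: twist_T ev_inner ev1_const TU)
next
  case inner
  show ?case
    unfolding ev_twist_inner ev_inner ev1_var by (rule WU)
next
  case outer
  show ?case
    unfolding DU_ev[symmetric] ev_outer by (rule mult.assoc)
next
  case (add f g)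
  then show ?case
    by (simp only: rhom_add[OF rhom_ev] rhom_add[OF rhom_twist] distrib_left distrib_right)
next
  case (mult f g)
  have "ev (f * g) * U = ev f * (ev g * U)"
    by (simp only: rhom_mult[OF rhom_ev] mult.assoc)
  also have "\<dots> = ev f * U * ev (\<sigma> g)"
    unfolding mult(2) by (rule mult.assoc[symmetric])
  also have "\<dots> = U * ev (\<sigma> (f * g))"
    unfolding mult(1) by (simp only: rhom_mult[OF rhom_ev] rhom_mult[OF rhom_twist] mult.assoc)
  finally show ?case .
qed

end

section \<open>Polynomials in \<open>t\<^sub>1, \<dots>, t\<^sub>n\<close>\<close>

definition tvar :: "nat \<Rightarrow> 'k::field mpol"
  where "tvar i = Poly_Mapping.single (Poly_Mapping.single i 1) 1"

text \<open>Evaluation of a polynomial ignores the variables outside \<open>t\<^sub>1, \<dots>, t\<^sub>n\<close>, so it factors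
  through setting them to \<open>1\<close>.\<close>

definition trunc :: "nat \<Rightarrow> 'k::field mpol \<Rightarrow> 'k mpol"
  where "trunc n = mlift cst (tmon n tvar)"

lemma rhom_trunc: "rhom (trunc n)"
  unfolding trunc_def by (intro rhom_mlift rhom_cst tmon_0 tmon_add) (simp_all add: mult.commute)

lemma trunc_cst: "trunc n (cst c) = cst c"
  using mlift_single[OF rhom_cst, of "tmon n tvar" 0 c]
  unfolding trunc_def by (simp add: tmon_0 flip: cst_def)

lemma tvar_power: "tvar i ^ k = Poly_Mapping.single (Poly_Mapping.single i k) (1 :: 'k::field)"
  by (induction k) (simp_all add: tvar_def mult_single flip: single_add)

lemma tmon_tvar:
  assumes "Poly_Mapping.keys e \<subseteq> {1..n}"
  shows "tmon n tvar e = Poly_Mapping.single e (1 :: 'k::field)"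
proof -
  have "(\<Prod>i\<leftarrow>xs. tvar i ^ Poly_Mapping.lookup e i)
      = Poly_Mapping.single (\<Sum>i\<leftarrow>xs. Poly_Mapping.single i (Poly_Mapping.lookup e i)) (1 :: 'k)" for xs
    by (induction xs) (simp_all add: tvar_power mult_single)
  moreover have "(\<Sum>i\<leftarrow>[1..<Suc n]. Poly_Mapping.single i (Poly_Mapping.lookup e i)) = e"
  proof -
    have "(\<Sum>i\<leftarrow>[1..<Suc n]. Poly_Mapping.single i (Poly_Mapping.lookup e i))
        = (\<Sum>i\<in>{1..n}. Poly_Mapping.single i (Poly_Mapping.lookup e i))"
      by (subst sum_list_distinct_conv_sum_set) (auto simp: atLeastLessThanSuc_atLeastAtMost simp del: upt_Suc)
    also have "\<dots> = (\<Sum>i\<in>Poly_Mapping.keys e. Poly_Mapping.single i (Poly_Mapping.lookup e i))"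
      using assms by (intro sum.mono_neutral_right) (auto simp: in_keys_iff)
    also have "\<dots> = e" by (simp flip: poly_mapping_as_sum)
    finally show ?thesis .
  qed
  ultimately show ?thesis unfolding tmon_def by simp
qed

lemma trunc_id: assumes "p \<in> mpols n" shows "trunc n p = p"
proof -
  have "trunc n p = (\<Sum>e\<in>Poly_Mapping.keys p. trunc n (Poly_Mapping.single e (Poly_Mapping.lookup p e)))"
    by (subst poly_mapping_as_sum) (rule rhom_sum[OF rhom_trunc])
  also have "\<dots> = (\<Sum>e\<in>Poly_Mapping.keys p. Poly_Mapping.single e (Poly_Mapping.lookup p e))"
  proof (intro sum.cong refl)
    fix e assume "e \<in> Poly_Mapping.keys p"
    with assms have "tmon n tvar e = Poly_Mapping.single e (1 :: 'a)"
      by (intro tmon_tvar) (auto simp: mpols_def)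
    then show "trunc n (Poly_Mapping.single e (Poly_Mapping.lookup p e)) = Poly_Mapping.single e (Poly_Mapping.lookup p e)"
      unfolding trunc_def mlift_single[OF rhom_cst] by (simp add: cst_def mult_single)
  qed
  finally show ?thesis by (simp flip: poly_mapping_as_sum)
qed

definition trunc1 :: "nat \<Rightarrow> 'k::field mpol poly \<Rightarrow> 'k mpol poly"
  where "trunc1 n = pev (\<lambda>c. [:trunc n c:]) [:0, 1:]"

definition trunc2 :: "nat \<Rightarrow> 'k::field mpol poly poly \<Rightarrow> 'k mpol poly poly"
  where "trunc2 n = pev (\<lambda>p. [:trunc1 n p:]) [:0, 1:]"

lemma rhom_trunc1: "rhom (trunc1 n)"
  unfolding trunc1_def by (rule rhom_pev[OF rhom_comp[OF rhom_pconst rhom_trunc] mult.commute])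

lemma rhom_trunc2: "rhom (trunc2 n)"
  unfolding trunc2_def
  by (rule rhom_pev[OF rhom_comp[OF rhom_pconst rhom_trunc1] mult.commute])

lemma trunc1_simps: "trunc1 n [:c:] = [:trunc n c:]" "trunc1 n [:0, 1:] = [:0, 1:]"
  by (simp_all only: trunc1_def pev_const[OF rhom_comp[OF rhom_pconst rhom_trunc]]
      pev_var[OF rhom_comp[OF rhom_pconst rhom_trunc]])

lemma trunc2_inner: "trunc2 n [:p:] = [:trunc1 n p:]"
  by (simp only: trunc2_def pev_const[OF rhom_comp[OF rhom_pconst rhom_trunc1]])

lemma trunc2_simps: "trunc2 n [:[:c:]:] = [:[:trunc n c:]:]" "trunc2 n [:[:0, 1:]:] = [:[:0, 1:]:]"
  "trunc2 n [:0, 1:] = [:0, 1:]"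
  by (simp_all only: trunc2_inner trunc1_simps)
    (simp only: trunc2_def pev_var[OF rhom_comp[OF rhom_pconst rhom_trunc1]])

lemma twist1_lin: "twist1 \<phi> s [:a, b:] = [:a + \<phi> * b, cst s * b:]"
  by (simp add: twist1_def pev_pCons[OF rhom_pconst] pev_0 mult.commute)

lemma twist_lin: "twist \<phi> r s [:p, q:] = [:twist1 \<phi> s p + [:0, 1:] * twist1 \<phi> s q, [:cst r:] * twist1 \<phi> s q:]"
  by (simp add: twist_def pev_pCons[OF rhom_comp[OF rhom_pconst rhom_twist1]] pev_0 mult.commute)

section \<open>Lifts to the free algebra and comparison of representations\<close>

text \<open>Substitution of \<open>du - r ud\<close> and \<open>ud\<close> already in the free algebra. It is not multiplicative there,
  but its values lift those in every representation, so that an expansion found in the faithful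
  representation can be transported to any other one.\<close>

definition evF1 :: "nat \<Rightarrow> 'k::field \<Rightarrow> 'k mpol poly \<Rightarrow> 'k free"
  where "evF1 n r = pev (mpol_eval n) (fd * fu - scal r * fu * fd)"

definition evF :: "nat \<Rightarrow> 'k::field \<Rightarrow> 'k mpol poly poly \<Rightarrow> 'k free"
  where "evF n r = pev (evF1 n r) (fu * fd)"

lemma mpol_eval_0: "mpol_eval n 0 = 0"
  by (simp add: mpol_eval_def)

lemma evF_0: "evF1 n r 0 = 0" "evF n r 0 = 0"
  by (simp_all add: evF1_def evF_def pev_0)

context gdu_rep
begin

lemma h_evF1: "h (evF1 n r p) = ev1 p"
  by (simp add: ev1_def evF1_def rhom_pev_comp[OF h, of "mpol_eval n", OF mpol_eval_0] rhom_simps[OF h])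

lemma h_evF: "h (evF n r p) = ev p"
  by (simp add: ev_def evF_def rhom_pev_comp[OF h, of "evF1 n r", OF evF_0(1)] rhom_mult[OF h] h_evF1
      cong: if_cong)

lemma kills: "restr n x \<in> rel_ideal n \<alpha> \<beta> \<phi> \<Longrightarrow> h x = 0"
  using kills_rel_ideal[OF h relators] restr by metis

lemma T_tvar: assumes "i \<in> {1..n}" shows "T (tvar i) = t i"
proof -
  have "(\<Prod>j\<leftarrow>xs. t j ^ Poly_Mapping.lookup (Poly_Mapping.single i 1) j) = (if i \<in> set xs then t i else 1)"
    if "distinct xs" for xs
    using that by (induction xs) (auto simp: lookup_single when_def)
  from this[of "[1..<Suc n]"] have "tmon n (\<lambda>i. t i) (Poly_Mapping.single i 1) = t i"
    unfolding tmon_def using assms by (simp del: upt_Suc)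
  then show ?thesis
    unfolding T_mlift tvar_def mlift_single[OF rhom_C] by (simp add: rhom_one[OF rhom_C])
qed

lemma T_trunc: "T (trunc n p) = T p"
proof -
  have "T (trunc n p) = mlift (\<lambda>c. T (cst c)) (\<lambda>e. T (tmon n tvar e)) p"
    unfolding trunc_def by (rule rhom_mlift_comp[OF rhom_T])
  also have "(\<lambda>e. T (tmon n tvar e)) = tmon n (\<lambda>i. t i)"
  proof
    fix e
    have "T (tmon n tvar e) = (\<Prod>i\<leftarrow>[1..<Suc n]. T (tvar i) ^ Poly_Mapping.lookup e i)"
      unfolding tmon_def
      by (simp add: rhom_prod_list[OF rhom_T] rhom_power[OF rhom_T] o_def del: upt_Suc)
    also have "\<dots> = tmon n (\<lambda>i. t i) e"
      unfolding tmon_def by (intro arg_cong[of _ _ prod_list] map_cong) (auto simp: T_tvar)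
    finally show "T (tmon n tvar e) = tmon n (\<lambda>i. t i) e" .
  qed
  finally show ?thesis by (simp only: T_cst T_mlift[of p])
qed

lemma ev_trunc2: "ev (trunc2 n p) = ev p"
  by (induction p rule: poly2_ring_induct)
    (simp_all add: rhom_add[OF rhom_trunc2] rhom_add[OF rhom_ev]
      rhom_mult[OF rhom_trunc2] rhom_mult[OF rhom_ev] trunc2_simps ev_inner ev1_const T_trunc)

end

text \<open>A representation is determined by the actions of \<open>u\<close>, \<open>d\<close> and of the polynomials in the \<open>t\<^sub>i\<close>.\<close>

lemma gdu_rep_exists:
  fixes \<delta> :: "'k::field_char_0 mpol \<Rightarrow> 'e::ring_1" and u d :: 'e
  assumes \<delta>: "rhom \<delta>" and \<delta>u: "\<And>p. \<delta> p * u = u * \<delta> p" and \<delta>d: "\<And>p. \<delta> p * d = d * \<delta> p"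
    and \<phi>: "\<phi> \<in> mpols n" and roots: "r + s = \<alpha>" "r * s = - \<beta>"
    and ddu: "d * d * u = \<delta> (cst \<alpha>) * d * u * d + \<delta> (cst \<beta>) * u * d * d + \<delta> \<phi> * d"
    and duu: "d * u * u = \<delta> (cst \<alpha>) * u * d * u + \<delta> (cst \<beta>) * u * u * d + u * \<delta> \<phi>"
  obtains \<Psi> where "gdu_rep n \<alpha> \<beta> r s \<phi> \<Psi>" "\<Psi> fu = u" "\<Psi> fd = d" "\<And>p. \<Psi> (mpol_eval n p) = \<delta> (trunc n p)"
proof -
  define g where "g x = (case x of Gu \<Rightarrow> u | Gd \<Rightarrow> d | Gt i \<Rightarrow> \<delta> (tvar i))" for x
  define \<Psi> where "\<Psi> = mlift (\<lambda>c. \<delta> (cst c)) (\<lambda>w. prod_list (map g (letters w)))"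
  have \<delta>\<delta>: "\<delta> p * \<delta> q = \<delta> q * \<delta> p" for p q
    by (metis \<delta> rhom_mult mult.commute)
  note rc = rhom_comp[OF \<delta> rhom_cst]
  have \<delta>g: "\<delta> p * g x = g x * \<delta> p" for p x
    by (cases x) (simp_all add: g_def \<delta>u \<delta>d \<delta>\<delta>)
  have \<Psi>: "rhom \<Psi>"
    unfolding \<Psi>_def
    by (intro rhom_mlift rc commute_prod_list)
      (auto simp: zero_fword_def plus_fword_def \<delta>g rhom_one[OF \<delta>])
  have \<Psi>_gen: "\<Psi> (gen_elt x) = g x" and \<Psi>_scal: "\<Psi> (scal c) = \<delta> (cst c)" for x c
    by (simp_all add: \<Psi>_def gen_elt_def scal_def mlift_single[OF rc] rhom_one[OF \<delta>] zero_fword_def)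
  have \<Psi>_T: "\<Psi> (mpol_eval n p) = \<delta> (trunc n p)" for p
    unfolding mpol_eval_mlift trunc_def rhom_mlift_comp[OF \<Psi>] rhom_mlift_comp[OF \<delta>] \<Psi>_scal
    by (simp add: tmon_def rhom_prod_list[OF \<Psi>] rhom_power[OF \<Psi>] rhom_prod_list[OF \<delta>]
        rhom_power[OF \<delta>] o_def \<Psi>_gen g_def del: upt_Suc)
  have restr_fix: "restr n x = x" if "x \<in> {fu, fd} \<union> relators n \<alpha> \<beta> \<phi> \<union> range (mpol_eval n)" for x
  proof (rule restr_id)
    have "fu \<in> carrier (free_alg n :: 'k free ring)" "fd \<in> carrier (free_alg n :: 'k free ring)"
      by (rule free_alg_closed(4), simp add: gens_def)+
    then show "x \<in> carrier (free_alg n)"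
      using that relators_closed mpol_eval_closed by blast
  qed
  have \<Psi>_rel: "\<Psi> x = 0" if "x \<in> relators n \<alpha> \<beta> \<phi>" for x
  proof -
    from that consider
        i j where "x = ft i * ft j - ft j * ft i"
      | i where "x = ft i * fu - fu * ft i"
      | i where "x = ft i * fd - fd * ft i"
      | "x = fd^2 * fu - (scal \<alpha> * fd * fu * fd + scal \<beta> * fu * fd^2 + mpol_eval n \<phi> * fd)"
      | "x = fd * fu^2 - (scal \<alpha> * fu * fd * fu + scal \<beta> * fu^2 * fd + fu * mpol_eval n \<phi>)"
      unfolding relators_def by blast
    then show ?thesis
    proof cases
      case 4
      then show ?thesis using ddu
        by (simp add: rhom_simps[OF \<Psi>] \<Psi>_gen \<Psi>_scal \<Psi>_T trunc_id[OF \<phi>] g_def power2_eq_square mult.assoc)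
    next
      case 5
      then show ?thesis using duu
        by (simp add: rhom_simps[OF \<Psi>] \<Psi>_gen \<Psi>_scal \<Psi>_T trunc_id[OF \<phi>] g_def power2_eq_square mult.assoc)
    qed (simp_all add: rhom_simps[OF \<Psi>] \<Psi>_gen g_def \<delta>u \<delta>d \<delta>\<delta>)
  qed
  have "gdu_rep n \<alpha> \<beta> r s \<phi> (\<lambda>x. \<Psi> (restr n x))"
  proof
    show "rhom (\<lambda>x. \<Psi> (restr n x))" by (rule rhom_comp[OF \<Psi> rhom_restr])
  qed (simp_all add: restr_fix \<Psi>_rel roots restr_id[OF restr_closed])
  then show thesis
    by (rule that) (simp_all add: restr_fix \<Psi>_gen \<Psi>_T, simp_all add: g_def)
qed

text \<open>An equation that holds in the faithful representation holds modulo the relations, hence in every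
  representation.\<close>

lemma rep_equation_transfer:
  assumes "gdu_rep n \<alpha> \<beta> r s \<phi> h'" and "rhom h" "\<And>x. h x = 0 \<longleftrightarrow> restr n x \<in> rel_ideal n \<alpha> \<beta> \<phi>"
    and "h x = h y"
  shows "h' x = h' y"
proof -
  interpret gdu_rep n \<alpha> \<beta> r s \<phi> h' by fact
  have "h (x - y) = 0"
    using assms by (simp add: rhom_diff)
  then have "h' (x - y) = 0"
    using assms(3) kills by blast
  then show ?thesis by (simp add: rhom_diff[OF h])
qed

section \<open>The centre when \<open>\<beta> \<noteq> 0\<close>\<close>

text \<open>For nonzero roots the twist is an automorphism; solving \<open>w' = s w + \<phi>\<close> and \<open>h' = w + r h\<close> gives
  its inverse.\<close>

definition untwist1 :: "'k::field mpol \<Rightarrow> 'k \<Rightarrow> 'k mpol poly \<Rightarrow> 'k mpol poly"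
  where "untwist1 \<phi> s = twist1 (- cst (1 / s) * \<phi>) (1 / s)"

definition untwist :: "'k::field mpol \<Rightarrow> 'k \<Rightarrow> 'k \<Rightarrow> 'k mpol poly poly \<Rightarrow> 'k mpol poly poly"
  where "untwist \<phi> r s = pev (\<lambda>p. [:untwist1 \<phi> s p:])
    [:[:cst (- 1 / r):] * untwist1 \<phi> s [:0, 1:], [:cst (1 / r):]:]"

lemma rhom_untwist1: "rhom (untwist1 \<phi> s)"
  unfolding untwist1_def by (rule rhom_twist1)

lemma rhom_untwist: "rhom (untwist \<phi> r s)"
  unfolding untwist_def
  by (rule rhom_pev[OF rhom_comp[OF rhom_pconst rhom_untwist1]]) (rule mult.commute)

lemma cst_inverse: "r \<noteq> 0 \<Longrightarrow> cst r * (cst (1 / r) * x) = x" "r \<noteq> 0 \<Longrightarrow> cst r * cst (1 / r) = 1"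
  by (simp_all flip: rhom_mult[OF rhom_cst] mult.assoc)

lemma cst_inverse': "r \<noteq> 0 \<Longrightarrow> cst (1 / r) * cst r = 1"
  by (simp flip: rhom_mult[OF rhom_cst])

lemma cst_uminus: "cst (- c) = - cst c"
  by (rule rhom_minus[OF rhom_cst])

lemma twist1_untwist1:
  assumes "s \<noteq> 0"
  shows "twist1 \<phi> s (untwist1 \<phi> s p) = p" "untwist1 \<phi> s (twist1 \<phi> s p) = p"
proof -
  show "twist1 \<phi> s (untwist1 \<phi> s p) = p"
    by (induction p rule: poly_ring_induct)
      (simp_all add: untwist1_def twist1_const twist1_var twist1_lin rhom_add[OF rhom_twist1]
        rhom_mult[OF rhom_twist1] cst_inverse assms mult.commute[of \<phi>])
  show "untwist1 \<phi> s (twist1 \<phi> s p) = p"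
    by (induction p rule: poly_ring_induct)
      (simp_all add: untwist1_def twist1_const twist1_var twist1_lin rhom_add[OF rhom_twist1]
        rhom_mult[OF rhom_twist1] cst_inverse assms mult.commute[of "cst (1 / s)"] mult.assoc)
qed

lemma untwist_inner: "untwist \<phi> r s [:p:] = [:untwist1 \<phi> s p:]"
  and untwist_outer: "untwist \<phi> r s [:0, 1:]
    = [:[:cst (- 1 / r):] * untwist1 \<phi> s [:0, 1:], [:cst (1 / r):]:]"
  by (simp_all only: untwist_def pev_const[OF rhom_comp[OF rhom_pconst rhom_untwist1]]
      pev_var[OF rhom_comp[OF rhom_pconst rhom_untwist1]])

lemma untwist_lin: "untwist \<phi> r s [:p, q:] = [:untwist1 \<phi> s p:]
    + [:[:cst (- 1 / r):] * untwist1 \<phi> s [:0, 1:], [:cst (1 / r):]:] * [:untwist1 \<phi> s q:]"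
  by (simp only: untwist_def pev_pCons[OF rhom_comp[OF rhom_pconst rhom_untwist1]] pev_0 mult_zero_right add_0_right)

lemma poly_hom_id:
  assumes "rhom h" "\<And>p. h [:p:] = [:p:]" "h [:0, 1:] = [:0, 1:]"
  shows "h p = (p :: 'c::comm_ring_1 poly)"
  by (induction p rule: poly_ring_induct)
    (simp_all only: assms(2,3) rhom_add[OF assms(1)] rhom_mult[OF assms(1)])

lemma twist_untwist:
  assumes "r \<noteq> 0" "s \<noteq> 0"
  shows "twist \<phi> r s (untwist \<phi> r s p) = p"
proof (rule poly_hom_id[of "\<lambda>p. twist \<phi> r s (untwist \<phi> r s p)"])
  show "twist \<phi> r s (untwist \<phi> r s [:0, 1:]) = [:0, 1:]"
    by (simp only: untwist_outer twist_lin rhom_mult[OF rhom_twist1] twist1_const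
        twist1_untwist1[OF assms(2)])
      (simp add: cst_inverse' assms cst_uminus)
qed (simp_all only: rhom_comp[OF rhom_twist rhom_untwist] untwist_inner twist_inner twist1_untwist1[OF assms(2)])

lemma untwist_twist:
  assumes "r \<noteq> 0" "s \<noteq> 0"
  shows "untwist \<phi> r s (twist \<phi> r s p) = p"
proof (rule poly_hom_id[of "\<lambda>p. untwist \<phi> r s (twist \<phi> r s p)"])
  have c: "untwist1 \<phi> s [:c:] = [:c:]" for c
    by (simp add: untwist1_def twist1_const)
  show "untwist \<phi> r s (twist \<phi> r s [:0, 1:]) = [:0, 1:]"
    by (simp only: twist_outer untwist_lin c)
      (simp add: cst_inverse' assms cst_uminus)
qed (simp_all only: rhom_comp[OF rhom_untwist rhom_twist] untwist_inner twist_inner twist1_untwist1[OF assms(2)])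

context gdu_rep
begin

abbreviation "\<sigma>' \<equiv> untwist \<phi> r s"

text \<open>A polynomial \<open>F\<close> over \<open>P[w][h]\<close> encodes the finite family of coefficients in
  \<open>\<Sum> u\<^sup>k p\<^sub>k\<close>. The power \<open>d\<^sup>0\<close> would duplicate \<open>u\<^sup>0\<close>, so the second sum starts at \<open>d\<close>.\<close>

definition normal_forms :: "'e set"
  where "normal_forms = {pev ev U F + D * pev ev D G | F G. True}"

lemma pev_ev_pCons: "pev ev a (pCons c F) = ev c + a * pev ev a F"
  by (rule pev_pCons[OF rhom_ev])

lemma pev_ev_add: "pev ev a (F + G) = pev ev a F + pev ev a G"
  by (rule pev_add) (simp_all add: rhom_zero[OF rhom_ev] rhom_add[OF rhom_ev])

lemma pev_ev_mult: "pev ev a F * ev p = pev ev a (smult p F)"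
  by (induction F)
    (simp_all add: pev_0 pev_ev_pCons distrib_right mult.assoc rhom_mult[OF rhom_ev] ev_commute)

lemma U_power_U: "\<exists>F'. pev ev U F * U = U * pev ev U F'"
proof (induction F)
  case (pCons c F)
  then obtain F' where F': "pev ev U F * U = U * pev ev U F'" by blast
  have "pev ev U (pCons c F) * U = U * pev ev U ([:\<sigma> c:] + pCons 0 F')"
    by (simp add: pev_ev_pCons pev_ev_add distrib_left distrib_right mult.assoc F' ev_U pev_0 rhom_zero[OF rhom_ev])
  then show ?case by blast
qed (auto simp: pev_0 intro!: exI[of _ 0])

text \<open>A factor \<open>u\<close> on the right meets \<open>d\<close> and the product \<open>du\<close> is absorbed into the coefficients.\<close>

lemma D_power_U: "\<exists>G'. D * (pev ev D G * U) = pev ev D G'"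
proof (induction G)
  case (pCons c G)
  then obtain G' where G': "D * (pev ev D G * U) = pev ev D G'" by blast
  have "D * (ev c * U) = ev (\<sigma> [:0, 1:] * \<sigma> c)"
    by (simp only: ev_U rhom_mult[OF rhom_ev] DU_ev[symmetric] mult.assoc)
  then have "D * (pev ev D (pCons c G) * U) = pev ev D (pCons (\<sigma> [:0, 1:] * \<sigma> c) G')"
    by (simp only: pev_ev_pCons distrib_left distrib_right mult.assoc G')
  then show ?case by blast
qed (auto simp: pev_0 intro!: exI[of _ 0])

text \<open>Moving a coefficient to the right of \<open>d\<close> requires the inverse of the twist; this is where both
  roots have to be nonzero.\<close>

lemma D_power_D:
  assumes "r \<noteq> 0" "s \<noteq> 0" shows "\<exists>G'. pev ev D G * D = D * pev ev D G'"
proof (induction G)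
  case (pCons c G)
  then obtain G' where G': "pev ev D G * D = D * pev ev D G'" by blast
  have "ev c * D = D * ev (\<sigma>' c)"
    by (simp add: D_ev twist_untwist assms)
  then have "pev ev D (pCons c G) * D = D * pev ev D ([:\<sigma>' c:] + pCons 0 G')"
    by (simp add: pev_ev_pCons pev_ev_add distrib_left distrib_right mult.assoc G' pev_0 rhom_zero[OF rhom_ev])
  then show ?case by blast
qed (auto simp: pev_0 intro!: exI[of _ 0])

lemma U_power_D:
  assumes "r \<noteq> 0" "s \<noteq> 0" shows "\<exists>F'. U * (pev ev U F * D) = pev ev U F'"
proof (induction F)
  case (pCons c F)
  then obtain F' where F': "U * (pev ev U F * D) = pev ev U F'" by blast
  have "ev c * D = D * ev (\<sigma>' c)"
    by (simp add: D_ev twist_untwist assms)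
  then have "U * (ev c * D) = ev ([:0, 1:] * \<sigma>' c)"
    by (simp only: rhom_mult[OF rhom_ev] ev_outer mult.assoc)
  then have "U * (pev ev U (pCons c F) * D) = pev ev U (pCons ([:0, 1:] * \<sigma>' c) F')"
    by (simp only: pev_ev_pCons distrib_left distrib_right mult.assoc F')
  then show ?case by blast
qed (auto simp: pev_0 intro!: exI[of _ 0])

lemma normal_forms_mult_gen:
  assumes rs: "r \<noteq> 0" "s \<noteq> 0" and y: "y \<in> normal_forms"
  shows "y * U \<in> normal_forms" "y * D \<in> normal_forms" "y * ev p \<in> normal_forms"
proof -
  from y obtain F G where y: "y = pev ev U F + D * pev ev D G"
    unfolding normal_forms_def by blast
  obtain F' where F': "pev ev U F * U = U * pev ev U F'" using U_power_U by blast
  obtain G' where G': "D * (pev ev D G * U) = pev ev D G'" using D_power_U by blast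
  obtain c G'' where G'': "G' = pCons c G''" by (cases G')
  have "y * U = pev ev U (pCons c F') + D * pev ev D G''"
    by (simp add: y distrib_right mult.assoc F' G' G'' pev_ev_pCons)
  then show "y * U \<in> normal_forms" unfolding normal_forms_def by blast
  obtain c F1 where F: "F = pCons c F1" by (cases F)
  obtain F2 where F2: "U * (pev ev U F1 * D) = pev ev U F2" using U_power_D[OF rs] by blast
  obtain G2 where G2: "pev ev D G * D = D * pev ev D G2" using D_power_D[OF rs] by blast
  have "ev c * D = D * ev (\<sigma>' c)"
    by (simp add: D_ev twist_untwist rs)
  then have "y * D = pev ev U F2 + D * pev ev D (pCons (\<sigma>' c) G2)"
    by (simp add: y F distrib_right distrib_left mult.assoc F2 G2 pev_ev_pCons)
  then show "y * D \<in> normal_forms" unfolding normal_forms_def by blast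
  have "y * ev p = pev ev U (smult p F) + D * pev ev D (smult p G)"
    by (simp add: y distrib_right mult.assoc pev_ev_mult)
  then show "y * ev p \<in> normal_forms" unfolding normal_forms_def by blast
qed

lemma h_ft: "h (ft i) = (if i \<in> {1..n} then T (tvar i) else 0)"
proof (cases "i \<in> {1..n}")
  case False
  then have "restr n (ft i :: 'k free) = 0"
    by (auto simp: gen_elt_def restr_single gens_def)
  then show ?thesis unfolding if_not_P[OF False] using restr[of "ft i"] by (simp add: rhom_zero[OF h])
qed (simp add: T_tvar)

text \<open>The algebra is generated by \<open>u\<close>, \<open>d\<close> and the polynomials in the \<open>t\<^sub>i\<close>.\<close>

lemma rep_induct [case_names poly U D zero add mult]:
  assumes "\<And>c. Q (T c)" "Q U" "Q D" "Q 0" "\<And>x y. Q x \<Longrightarrow> Q y \<Longrightarrow> Q (x + y)" "\<And>x y. Q x \<Longrightarrow> Q y \<Longrightarrow> Q (x * y)"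
  shows "Q (h x)"
proof (induction x rule: free_generated)
  case (scal c)
  then show ?case using assms(1)[of "cst c"] by (simp add: T_cst)
next
  case (gen g)
  then show ?case by (cases g) (simp_all add: assms h_ft)
qed (simp_all add: assms rhom_add[OF h] rhom_mult[OF h])

lemma mult_closed_all:
  assumes M: "1 \<in> M" "0 \<in> M" "\<And>x y. x \<in> M \<Longrightarrow> y \<in> M \<Longrightarrow> x + y \<in> M"
    and MU: "\<And>y. y \<in> M \<Longrightarrow> y * U \<in> M" and MD: "\<And>y. y \<in> M \<Longrightarrow> y * D \<in> M"
    and Mev: "\<And>y c. y \<in> M \<Longrightarrow> y * T c \<in> M"
  shows "h x \<in> M"
proof -
  have "\<forall>y\<in>M. y * h x \<in> M"
  proof (induction rule: rep_induct)
    case (mult x y)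
    then show ?case by (simp flip: mult.assoc)
  qed (simp_all add: M MU MD Mev distrib_left)
  with M(1) show ?thesis by (metis mult_1)
qed

lemma spanned_by_normal_forms:
  assumes "r \<noteq> 0" "s \<noteq> 0"
  obtains F G where "h x = pev ev U F + D * pev ev D G"
proof -
  have "h x \<in> normal_forms"
  proof (rule mult_closed_all)
    have "1 = pev ev U [:1:] + D * pev ev D 0"
      by (simp add: pev_ev_pCons pev_0 rhom_one[OF rhom_ev])
    then show "1 \<in> normal_forms" unfolding normal_forms_def by blast
    have "0 = pev ev U 0 + D * pev ev D 0"
      by (simp add: pev_0)
    then show "0 \<in> normal_forms" unfolding normal_forms_def by blast
    show "x + y \<in> normal_forms" if "x \<in> normal_forms" "y \<in> normal_forms" for x y
    proof -
      from that obtain F G F' G' where "x = pev ev U F + D * pev ev D G" "y = pev ev U F' + D * pev ev D G'"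
        unfolding normal_forms_def by blast
      then have "x + y = pev ev U (F + F') + D * pev ev D (G + G')"
        by (simp add: pev_ev_add distrib_left)
      then show ?thesis unfolding normal_forms_def by blast
    qed
    show "y * T c \<in> normal_forms" if "y \<in> normal_forms" for y c
      using normal_forms_mult_gen(3)[OF assms that, of "[:[:c:]:]"] by (simp add: ev_inner ev1_const)
  qed (use normal_forms_mult_gen[OF assms] in auto)
  then show thesis using that unfolding normal_forms_def by blast
qed

end

text \<open>Linear independence of the normal forms, and the conditions imposed by centrality, are read off
  from an explicit module: sequences of polynomials indexed by the integers.\<close>

locale twist_auto =
  fixes n :: nat and \<phi> :: "'k::field_char_0 mpol" and r s :: 'k
  assumes r: "r \<noteq> 0" and s: "s \<noteq> 0" and phi: "\<phi> \<in> mpols n"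
begin

abbreviation "\<tau> \<equiv> twist \<phi> r s"
abbreviation "\<tau>' \<equiv> untwist \<phi> r s"

lemmas inverses = twist_untwist[OF r s] untwist_twist[OF r s]

definition zpow :: "int \<Rightarrow> 'k mpol poly poly \<Rightarrow> 'k mpol poly poly"
  where "zpow k = (if k \<ge> 0 then \<tau> ^^ nat k else \<tau>' ^^ nat (- k))"

lemma zpow_0: "zpow 0 p = p"
  by (simp add: zpow_def)

lemma zpow_Suc: "zpow (k + 1) p = \<tau> (zpow k p)"
proof -
  consider "k \<ge> 0" | "k < 0" by linarith
  then show ?thesis
  proof cases
    case 1
    then have "nat (k + 1) = Suc (nat k)" by simp
    with 1 show ?thesis by (simp add: zpow_def)
  next
    case 2
    then have "nat (- k) = Suc (nat (- (k + 1)))" by simp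
    with 2 show ?thesis by (simp add: zpow_def inverses)
  qed
qed

lemma zpow_Suc': "zpow (k + 1) p = zpow k (\<tau> p)"
proof -
  consider "k \<ge> 0" | "k < 0" by linarith
  then show ?thesis
  proof cases
    case 1
    then have "nat (k + 1) = Suc (nat k)" by simp
    with 1 show ?thesis by (simp add: zpow_def funpow_swap1)
  next
    case 2
    then have "nat (- k) = Suc (nat (- (k + 1)))" by simp
    with 2 show ?thesis by (simp add: zpow_def funpow_swap1 inverses)
  qed
qed

lemma zpow_pred: "zpow (k - 1) (\<tau> p) = zpow k p"
  using zpow_Suc'[of "k - 1" p] by simp

lemma rhom_zpow: "rhom (zpow k)"
  by (simp add: zpow_def rhom_funpow rhom_twist rhom_untwist)

lemma twist_inj: "\<tau> p = 0 \<Longrightarrow> p = 0"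
  using inverses(2)[of \<phi> p] rhom_zero[OF rhom_untwist, of \<phi> r s] by simp

lemma zpow_inj:
  assumes "zpow k p = 0" shows "p = 0"
proof -
  have inj': "\<tau>' p = 0 \<Longrightarrow> p = 0" for p
    using inverses(1)[of \<phi> p] rhom_zero[OF rhom_twist, of \<phi> r s] by simp
  have "(\<tau> ^^ m) p = 0 \<Longrightarrow> p = 0" "(\<tau>' ^^ m) p = 0 \<Longrightarrow> p = 0" for m
    by (induction m) (auto dest: twist_inj inj')
  with assms show ?thesis by (auto simp: zpow_def split: if_splits)
qed

lemma twist_funpow_const: "(\<tau> ^^ m) [:[:c:]:] = [:[:c:]:]" "(\<tau>' ^^ m) [:[:c:]:] = [:[:c:]:]"
  by (induction m) (simp_all add: twist_simps untwist_inner untwist1_def)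

lemma zpow_const: "zpow k [:[:c:]:] = [:[:c:]:]"
  by (simp add: zpow_def twist_funpow_const)

lemma zpow_neg_id:
  assumes "\<And>p. zpow (- int m) p = p" shows "(\<tau> ^^ m) p = p"
proof -
  have "(\<tau> ^^ m) ((\<tau>' ^^ m) p) = p" for p
    by (induction m arbitrary: p) (simp_all add: funpow_swap1 inverses)
  moreover have "(\<tau>' ^^ m) p = p" for p
    using assms[of p] by (cases "m = 0") (simp_all add: zpow_def)
  ultimately show ?thesis by metis
qed

text \<open>The element \<open>u\<close> shifts and \<open>d\<close> shifts back with the weights that make \<open>du\<close> act on the \<open>k\<close>-th
  entry as \<open>\<sigma>\<^sup>k(du)\<close>. Then every polynomial in \<open>ud\<close> and \<open>du\<close> acts on the \<open>k\<close>-th entry through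
  \<open>\<sigma>\<^sup>k\<close>.\<close>

definition diag :: "(int \<Rightarrow> 'k mpol poly poly) \<Rightarrow> (int \<Rightarrow> 'k mpol poly poly) endo"
  where "diag m = Endo (\<lambda>v k. m k * v k)"

definition shift_up :: "(int \<Rightarrow> 'k mpol poly poly) endo"
  where "shift_up = Endo (\<lambda>v k. v (k - 1))"

definition shift_down :: "(int \<Rightarrow> 'k mpol poly poly) endo"
  where "shift_down = Endo (\<lambda>v k. zpow k (\<tau> [:0, 1:]) * v (k + 1))"

lemma app_diag: "app (diag m) v k = m k * v k"
  and app_up: "app shift_up v k = v (k - 1)"
  and app_down: "app shift_down v k = zpow k (\<tau> [:0, 1:]) * v (k + 1)"
  unfolding diag_def shift_up_def shift_down_def
  by (subst Endo_inverse; simp add: fun_eq_iff distrib_left)+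

lemmas app_simps = plus_endo.rep_eq times_endo.rep_eq minus_endo.rep_eq zero_endo.rep_eq
  one_endo.rep_eq app_diag app_up app_down

definition \<delta> :: "'k mpol \<Rightarrow> (int \<Rightarrow> 'k mpol poly poly) endo"
  where "\<delta> p = diag (\<lambda>_. [:[:p:]:])"

lemma rhom_cc: "rhom (\<lambda>p :: 'k mpol. [:[:p:]:])"
  by (rule rhom_comp[OF rhom_pconst rhom_pconst])

lemma rhom_\<delta>: "rhom \<delta>"
  by (rule rhomI; rule endo_eqI)
    (simp_all add: \<delta>_def app_simps rhom_simps[OF rhom_cc] distrib_right mult.assoc
      del: mult_pCons_left mult_pCons_right add_pCons)

lemma twist_outer_eq: "\<tau> [:0, 1:] = [:[:0, 1:]:] + [:[:cst r:]:] * [:0, 1:]"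
  by (simp add: twist_simps)

lemma twist_twist_outer:
  "\<tau> (\<tau> [:0, 1:]) = [:[:cst (r + s):]:] * \<tau> [:0, 1:] + [:[:cst (- (r * s)):]:] * [:0, 1:] + [:[:\<phi>:]:]"
proof -
  have w: "\<tau> [:[:0, 1:]:] = [:[:\<phi>:]:] + [:[:cst s:]:] * [:[:0, 1:]:]"
    and c: "\<tau> [:[:c:]:] = [:[:c:]:]" for c
    by (simp_all add: twist_simps)
  have "\<tau> (\<tau> [:0, 1:]) = \<tau> ([:[:0, 1:]:] + [:[:cst r:]:] * [:0, 1:])"
    by (simp only: twist_outer_eq)
  also have "\<dots> = [:[:\<phi>:]:] + [:[:cst s:]:] * [:[:0, 1:]:] + [:[:cst r:]:] * \<tau> [:0, 1:]"
    by (simp only: rhom_add[OF rhom_twist] rhom_mult[OF rhom_twist] w c)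
  also have "[:[:0, 1:]:] = \<tau> [:0, 1:] - [:[:cst r:]:] * [:0, 1:]"
    by (simp only: twist_outer_eq add_diff_cancel_right')
  finally show ?thesis
    by (simp add: rhom_simps[OF rhom_cst] rhom_simps[OF rhom_cc] algebra_simps
        del: mult_pCons_left mult_pCons_right add_pCons minus_pCons)
qed

text \<open>The operator \<open>\<sigma>\<^sup>2 - (r + s) \<sigma> + r s\<close> sends \<open>ud\<close> to \<open>\<phi>\<close>. For the weights of the module below
  this is exactly what the two defining relations require.\<close>

lemma zpow_recurrence: "zpow (k + 1) (\<tau> [:0, 1:]) = [:[:cst (r + s):]:] * zpow k (\<tau> [:0, 1:])
    + [:[:cst (- (r * s)):]:] * zpow (k - 1) (\<tau> [:0, 1:]) + [:[:\<phi>:]:]"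
  unfolding zpow_Suc' twist_twist_outer by (simp only: rhom_add[OF rhom_zpow] rhom_mult[OF rhom_zpow] zpow_const zpow_pred)

lemma sequence_rep:
  obtains \<Psi> where "gdu_rep n (r + s) (- (r * s)) r s \<phi> \<Psi>" "\<Psi> fu = shift_up" "\<Psi> fd = shift_down"
    "\<And>p. \<Psi> (mpol_eval n p) = \<delta> (trunc n p)"
proof (rule gdu_rep_exists[OF rhom_\<delta> _ _ phi])
  have rec: "zpow (k + 1) (\<tau> [:0, 1:]) = [:[:cst (r + s):]:] * zpow k (\<tau> [:0, 1:])
    + [:[:cst (- (r * s)):]:] * zpow (k - 1) (\<tau> [:0, 1:]) + [:[:\<phi>:]:]" for k
    using zpow_recurrence[of k] by simp
  have rec': "zpow k (\<tau> [:0, 1:]) = [:[:cst (r + s):]:] * zpow (k - 1) (\<tau> [:0, 1:])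
    + [:[:cst (- (r * s)):]:] * zpow (k - 2) (\<tau> [:0, 1:]) + [:[:\<phi>:]:]" for k
    using rec[of "k - 1"] by simp
  show "shift_down * shift_down * shift_up = \<delta> (cst (r + s)) * shift_down * shift_up * shift_down
      + \<delta> (cst (- (r * s))) * shift_up * shift_down * shift_down + \<delta> \<phi> * shift_down"
    apply (rule endo_eqI)
    subgoal for v k
      by (simp add: app_simps \<delta>_def rec[of k] distrib_left distrib_right mult_ac add.commute[of 1 k]
          del: mult_pCons_left mult_pCons_right)
    done
  show "shift_down * shift_up * shift_up = \<delta> (cst (r + s)) * shift_up * shift_down * shift_up
      + \<delta> (cst (- (r * s))) * shift_up * shift_up * shift_down + shift_up * \<delta> \<phi>"
    apply (rule endo_eqI)
    subgoal for v k
      by (simp add: app_simps \<delta>_def rec'[of k] distrib_left distrib_right mult_ac add.commute[of 1 k]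
          del: mult_pCons_left mult_pCons_right)
    done
  show "\<delta> p * shift_up = shift_up * \<delta> p" "\<delta> p * shift_down = shift_down * \<delta> p" for p
    by (rule endo_eqI; simp add: app_simps \<delta>_def)+
qed (use that in auto)

end

lemma (in gdu_rep) pev_ev_map_trunc2: "pev ev a (map_poly (trunc2 n) F) = pev ev a F"
  by (induction F) (simp_all add: pev_0 pev_ev_pCons map_poly_pCons rhom_zero[OF rhom_trunc2] ev_trunc2)

lemma (in gdu_rep) h_pevF: "h (pev (evF n r) a F) = pev ev (h a) F"
  by (simp add: rhom_pev_comp[OF h, of "evF n r", OF evF_0(2)] h_evF)

text \<open>Let \<open>z\<close> be central and apply it to the sequence \<open>e\<^sub>0\<close> concentrated in degree \<open>0\<close>. The entries
  of \<open>z e\<^sub>0\<close> are the coefficients of the normal form of \<open>z\<close>, up to the nonzero products of weights that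
  the powers of \<open>d\<close> pick up. Commuting with \<open>p \<in> P[w][h]\<close> gives \<open>(\<sigma>\<^sup>k(p) - p) v\<^sub>k = 0\<close> for the
  \<open>k\<close>-th entry \<open>v\<^sub>k\<close>, and commuting with \<open>u\<close> gives \<open>\<sigma>(v\<^sub>k) = v\<^sub>k\<close>.\<close>

theorem central_normal_form:
  fixes \<Phi> :: "'k::field_char_0 free \<Rightarrow> 'e::ring_1"
  assumes rep: "gdu_rep n \<alpha> \<beta> r s \<phi> \<Phi>" and faithful: "\<And>x. \<Phi> x = 0 \<longleftrightarrow> restr n x \<in> rel_ideal n \<alpha> \<beta> \<phi>"
    and phi: "\<phi> \<in> mpols n" and r: "r \<noteq> 0" and s: "s \<noteq> 0"
    and central: "\<And>x. \<Phi> z * \<Phi> x = \<Phi> x * \<Phi> z"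
  obtains F G where "\<Phi> z = pev (gdu_rep.ev n r \<Phi>) (\<Phi> fu) F + \<Phi> fd * pev (gdu_rep.ev n r \<Phi>) (\<Phi> fd) G"
    "\<And>k. twist \<phi> r s (coeff F k) = coeff F k" "\<And>k. twist \<phi> r s (coeff G k) = coeff G k"
    "\<And>k p. coeff F k \<noteq> 0 \<Longrightarrow> (twist \<phi> r s ^^ k) p = p"
    "\<And>k p. coeff G k \<noteq> 0 \<Longrightarrow> (twist \<phi> r s ^^ Suc k) p = p"
proof -
  interpret \<Phi>: gdu_rep n \<alpha> \<beta> r s \<phi> \<Phi> by (fact rep)
  interpret twist_auto n \<phi> r s by standard (fact r s phi)+
  have ab: "\<alpha> = r + s" "\<beta> = - (r * s)" using \<Phi>.roots by simp_all
  obtain \<Psi> where \<Psi>: "gdu_rep n \<alpha> \<beta> r s \<phi> \<Psi>" and up: "\<Psi> fu = shift_up" and down: "\<Psi> fd = shift_down"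
    and T: "\<And>p. \<Psi> (mpol_eval n p) = \<delta> (trunc n p)"
    unfolding ab using sequence_rep by blast
  interpret \<Psi>: gdu_rep n \<alpha> \<beta> r s \<phi> \<Psi> by (fact \<Psi>)
  note transfer = rep_equation_transfer[OF \<Psi> \<Phi>.h faithful]
  have app_ev: "app (\<Psi>.ev p) v k = zpow k (trunc2 n p) * v k" for p v k
  proof (induction p arbitrary: v rule: poly2_ring_induct)
    case (const c)
    then show ?case by (simp add: \<Psi>.ev_inner \<Psi>.ev1_const T \<delta>_def app_diag trunc2_simps zpow_const)
  next
    case inner
    have "\<Psi> (scal r) = \<delta> (cst r)"
      by (metis \<Psi>.T_cst T trunc_cst)
    moreover have "zpow k (\<tau> [:0, 1:]) - [:[:cst r:]:] * zpow (k - 1) (\<tau> [:0, 1:]) = zpow k [:[:0, 1:]:]"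
      unfolding zpow_pred by (simp only: twist_outer_eq rhom_add[OF rhom_zpow] rhom_mult[OF rhom_zpow] zpow_const add_diff_cancel_right')
    ultimately show ?case
      by (simp add: \<Psi>.ev_inner \<Psi>.ev1_var up down app_simps \<delta>_def trunc2_simps flip: left_diff_distrib mult.assoc
          del: mult_pCons_left mult_pCons_right)
  next
    case outer
    then show ?case by (simp add: \<Psi>.ev_outer up down app_simps trunc2_simps zpow_pred)
  qed (simp_all add: rhom_add[OF \<Psi>.rhom_ev] rhom_add[OF rhom_trunc2] rhom_add[OF rhom_zpow] distrib_right app_simps
      rhom_mult[OF \<Psi>.rhom_ev] rhom_mult[OF rhom_trunc2] rhom_mult[OF rhom_zpow] mult.assoc)
  obtain F G where FG: "\<Phi> z = pev \<Phi>.ev (\<Phi> fu) F + \<Phi> fd * pev \<Phi>.ev (\<Phi> fd) G"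
    using \<Phi>.spanned_by_normal_forms[OF r s] by blast
  have "\<Phi> z = \<Phi> (pev (evF n r) fu F + fd * pev (evF n r) fd G)"
    by (simp add: FG rhom_add[OF \<Phi>.h] rhom_mult[OF \<Phi>.h] \<Phi>.h_pevF)
  then have "\<Psi> z = \<Psi> (pev (evF n r) fu F + fd * pev (evF n r) fd G)"
    by (rule transfer)
  then have \<Psi>z: "\<Psi> z = pev \<Psi>.ev shift_up F + pev \<Psi>.ev shift_down (pCons 0 G)"
    by (simp add: rhom_add[OF \<Psi>.h] rhom_mult[OF \<Psi>.h] \<Psi>.h_pevF up down \<Psi>.pev_ev_pCons rhom_zero[OF \<Psi>.rhom_ev])
  define e0 :: "int \<Rightarrow> 'k mpol poly poly" where "e0 k = (if k = 0 then 1 else 0)" for k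
  have e0: "e0 0 = 1" "k \<noteq> 0 \<Longrightarrow> e0 k = 0" for k
    by (simp_all add: e0_def)
  define v where "v = app (\<Psi> z) e0"
  have upF: "app (pev \<Psi>.ev shift_up F) e0 k = (if k \<ge> 0 then trunc2 n (coeff F (nat k)) else 0)" for k F
  proof (induction F arbitrary: k)
    case 0
    then show ?case by (simp add: pev_0 app_simps rhom_zero[OF rhom_trunc2])
  next
    case (pCons c F)
    have "nat k = Suc (nat (k - 1))" if "k > 0" using that by simp
    then show ?case
      by (cases k "0 :: int" rule: linorder_cases)
        (simp_all add: \<Psi>.pev_ev_pCons app_simps app_ev pCons.IH e0 zpow_0)
  qed
  \<comment> \<open>The product of the weights that \<open>d\<^sup>m\<close> picks up on its way from degree \<open>0\<close> to degree \<open>-m\<close>.\<close>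
  define P where "P = rec_nat (1 :: 'k mpol poly poly) (\<lambda>m x. zpow (- int (Suc m)) (\<tau> [:0, 1:]) * x)"
  have P_0: "P 0 = 1" and P_Suc: "P (Suc m) = zpow (- int (Suc m)) (\<tau> [:0, 1:]) * P m" for m
    by (simp_all add: P_def)
  have downG: "app (pev \<Psi>.ev shift_down G) e0 k
      = (if k \<le> 0 then P (nat (- k)) * trunc2 n (coeff G (nat (- k))) else 0)" for k G
  proof (induction G arbitrary: k)
    case 0
    then show ?case by (simp add: pev_0 app_simps rhom_zero[OF rhom_trunc2])
  next
    case (pCons c G)
    have "nat (- k) = Suc (nat (- (k + 1)))" "- int (Suc (nat (- (k + 1)))) = k" if "k < 0"
      using that by simp_all
    then show ?case
      by (cases k "0 :: int" rule: linorder_cases)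
        (simp_all add: \<Psi>.pev_ev_pCons app_simps app_ev pCons.IH e0 zpow_0 P_0 P_Suc del: of_nat_Suc)
  qed
  have v_nonneg: "v (int k) = trunc2 n (coeff F k)" for k
    by (cases "k = 0") (simp_all add: v_def \<Psi>z app_simps upF downG rhom_zero[OF rhom_trunc2])
  have v_neg: "v (- int (Suc k)) = P (Suc k) * trunc2 n (coeff G k)" for k
    by (simp add: v_def \<Psi>z app_simps upF downG nat_add_distrib)
  have comm: "\<Psi> z * \<Psi> x = \<Psi> x * \<Psi> z" for x
    using transfer[of "z * x" "x * z"] central[of x]
    by (simp add: rhom_mult[OF \<Phi>.h] rhom_mult[OF \<Psi>.h])
  \<comment> \<open>Shifting the index and applying the twist to each entry commutes with the action, and so does
    multiplication of all entries by one fixed polynomial.\<close>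
  have twisted: "app (\<Psi> x) (\<lambda>k. \<tau> (w (k - 1))) k = \<tau> (app (\<Psi> x) w (k - 1))" for x w k
  proof -
    have "\<forall>w. app (\<Psi> x) (\<lambda>k. \<tau> (w (k - 1))) = (\<lambda>k. \<tau> (app (\<Psi> x) w (k - 1)))"
    proof (induction x rule: \<Psi>.rep_induct)
      case (mult x y)
      then show ?case by (simp add: times_endo.rep_eq)
    qed (simp_all add: fun_eq_iff T up down \<delta>_def app_simps rhom_mult[OF rhom_twist] rhom_add[OF rhom_twist]
        rhom_zero[OF rhom_twist] \<Psi>.twist_T zpow_Suc[symmetric] del: mult_pCons_left mult_pCons_right)
    then show ?thesis by metis
  qed
  have linear: "app (\<Psi> x) (\<lambda>k. q * w k) k = q * app (\<Psi> x) w k" for x q w k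
  proof -
    have "\<forall>w. app (\<Psi> x) (\<lambda>k. q * w k) = (\<lambda>k. q * app (\<Psi> x) w k)"
    proof (induction x rule: \<Psi>.rep_induct)
      case (mult x y)
      then show ?case by (simp add: times_endo.rep_eq)
    qed (simp_all add: fun_eq_iff T up down \<delta>_def app_simps distrib_left mult_ac
        del: mult_pCons_left mult_pCons_right)
    then show ?thesis by metis
  qed
  have inv: "\<tau> (v k) = v k" for k
  proof -
    have "app (\<Psi> fu) e0 = (\<lambda>k. \<tau> (e0 (k - 1)))"
      by (auto simp: up app_simps e0_def fun_eq_iff rhom_one[OF rhom_twist] rhom_zero[OF rhom_twist])
    then have "app (\<Psi> z) (app (\<Psi> fu) e0) (k + 1) = \<tau> (v k)"
      by (simp add: twisted v_def)
    moreover have "app (\<Psi> z) (app (\<Psi> fu) e0) = app (\<Psi> fu) v"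
      unfolding v_def by (metis comm times_endo.rep_eq)
    ultimately show ?thesis by (simp add: up app_up)
  qed
  have period: "zpow k p = p" if "v k \<noteq> 0" for k p
  proof -
    have fix_gen: "zpow k q = q" if "trunc2 n q = q" for q
    proof -
      have "app (\<Psi>.ev q) e0 = (\<lambda>k. q * e0 k)"
        by (auto simp: app_ev e0_def fun_eq_iff that zpow_0)
      then have "app (\<Psi> z) (app (\<Psi>.ev q) e0) k = q * v k"
        by (simp add: linear v_def)
      moreover have "app (\<Psi> z) (app (\<Psi>.ev q) e0) = app (\<Psi>.ev q) v"
        unfolding v_def \<Psi>.h_evF[symmetric] by (metis comm times_endo.rep_eq)
      ultimately have "(zpow k q - q) * v k = 0"
        by (simp add: app_ev that left_diff_distrib)
      then show ?thesis using \<open>v k \<noteq> 0\<close> by simp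
    qed
    show ?thesis
      by (induction p rule: poly2_ring_induct)
        (simp_all add: zpow_const fix_gen[OF trunc2_simps(2)] fix_gen[OF trunc2_simps(3)] rhom_add[OF rhom_zpow] rhom_mult[OF rhom_zpow])
  qed
  have outer_nz: "\<tau> [:0, 1:] \<noteq> 0" using twist_inj[of "[:0, 1:]"] by auto
  have P_nz: "P m \<noteq> 0" for m
    using outer_nz by (induction m) (auto simp: P_0 P_Suc dest: zpow_inj)
  \<comment> \<open>The twist shifts the factors of this product by one place, so it fixes the product as soon as
    the weights are periodic with period \<open>m\<close>.\<close>
  have P_cycle: "\<tau> (P m) * zpow (- int m) (\<tau> [:0, 1:]) = P m * \<tau> [:0, 1:]" for m
  proof (induction m)
    case (Suc m)
    have "\<tau> (zpow (- int (Suc m)) (\<tau> [:0, 1:])) = zpow (- int m) (\<tau> [:0, 1:])"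
      by (simp flip: zpow_Suc)
    then have "\<tau> (P (Suc m)) * zpow (- int (Suc m)) (\<tau> [:0, 1:])
        = (\<tau> (P m) * zpow (- int m) (\<tau> [:0, 1:])) * zpow (- int (Suc m)) (\<tau> [:0, 1:])"
      by (simp only: P_Suc rhom_mult[OF rhom_twist] mult_ac)
    also have "\<dots> = P (Suc m) * \<tau> [:0, 1:]"
      unfolding Suc.IH by (simp only: P_Suc mult_ac)
    finally show ?case .
  qed (simp add: P_0 rhom_one[OF rhom_twist] zpow_0)
  show thesis
  proof (rule that[of "map_poly (trunc2 n) F" "map_poly (trunc2 n) G"])
    have coeff: "coeff (map_poly (trunc2 n) H) k = trunc2 n (coeff H k)" for H k
      by (simp add: coeff_map_poly rhom_zero[OF rhom_trunc2])
    show "\<Phi> z = pev \<Phi>.ev (\<Phi> fu) (map_poly (trunc2 n) F) + \<Phi> fd * pev \<Phi>.ev (\<Phi> fd) (map_poly (trunc2 n) G)"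
      by (simp add: FG \<Phi>.pev_ev_map_trunc2)
    show "\<tau> (coeff (map_poly (trunc2 n) F) k) = coeff (map_poly (trunc2 n) F) k" for k
      using inv[of "int k"] by (simp add: coeff v_nonneg)
    show "(\<tau> ^^ k) p = p" if "coeff (map_poly (trunc2 n) F) k \<noteq> 0" for k p
      using period[of "int k" p] that by (simp add: coeff v_nonneg zpow_def)
    show id: "(\<tau> ^^ Suc k) p = p" if "coeff (map_poly (trunc2 n) G) k \<noteq> 0" for k p
    proof (rule zpow_neg_id)
      fix p
      have "v (- int (Suc k)) \<noteq> 0"
        using that P_nz[of "Suc k"] unfolding v_neg coeff by simp
      then show "zpow (- int (Suc k)) p = p" by (rule period)
    qed
    show "\<tau> (coeff (map_poly (trunc2 n) G) k) = coeff (map_poly (trunc2 n) G) k" for k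
    proof (cases "coeff (map_poly (trunc2 n) G) k = 0")
      case False
      then have "v (- int (Suc k)) \<noteq> 0"
        using P_nz[of "Suc k"] unfolding v_neg coeff by simp
      then have "zpow (- int (Suc k)) (\<tau> [:0, 1:]) = \<tau> [:0, 1:]" by (rule period)
      then have "\<tau> (P (Suc k)) = P (Suc k)"
        using P_cycle[of "Suc k"] outer_nz by simp
      then show ?thesis
        using inv[of "- int (Suc k)"] P_nz[of "Suc k"] unfolding v_neg coeff
        by (simp add: rhom_mult[OF rhom_twist])
    qed (simp add: rhom_zero[OF rhom_twist])
  qed
qed

section \<open>The centre when \<open>\<beta> = 0\<close>\<close>

text \<open>Horner evaluation with the powers of \<open>a\<close> on the right of the coefficients.\<close>

definition qev :: "('c::zero \<Rightarrow> 'e) \<Rightarrow> 'e \<Rightarrow> 'c poly \<Rightarrow> 'e::ring_1"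
  where "qev \<kappa> a p = fold_coeffs (\<lambda>c y. \<kappa> c + y * a) p 0"

lemma qev_0: "qev \<kappa> a 0 = 0"
  by (simp add: qev_def)

lemma qev_pCons: "\<kappa> 0 = 0 \<Longrightarrow> qev \<kappa> a (pCons c p) = \<kappa> c + qev \<kappa> a p * a"
  by (cases "p = 0"; cases "c = 0") (simp_all add: qev_def)

lemma qev_add:
  assumes "rhom \<kappa>" shows "qev \<kappa> a (p + q) = qev \<kappa> a p + qev \<kappa> a q"
proof (induction p arbitrary: q)
  case (pCons c p)
  obtain d q' where q: "q = pCons d q'" by (cases q)
  have "qev \<kappa> a (pCons c p + q) = (\<kappa> c + \<kappa> d) + (qev \<kappa> a p * a + qev \<kappa> a q' * a)"
    by (simp add: q qev_pCons[of \<kappa>] rhom_zero[OF assms] rhom_add[OF assms] pCons.IH distrib_right)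
  then show ?case
    by (simp add: q qev_pCons[of \<kappa>] rhom_zero[OF assms] add_ac)
qed (simp add: qev_0)

lemma rhom_qev_comp: "rhom h \<Longrightarrow> \<kappa> 0 = 0 \<Longrightarrow> h (qev \<kappa> a p) = qev (\<lambda>c. h (\<kappa> c)) (h a) p"
  by (induction p) (simp_all add: qev_0 qev_pCons rhom_zero rhom_add rhom_mult)

context gdu_rep
begin

abbreviation "row \<equiv> qev ev1 D"

text \<open>If \<open>\<beta> = 0\<close>, one root vanishes, and since the roots may be exchanged it is \<open>r\<close>. Then \<open>w = du\<close>, while
  \<open>ud\<close> is a zero divisor modulo the relations and the twist is not injective. The normal forms are now the
  sums of \<open>u\<^sup>i p(w) d\<^sup>k\<close>, encoded as polynomials with rows of polynomials as coefficients.\<close>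

lemma row_0: "row 0 = 0" and row_pCons: "row (pCons c F) = ev1 c + row F * D"
  and row_add: "row (F + G) = row F + row G"
  by (simp_all add: qev_0 qev_pCons rhom_zero[OF rhom_ev1] qev_add[OF rhom_ev1])

lemma pev_row_pCons: "pev row U (pCons F Z) = row F + U * pev row U Z"
  and pev_row_add: "pev row U (Z + Y) = pev row U Z + pev row U Y"
  by (simp_all add: pev_pCons' pev_add row_0 row_add)

lemma ev1_trunc1: "ev1 (trunc1 n p) = ev1 p"
  using ev_trunc2[of "[:p:]"] by (simp add: trunc2_inner ev_inner)

lemma row_trunc1: "row (map_poly (trunc1 n) F) = row F"
  by (induction F) (simp_all add: row_0 row_pCons map_poly_pCons rhom_zero[OF rhom_trunc1] ev1_trunc1)

lemma pev_row_trunc1: "pev row U (map_poly (map_poly (trunc1 n)) Z) = pev row U Z"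
  by (induction Z) (simp_all add: pev_0 pev_row_pCons map_poly_pCons row_trunc1)

lemma D_ev1: "D * ev1 p = ev1 (twist1 \<phi> s p) * D" and ev1_U: "ev1 p * U = U * ev1 (twist1 \<phi> s p)"
  using D_ev[of "[:p:]"] ev_U[of "[:p:]"] by (simp_all add: twist_inner ev_inner)

lemma row_ev1: "\<exists>F'. row F * ev1 p = row F'"
proof (induction F arbitrary: p)
  case (pCons c F)
  then obtain F' where F': "row F * ev1 (twist1 \<phi> s p) = row F'" by blast
  have "row (pCons c F) * ev1 p = ev1 c * ev1 p + row F * ev1 (twist1 \<phi> s p) * D"
    by (simp only: row_pCons distrib_right mult.assoc D_ev1)
  also have "\<dots> = row (pCons (c * p) F')"
    by (simp only: F' row_pCons rhom_mult[OF rhom_ev1])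
  finally show ?case by blast
qed (auto simp: row_0 intro!: exI[of _ 0])

lemma row_U:
  assumes "r = 0" shows "\<exists>c F'. row F * U = U * ev1 c + row F'"
proof (cases F)
  case (pCons c F1)
  obtain F' where F': "row F1 * ev1 [:0, 1:] = row F'" using row_ev1 by blast
  have "D * U = ev1 [:0, 1:]"
  proof -
    have "C r = 0" using assms rhom_zero[OF rhom_C] by simp
    then show ?thesis by (simp only: ev1_var mult_zero_left diff_zero)
  qed
  then have "row F * U = U * ev1 (twist1 \<phi> s c) + row F'"
    by (simp add: pCons row_pCons distrib_right mult.assoc ev1_U F')
  then show ?thesis by blast
qed

lemma spanned_by_rows:
  assumes "r = 0"
  obtains Z where "h x = pev row U Z"
proof -
  have "h x \<in> range (pev row U)"
  proof (rule mult_closed_all)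
    have "1 = pev row U [:[:1:]:]" "0 = pev row U 0"
      by (simp_all add: pev_row_pCons row_pCons pev_0 row_0 rhom_one[OF rhom_ev1])
    then show "1 \<in> range (pev row U)" "0 \<in> range (pev row U)"
      by blast+
    show "x + y \<in> range (pev row U)" if "x \<in> range (pev row U)" "y \<in> range (pev row U)" for x y
    proof -
      from that obtain Z Y where "x = pev row U Z" "y = pev row U Y" by blast
      then have "x + y = pev row U (Z + Y)" by (simp only: pev_row_add)
      then show ?thesis by blast
    qed
    have "\<exists>Y. pev row U Z * U = pev row U Y" for Z
    proof (induction Z)
      case (pCons F Z)
      then obtain Y where Y: "pev row U Z * U = pev row U Y" by blast
      obtain c F' where "row F * U = U * ev1 c + row F'" using row_U[OF assms] by blast
      then have "pev row U (pCons F Z) * U = pev row U (pCons F' ([:[:c:]:] + Y))"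
        by (simp add: pev_row_pCons pev_row_add distrib_right distrib_left mult.assoc Y row_pCons row_0 pev_0)
      then show ?case by blast
    qed (auto simp: pev_0 intro!: exI[of _ 0])
    then show "y * U \<in> range (pev row U)" if "y \<in> range (pev row U)" for y
      using that by blast
    have "\<exists>Y. pev row U Z * D = pev row U Y" for Z
    proof (induction Z)
      case (pCons F Z)
      then obtain Y where Y: "pev row U Z * D = pev row U Y" by blast
      then have "pev row U (pCons F Z) * D = pev row U (pCons (pCons 0 F) Y)"
        by (simp add: pev_row_pCons distrib_right mult.assoc row_pCons rhom_zero[OF rhom_ev1])
      then show ?case by blast
    qed (auto simp: pev_0 intro!: exI[of _ 0])
    then show "y * D \<in> range (pev row U)" if "y \<in> range (pev row U)" for y
      using that by blast
    have "\<exists>Y. pev row U Z * ev1 p = pev row U Y" for Z p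
    proof (induction Z)
      case (pCons F Z)
      then obtain Y where Y: "pev row U Z * ev1 p = pev row U Y" by blast
      obtain F' where "row F * ev1 p = row F'" using row_ev1 by blast
      then have "pev row U (pCons F Z) * ev1 p = pev row U (pCons F' Y)"
        by (simp add: pev_row_pCons distrib_right mult.assoc Y)
      then show ?case by blast
    qed (auto simp: pev_0 intro!: exI[of _ 0])
    then show "y * T c \<in> range (pev row U)" if "y \<in> range (pev row U)" for y c
      using that unfolding ev1_const[symmetric] by blast
  qed
  then show thesis using that by blast
qed

lemma h_rowF: "h (qev (evF1 n r) fd F) = row F"
  by (simp add: rhom_qev_comp[OF h, of "evF1 n r", OF evF_0(1)] h_evF1)

lemma h_pev_rowF: "h (pev (qev (evF1 n r) fd) fu Z) = pev row U Z"
  by (simp add: rhom_pev_comp[OF h, of "qev (evF1 n r) fd", OF qev_0] h_rowF)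

end

text \<open>The module with one basis vector for each \<open>u\<^sup>i d\<^sup>k\<close> over \<open>P[w]\<close>; the formulas are those of left
  multiplication on normal forms.\<close>

locale twist_degenerate =
  fixes n :: nat and \<phi> :: "'k::field_char_0 mpol" and s :: 'k
  assumes phi: "\<phi> \<in> mpols n"
begin

abbreviation "\<tau> \<equiv> twist1 \<phi> s"

type_synonym 'a grid = "nat \<times> nat \<Rightarrow> 'a mpol poly"

definition tw :: "nat \<Rightarrow> 'k mpol poly"
  where "tw i = (\<tau> ^^ i) [:0, 1:]"

lemma twist1_tw: "\<tau> (tw i) = tw (Suc i)"
  by (simp add: tw_def)

definition \<delta> :: "'k mpol \<Rightarrow> 'k grid endo"
  where "\<delta> p = Endo (\<lambda>v x. [:p:] * v x)"

definition up :: "'k grid endo"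
  where "up = Endo (\<lambda>v (i, k). if i = 0 then 0 else v (i - 1, k))"

definition down :: "'k grid endo"
  where "down = Endo (\<lambda>v (i, k). tw i * v (Suc i, k)
    + (if i = 0 \<and> k > 0 then \<tau> (v (0, k - 1)) else 0))"

lemma app_\<delta>: "app (\<delta> p) v x = [:p:] * v x"
  unfolding \<delta>_def by (subst Endo_inverse) (simp_all add: fun_eq_iff distrib_left smult_add_right)

lemma app_up: "app up v (i, k) = (if i = 0 then 0 else v (i - 1, k))"
  unfolding up_def by (subst Endo_inverse) (simp_all add: fun_eq_iff)

lemma app_down: "app down v (i, k) = tw i * v (Suc i, k)
    + (if i = 0 \<and> k > 0 then \<tau> (v (0, k - 1)) else 0)"
  unfolding down_def
  by (subst Endo_inverse) (auto simp add: fun_eq_iff distrib_left rhom_add[OF rhom_twist1] add_ac)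

lemmas app_simps = plus_endo.rep_eq times_endo.rep_eq minus_endo.rep_eq zero_endo.rep_eq
  one_endo.rep_eq app_\<delta> app_up app_down

lemma rhom_\<delta>: "rhom \<delta>"
  by (rule rhomI; rule endo_eqI)
    (simp_all add: app_simps rhom_simps[OF rhom_pconst] distrib_right mult.assoc
      del: mult_pCons_left mult_pCons_right add_pCons)

lemma twist1_power_const: "(\<tau> ^^ i) [:c:] = [:c:]"
  by (induction i) (simp_all add: twist1_const)

lemma tw_Suc: "tw (Suc i) = [:cst s:] * tw i + [:\<phi>:]"
proof -
  have "tw (Suc i) = (\<tau> ^^ i) (\<tau> [:0, 1:])"
    by (simp only: tw_def funpow_swap1 funpow.simps o_apply)
  also have "\<tau> [:0, 1:] = [:cst s:] * [:0, 1:] + [:\<phi>:]"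
    by (simp add: twist1_var)
  finally show ?thesis
    by (simp only: tw_def rhom_add[OF rhom_funpow[OF rhom_twist1]] rhom_mult[OF rhom_funpow[OF rhom_twist1]]
        twist1_power_const)
qed

lemma grid_rep:
  obtains \<Psi> where "gdu_rep n s 0 0 s \<phi> \<Psi>" "\<Psi> fu = up" "\<Psi> fd = down"
    "\<And>p. \<Psi> (mpol_eval n p) = \<delta> (trunc n p)"
proof (rule gdu_rep_exists[OF rhom_\<delta> _ _ phi])
  have twist_const: "\<tau> ([:c:] * p) = [:c:] * \<tau> p" for c p
    by (simp only: rhom_mult[OF rhom_twist1] twist1_const)
  show "down * down * up = \<delta> (cst s) * down * up * down + \<delta> (cst 0) * up * down * down + \<delta> \<phi> * down"
    apply (rule endo_eqI)
    subgoal for v x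
      by (cases x; cases "fst x") (simp_all add: app_simps rhom_mult[OF rhom_twist1]
          rhom_zero[OF rhom_twist1] twist1_tw tw_Suc distrib_left distrib_right mult_ac add_ac
          del: mult_pCons_left mult_pCons_right add_pCons)
    done
  show "down * up * up = \<delta> (cst s) * up * down * up + \<delta> (cst 0) * up * up * down + up * \<delta> \<phi>"
    apply (rule endo_eqI)
    subgoal for v x
      by (cases x; cases "fst x"; cases "fst x - 1") (simp_all add: app_simps
          rhom_zero[OF rhom_twist1] tw_Suc distrib_left distrib_right mult_ac add_ac
          del: mult_pCons_left mult_pCons_right add_pCons)
    done
  show "\<delta> p * up = up * \<delta> p" "\<delta> p * down = down * \<delta> p" for p
    by (rule endo_eqI, case_tac k, simp add: app_simps twist_const distrib_left mult_ac del: mult_pCons_left mult_pCons_right)+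
qed (use that in auto)

end

text \<open>The entries \<open>v\<^sub>i\<^sub>k\<close> of \<open>z e\<^sub>0\<close> are the coefficients of the normal form of \<open>z\<close>. Comparing \<open>z d\<close>
  with \<open>d z\<close> gives \<open>v\<^sub>i\<^sub>k = \<sigma>\<^sup>i(w) v\<^sub>i\<^sub>+\<^sub>1\<^sub>,\<^sub>k\<^sub>+\<^sub>1\<close> for \<open>i > 0\<close>, so all these entries vanish because only
  finitely many are nonzero, and then \<open>\<sigma>(v\<^sub>0\<^sub>k) = v\<^sub>0\<^sub>k\<close>. Comparing \<open>z u\<close> with \<open>u z\<close> leaves only
  \<open>v\<^sub>0\<^sub>0\<close>.\<close>

theorem central_normal_form_degenerate:
  fixes \<Phi> :: "'k::field_char_0 free \<Rightarrow> 'e::ring_1"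
  assumes rep: "gdu_rep n \<alpha> \<beta> 0 s \<phi> \<Phi>" and faithful: "\<And>x. \<Phi> x = 0 \<longleftrightarrow> restr n x \<in> rel_ideal n \<alpha> \<beta> \<phi>"
    and phi: "\<phi> \<in> mpols n"
    and central: "\<And>x. \<Phi> z * \<Phi> x = \<Phi> x * \<Phi> z"
  obtains c where "\<Phi> z = gdu_rep.ev1 n 0 \<Phi> c" "twist1 \<phi> s c = c"
proof -
  interpret \<Phi>: gdu_rep n \<alpha> \<beta> 0 s \<phi> \<Phi> by (fact rep)
  interpret twist_degenerate n \<phi> s by standard (fact phi)
  have ab: "\<alpha> = s" "\<beta> = 0" using \<Phi>.roots by simp_all
  obtain \<Psi> where \<Psi>: "gdu_rep n \<alpha> \<beta> 0 s \<phi> \<Psi>" and U: "\<Psi> fu = up" and D: "\<Psi> fd = down"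
    and T: "\<And>p. \<Psi> (mpol_eval n p) = \<delta> (trunc n p)"
    unfolding ab using grid_rep by blast
  interpret \<Psi>: gdu_rep n \<alpha> \<beta> 0 s \<phi> \<Psi> by (fact \<Psi>)
  note transfer = rep_equation_transfer[OF \<Psi> \<Phi>.h faithful]
  note rp = rhom_funpow[OF rhom_twist1]
  have app_ev1: "app (\<Psi>.ev1 p) v (i, k) = (\<tau> ^^ i) (trunc1 n p) * v (i, k)" for p v i k
  proof (induction p arbitrary: v rule: poly_ring_induct)
    case (const c)
    then show ?case
      by (simp add: \<Psi>.ev1_const T app_\<delta> trunc1_simps twist1_power_const del: mult_pCons_left)
  next
    case var
    have "\<Psi> (scal 0) = 0"
      using rhom_zero[OF \<Psi>.rhom_C] by simp
    then have "\<Psi>.ev1 [:0, 1:] = down * up"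
      by (simp only: \<Psi>.ev1_var U D mult_zero_left diff_zero)
    then show ?case
      by (simp add: app_simps rhom_zero[OF rhom_twist1] trunc1_simps tw_def)
  qed (simp_all add: rhom_add[OF \<Psi>.rhom_ev1] rhom_add[OF rhom_trunc1] rhom_add[OF rp] distrib_right app_simps
      rhom_mult[OF \<Psi>.rhom_ev1] rhom_mult[OF rhom_trunc1] rhom_mult[OF rp] mult.assoc)
  obtain Z0 where Z0: "\<Phi> z = pev \<Phi>.row (\<Phi> fu) Z0"
    using \<Phi>.spanned_by_rows by blast
  define Z where "Z = map_poly (map_poly (trunc1 n)) Z0"
  have \<Phi>Z: "\<Phi> z = pev \<Phi>.row (\<Phi> fu) Z"
    by (simp add: Z0 Z_def \<Phi>.pev_row_trunc1)
  have \<Psi>Z: "\<Psi> z = pev \<Psi>.row up Y" if "\<Phi> z = pev \<Phi>.row (\<Phi> fu) Y" for Y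
  proof -
    have "\<Phi> z = \<Phi> (pev (qev (evF1 n 0) fd) fu Y)"
      by (simp only: that \<Phi>.h_pev_rowF)
    then have "\<Psi> z = \<Psi> (pev (qev (evF1 n 0) fd) fu Y)"
      by (rule transfer)
    then show ?thesis
      by (simp only: \<Psi>.h_pev_rowF U)
  qed
  have comm: "\<Psi> z * \<Psi> x = \<Psi> x * \<Psi> z" for x
    using transfer[of "z * x" "x * z"] central[of x]
    by (simp add: rhom_mult[OF \<Phi>.h] rhom_mult[OF \<Psi>.h])
  define e :: "nat \<Rightarrow> 'k grid" where "e j = (\<lambda>x. if x = (0, j) then 1 else 0)" for j
  have e_simps: "e j (i, k) = (if i = 0 \<and> k = j then 1 else 0)" for i j k
    by (simp add: e_def)
  have appD: "app (\<Psi> fd) w (i, k) = app down w (i, k)" for w i k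
    by (simp add: D)
  have down_e: "app (\<Psi> fd) (e j) = e (Suc j)" for j
    unfolding D by (rule ext) (auto simp: app_down e_simps rhom_one[OF rhom_twist1] rhom_zero[OF rhom_twist1] split: prod.split)
  have row_e: "app (\<Psi>.row F) (e j) (i, k) = (if i = 0 \<and> j \<le> k then trunc1 n (coeff F (k - j)) else 0)" for F i j k
  proof (induction F arbitrary: j)
    case 0
    then show ?case by (simp add: \<Psi>.row_0 app_simps rhom_zero[OF rhom_trunc1])
  next
    case (pCons c F)
    have "x2 = k - Suc j" if "k - j = Suc x2" for x2
      using that by simp
    then show ?case
      by (auto simp: \<Psi>.row_pCons app_simps app_ev1 down_e pCons.IH e_simps coeff_pCons
          split: nat.split)
  qed
  have pev_e: "app (pev \<Psi>.row up Z) (e 0) (i, k) = trunc1 n (coeff (coeff Z i) k)" for Z i k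
  proof (induction Z arbitrary: i)
    case 0
    then show ?case by (simp add: pev_0 app_simps rhom_zero[OF rhom_trunc1])
  next
    case (pCons F Z)
    have "pev \<Psi>.row up (pCons F Z) = \<Psi>.row F + up * pev \<Psi>.row up Z"
      using \<Psi>.pev_row_pCons unfolding U .
    then show ?case
      by (cases i) (simp_all add: app_simps row_e pCons.IH)
  qed
  define v where "v = app (\<Psi> z) (e 0)"
  have v: "v (i, k) = coeff (coeff Z i) k" for i k
    unfolding v_def \<Psi>Z[OF Z0] pev_e Z_def
    by (simp add: coeff_map_poly rhom_zero[OF rhom_trunc1])
  define \<Theta> :: "'k grid \<Rightarrow> 'k grid" where "\<Theta> w = (\<lambda>(i, k). if k = 0 then 0 else w (i, k - 1))" for w
  have \<Theta>: "\<Theta> w (i, k) = (if k = 0 then 0 else w (i, k - 1))" for w i k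
    by (simp add: \<Theta>_def)
  \<comment> \<open>Shifting the second index is right multiplication by \<open>d\<close>, hence it commutes with the action.\<close>
  have shifted: "app (\<Psi> x) (\<Theta> w) = \<Theta> (app (\<Psi> x) w)" for x w
  proof -
    have "\<forall>w. app (\<Psi> x) (\<Theta> w) = \<Theta> (app (\<Psi> x) w)"
    proof (induction x rule: \<Psi>.rep_induct)
      case (mult x y)
      then show ?case by (simp add: times_endo.rep_eq)
    qed (auto simp: fun_eq_iff T U D \<Theta> app_simps rhom_zero[OF rhom_twist1] simp del: mult_pCons_left)
    then show ?thesis by blast
  qed
  have vD: "\<Theta> v = app down v"
  proof -
    have "\<Theta> (e 0) = app (\<Psi> fd) (e 0)"
      unfolding down_e by (rule ext) (auto simp: \<Theta> e_simps split: prod.split)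
    then have "\<Theta> v = app (\<Psi> z * \<Psi> fd) (e 0)"
      unfolding v_def shifted[symmetric] by (simp add: times_endo.rep_eq)
    also have "\<dots> = app down v"
      unfolding comm by (simp add: times_endo.rep_eq D v_def)
    finally show ?thesis .
  qed
  have step: "v (Suc i, k) = tw (Suc i) * v (Suc (Suc i), Suc k)" for i k
    using fun_cong[OF vD, of "(Suc i, Suc k)"] by (simp add: \<Theta> app_down)
  have far: "v (i, k) = 0" if "i > degree Z" for i k
    using that by (simp add: v coeff_eq_0)
  have v_Suc: "v (Suc i, k) = 0" for i k
  proof (induction "degree Z - i" arbitrary: i k)
    case 0
    then show ?case by (intro far) simp
  next
    case (Suc m)
    then have "v (Suc (Suc i), Suc k) = 0" by simp
    then show ?case using step[of i k] by simp
  qed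
  have fixed: "\<tau> (v (0, k)) = v (0, k)" for k
    using fun_cong[OF vD, of "(0, Suc k)"] v_Suc[of 0 "Suc k"] by (simp add: \<Theta> app_down)
  have "coeff Z (Suc i) = 0" for i
    using v_Suc[of i] by (intro poly_eqI) (simp add: v)
  then have Z_row: "Z = [:coeff Z 0:]"
    by (intro poly_eqI) (simp add: coeff_pCons split: nat.split)
  define F where "F = coeff Z 0"
  have row_0: "\<Phi> z = \<Phi>.row F" "\<Psi> z = \<Psi>.row F"
    using \<Phi>Z \<Psi>Z[OF \<Phi>Z] \<Phi>.pev_row_pCons[of F 0] \<Psi>.pev_row_pCons[of F 0]
    unfolding Z_row[folded F_def] U by (simp_all add: pev_0)
  have support: "app (\<Psi>.row F) w (Suc i, k) = 0" if "\<And>i k. w (Suc i, k) = 0" for F w i k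
    using that
  proof (induction F arbitrary: w)
    case (pCons c F)
    have "app (\<Psi>.row F) (app (\<Psi> fd) w) (Suc i, k) = 0"
      by (rule pCons.IH) (simp add: appD app_down pCons.prems)
    then show ?case by (simp add: \<Psi>.row_pCons app_simps app_ev1 pCons.prems)
  qed (simp add: \<Psi>.row_0 app_simps)
  have v_0: "v (0, Suc k) = 0" for k
  proof -
    obtain c F' where F: "F = pCons c F'" by (cases F)
    have "v (0, Suc k) = app (\<Psi> z * \<Psi> fu) (e 0) (1, Suc k)"
      unfolding comm by (simp add: times_endo.rep_eq U app_up v_def)
    also have "\<dots> = app (\<Psi>.row F') (app (\<Psi> fd) (app up (e 0))) (Suc 0, Suc k)"
      by (simp add: row_0 F \<Psi>.row_pCons app_simps app_ev1 U e_simps)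
    also have "\<dots> = 0"
      by (rule support) (simp add: appD app_simps e_simps)
    finally show ?thesis .
  qed
  have "coeff F (Suc k) = 0" for k
    using v_0[of k] by (simp add: v F_def)
  then have "F = [:coeff F 0:]"
    by (intro poly_eqI) (simp add: coeff_pCons split: nat.split)
  moreover have "coeff F 0 = v (0, 0)"
    by (simp add: v F_def)
  ultimately have "\<Phi> z = \<Phi>.ev1 (v (0, 0))"
    using row_0(1) \<Phi>.row_pCons[of "v (0, 0)" 0] by (simp add: \<Phi>.row_0)
  then show thesis
    by (rule that) (rule fixed)
qed

section \<open>Invariants of the twist\<close>

inductive_set pgen :: "'k::field mpol poly poly set \<Rightarrow> 'k mpol poly poly set"
  for G where
    const: "[:[:c:]:] \<in> pgen G"
  | incl: "g \<in> G \<Longrightarrow> g \<in> pgen G"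
  | add: "f \<in> pgen G \<Longrightarrow> g \<in> pgen G \<Longrightarrow> f + g \<in> pgen G"
  | mult: "f \<in> pgen G \<Longrightarrow> g \<in> pgen G \<Longrightarrow> f * g \<in> pgen G"

lemma pgen_zero: "0 \<in> pgen G"
  using pgen.const[of 0] by simp

lemma pgen_sum: "(\<And>i. i \<in> A \<Longrightarrow> f i \<in> pgen G) \<Longrightarrow> (\<Sum>i\<in>A. f i) \<in> pgen G"
  by (induction A rule: infinite_finite_induct) (simp_all add: pgen_zero pgen.add)

text \<open>Eigenvectors of the twist for the eigenvalues \<open>s\<close> and \<open>r\<close>, that is
  \<open>du - r ud + \<phi>/(s - 1)\<close> and \<open>du - s ud + \<phi>/(r - 1)\<close>. If \<open>s = 1\<close> and \<open>\<phi> \<noteq> 0\<close>, the first one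
  is not an eigenvector, since the division by zero yields \<open>w\<close>, which is translated by \<open>\<phi>\<close>.\<close>

definition eigX :: "'k::field mpol \<Rightarrow> 'k \<Rightarrow> 'k mpol poly"
  where "eigX \<phi> s = [:cst (1 / (s - 1)) * \<phi>, 1:]"

definition eigY :: "'k::field mpol \<Rightarrow> 'k \<Rightarrow> 'k \<Rightarrow> 'k mpol poly poly"
  where "eigY \<phi> r s = [:[:cst (1 / (r - 1)) * \<phi>, 1:], [:cst (r - s):]:]"

lemma twist1_pcompose: "twist1 \<phi> s p = pcompose p [:\<phi>, cst s:]"
  by (induction p) (simp_all add: rhom_zero[OF rhom_twist1],
      simp add: twist1_def pev_pCons[OF rhom_pconst] pcompose_pCons)

lemma twist_pCons: "twist \<phi> r s (pCons c f) = [:twist1 \<phi> s c:] + [:[:0, 1:], [:cst r:]:] * twist \<phi> r s f"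
  unfolding twist_def by (rule pev_pCons[OF rhom_comp[OF rhom_pconst rhom_twist1]])

lemma cst_diff: "cst (a - b) = cst a - cst b"
  by (rule rhom_diff[OF rhom_cst])

lemma cst_mult: "cst (a * b) = cst a * cst b"
  by (rule rhom_mult[OF rhom_cst])

lemma cst_power: "cst (a ^ k) = cst a ^ k"
  by (rule rhom_power[OF rhom_cst])

lemma cst_eq_1 [simp]: "cst c = 1 \<longleftrightarrow> c = 1"
  using cst_eq_0[of "c - 1"] by (simp add: cst_diff del: cst_eq_0)

lemma eig_const:
  assumes "s \<noteq> 1 \<or> \<phi> = 0"
  shows "cst (1 / (s - 1)) * \<phi> + \<phi> = cst s * (cst (1 / (s - 1)) * \<phi>)"
proof (cases "\<phi> = 0")
  case False
  with assms have "s * (1 / (s - 1)) = 1 / (s - 1) + 1"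
    by (simp add: field_simps)
  then have "cst s * cst (1 / (s - 1)) = cst (1 / (s - 1)) + 1"
    by (metis cst_mult rhom_add[OF rhom_cst] cst_1)
  then show ?thesis
    by (simp add: distrib_right flip: mult.assoc)
qed simp

lemma twist1_eigX:
  "s \<noteq> 1 \<or> \<phi> = 0 \<Longrightarrow> twist1 \<phi> s (eigX \<phi> s) = [:cst s:] * eigX \<phi> s"
  using eig_const[of s \<phi>] by (simp add: eigX_def twist1_lin)

lemma twist_eigY:
  "r \<noteq> 1 \<or> \<phi> = 0 \<Longrightarrow> twist \<phi> r s (eigY \<phi> r s) = [:[:cst r:]:] * eigY \<phi> r s"
  using eig_const[of r \<phi>] by (simp add: eigY_def twist_lin twist1_lin twist1_const cst_diff)

lemma twist_eigX:
  "s \<noteq> 1 \<or> \<phi> = 0 \<Longrightarrow> twist \<phi> r s [:eigX \<phi> s:] = [:[:cst s:]:] * [:eigX \<phi> s:]"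
  by (simp add: twist_inner twist1_eigX)

text \<open>The twist is triangular in \<open>h\<close>, so it acts on the leading coefficient by itself.\<close>

lemma coeff_twist_top:
  "degree f \<le> d \<Longrightarrow> degree (twist \<phi> r s f) \<le> d
    \<and> coeff (twist \<phi> r s f) d = [:cst (r ^ d):] * twist1 \<phi> s (coeff f d)"
proof (induction f arbitrary: d)
  case (pCons c f)
  show ?case
  proof (cases "f = 0")
    case True
    then show ?thesis
      by (simp add: twist_inner coeff_pCons rhom_zero[OF rhom_twist1] split: nat.split)
  next
    case False
    with pCons.prems obtain e where d: "d = Suc e" and e: "degree f \<le> e"
      by (cases d) auto
    note IH = pCons.IH[OF e]
    have "degree ([:[:0, 1:], [:cst r:]:] * twist \<phi> r s f) \<le> 1 + e"
      using IH by (intro order.trans[OF degree_mult_le] add_mono) auto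
    moreover have "coeff (twist \<phi> r s f) (Suc e) = 0"
      using IH by (intro coeff_eq_0) simp
    ultimately show ?thesis
      using IH unfolding twist_pCons d by (auto simp: cst_mult mult.commute[of _ "cst r"] intro!: degree_add_le)
  qed
qed (simp add: rhom_zero[OF rhom_twist] rhom_zero[OF rhom_twist1])

text \<open>The next coefficient receives a contribution of the leading one from \<open>h \<mapsto> w + r h\<close>. This is the
  obstruction that excludes \<open>h\<close> from the invariants when \<open>r = s\<close>.\<close>

lemma coeff_twist_second:
  "degree f \<le> Suc d \<Longrightarrow> coeff (twist \<phi> r s f) d = [:cst (r ^ d):] * (twist1 \<phi> s (coeff f d)
     + of_nat (Suc d) * [:0, 1:] * twist1 \<phi> s (coeff f (Suc d)))"
proof (induction f arbitrary: d)
  case (pCons c f)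
  have f: "degree f \<le> d" using pCons.prems by (cases "f = 0") auto
  note top = coeff_twist_top[OF f, of \<phi> r s]
  show ?case
  proof (cases d)
    case 0
    then show ?thesis using top by (simp add: twist_pCons)
  next
    case (Suc e)
    have "coeff (twist \<phi> r s (pCons c f)) d = [:0, 1:] * coeff (twist \<phi> r s f) (Suc e) + [:cst r:] * coeff (twist \<phi> r s f) e"
      by (simp add: twist_pCons Suc)
    also have "coeff (twist \<phi> r s f) e = [:cst (r ^ e):] * (twist1 \<phi> s (coeff f e)
       + of_nat (Suc e) * [:0, 1:] * twist1 \<phi> s (coeff f (Suc e)))"
      using f Suc by (intro pCons.IH) simp
    also have "coeff (twist \<phi> r s f) (Suc e) = [:cst (r ^ Suc e):] * twist1 \<phi> s (coeff f (Suc e))"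
      using top Suc by simp
    also have "[:cst (r ^ Suc e):] = [:cst r:] * [:cst (r ^ e):]"
      by (simp add: cst_mult)
    finally show ?thesis
      by (simp only: Suc coeff_pCons_Suc cst_mult power_Suc of_nat_Suc) (simp add: algebra_simps)
  qed
qed (simp add: rhom_zero[OF rhom_twist] rhom_zero[OF rhom_twist1])

lemma pcompose_as_sum: "pcompose q p = (\<Sum>i\<le>degree (map_poly (\<lambda>c. [:c:]) q). [:coeff q i:] * p ^ i)"
  unfolding pcompose_altdef poly_altdef by (simp add: coeff_map_poly)

text \<open>In the variable \<^const>\<open>eigX\<close> the inner twist is diagonal.\<close>

lemma eigX_coordinates:
  assumes "s \<noteq> 1 \<or> \<phi> = 0"
  obtains q where "p = pcompose q (eigX \<phi> s)" "\<And>i. coeff (pcompose q [:0, cst s:]) i = cst (s ^ i) * coeff q i"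
    "twist1 \<phi> s p = pcompose (pcompose q [:0, cst s:]) (eigX \<phi> s)"
proof -
  define c where "c = cst (1 / (s - 1)) * \<phi>"
  define q where "q = pcompose p [:- c, 1:]"
  have X: "eigX \<phi> s = [:c, 1:]" by (simp add: eigX_def c_def)
  have "pcompose q (eigX \<phi> s) = pcompose p (pcompose [:- c, 1:] [:c, 1:])"
    by (simp only: q_def X pcompose_assoc)
  also have "pcompose [:- c, 1:] [:c, 1:] = [:0, 1:]"
    by (simp add: pcompose_pCons)
  finally have p: "p = pcompose q (eigX \<phi> s)" by simp
  have "twist1 \<phi> s p = pcompose q (twist1 \<phi> s (eigX \<phi> s))"
    unfolding twist1_pcompose by (subst p) (rule pcompose_assoc[symmetric])
  also have "twist1 \<phi> s (eigX \<phi> s) = pcompose [:0, cst s:] (eigX \<phi> s)"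
    unfolding twist1_eigX[OF assms] by (simp add: pcompose_pCons)
  also have "pcompose q \<dots> = pcompose (pcompose q [:0, cst s:]) (eigX \<phi> s)"
    by (rule pcompose_assoc)
  finally have "twist1 \<phi> s p = pcompose (pcompose q [:0, cst s:]) (eigX \<phi> s)" .
  then show thesis
    by (rule that[OF p, rotated]) (simp add: coeff_pcompose_linear cst_power)
qed

lemma pcompose_eigX_inj:
  assumes "pcompose q (eigX \<phi> s) = pcompose q' (eigX \<phi> s)" shows "q = q'"
proof -
  define c where "c = cst (1 / (s - 1)) * \<phi>"
  have "pcompose (eigX \<phi> s) [:- c, 1:] = [:0, 1:]"
    by (simp add: eigX_def c_def pcompose_pCons)
  then have "x = pcompose (pcompose x (eigX \<phi> s)) [:- c, 1:]" for x
    by (simp flip: pcompose_assoc)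
  with assms show ?thesis by metis
qed

lemma eigenvector_expansion:
  assumes "s \<noteq> 1 \<or> \<phi> = 0" and "[:cst \<mu>:] * twist1 \<phi> s p = p"
  obtains q where "p = pcompose q (eigX \<phi> s)" "\<And>i. coeff q i \<noteq> 0 \<Longrightarrow> \<mu> * s ^ i = 1"
proof -
  obtain q where q: "p = pcompose q (eigX \<phi> s)"
    "\<And>i. coeff (pcompose q [:0, cst s:]) i = cst (s ^ i) * coeff q i"
    "twist1 \<phi> s p = pcompose (pcompose q [:0, cst s:]) (eigX \<phi> s)"
    using eigX_coordinates[OF assms(1)] by blast
  have "pcompose ([:cst \<mu>:] * pcompose q [:0, cst s:]) (eigX \<phi> s) = pcompose q (eigX \<phi> s)"
    using assms(2) unfolding pcompose_mult pcompose_const q(3)[symmetric] q(1)[symmetric] .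
  then have "[:cst \<mu>:] * pcompose q [:0, cst s:] = q"
    by (rule pcompose_eigX_inj)
  then have "cst \<mu> * (cst (s ^ i) * coeff q i) = coeff q i" for i
    using q(2)[of i] by (metis coeff_smult mult_pCons_left mult_zero_left pCons_0_0 add.right_neutral)
  then have "(cst (\<mu> * s ^ i) - 1) * coeff q i = 0" for i
    by (simp add: cst_mult left_diff_distrib mult.assoc)
  then have "coeff q i \<noteq> 0 \<Longrightarrow> \<mu> * s ^ i = 1" for i
    by (metis cst_eq_1 mult_eq_0_iff right_minus_eq)
  with q(1) show thesis using that by blast
qed

text \<open>In characteristic zero the orbit of a point under a nontrivial translation is infinite.\<close>

lemma translation_invariant_const:
  fixes p :: "'c::{idom,ring_char_0} poly"
  assumes "pcompose p [:a, 1:] = p" "a \<noteq> 0"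
  obtains c where "p = [:c:]"
proof -
  have "poly p (of_nat k * a) = poly p 0" for k
  proof (induction k)
    case (Suc k)
    have "poly p (of_nat k * a + a) = poly (pcompose p [:a, 1:]) (of_nat k * a)"
      by (simp add: poly_pcompose add.commute)
    with Suc show ?case by (simp add: assms(1) distrib_right add.commute)
  qed simp
  then have "range (\<lambda>k. of_nat k * a) \<subseteq> {x. poly (p - [:poly p 0:]) x = 0}"
    by auto
  moreover have "infinite (range (\<lambda>k :: nat. of_nat k * a))"
    using assms(2) by (intro range_inj_infinite) (auto simp: inj_def)
  ultimately have "p - [:poly p 0:] = 0"
    using poly_roots_finite finite_subset by blast
  then show thesis using that by simp
qed

text \<open>The leading coefficient of an invariant \<open>f\<close> of degree \<open>d\<close> in \<open>h\<close> is an eigenvector for \<open>r\<^sup>-\<^sup>d\<close>.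
  As \<open>Y\<close> has degree one in \<open>h\<close> with leading coefficient \<open>r - s\<close>, subtracting a multiple of
  \<open>p Y\<^sup>d\<close> lowers the degree and keeps \<open>f\<close> invariant.\<close>

lemma invariants_in_Y:
  fixes \<phi> :: "'k::field_char_0 mpol"
  assumes rs: "r \<noteq> s" and Y: "r \<noteq> 1 \<or> \<phi> = 0"
    and G: "\<And>d p. [:cst (r ^ d):] * twist1 \<phi> s p = p \<Longrightarrow> [:p:] * eigY \<phi> r s ^ d \<in> pgen G"
    and f: "twist \<phi> r s f = f"
  shows "f \<in> pgen G"
proof -
  let ?Y = "eigY \<phi> r s"
  have degY: "degree (?Y ^ d) \<le> d" and topY: "coeff (?Y ^ d) d = [:cst ((r - s) ^ d):]" for d
  proof (induction d)
    case (Suc d)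
    { case 1
      have "degree ?Y \<le> 1" by (simp add: eigY_def)
      then show ?case using order.trans[OF degree_mult_le add_mono[OF _ Suc(1)]] by fastforce }
    { case 2
      have "coeff (?Y ^ d) (Suc d) = 0" using Suc(1) by (intro coeff_eq_0) simp
      then show ?case using Suc(2) by (simp add: eigY_def cst_mult) }
  qed simp_all
  have "degree f \<le> d \<Longrightarrow> twist \<phi> r s f = f \<Longrightarrow> f \<in> pgen G" for d
  proof (induction d arbitrary: f)
    case (0 f)
    then obtain c where "f = [:c:]" using degree_eq_zeroE by auto
    with 0(2) G[of 0 c] show ?case by (simp add: twist_inner)
  next
    case (Suc d f)
    define p where "p = coeff f (Suc d)"
    define g where "g = [:p:] * ?Y ^ Suc d"
    define c where "c = cst ((1 / (r - s)) ^ Suc d)"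
    have p: "[:cst (r ^ Suc d):] * twist1 \<phi> s p = p"
      using coeff_twist_top[OF Suc.prems(1), of \<phi> r s] Suc.prems(2) by (simp add: p_def)
    have gG: "g \<in> pgen G" unfolding g_def by (rule G[OF p])
    have "twist \<phi> r s g = [:[:cst (r ^ Suc d):] * twist1 \<phi> s p:] * ?Y ^ Suc d"
      by (simp add: g_def rhom_mult[OF rhom_twist] rhom_power[OF rhom_twist] twist_eigY[OF Y] twist_inner
          power_mult_distrib cst_power poly_const_pow mult_ac del: power_Suc mult_pCons_left mult_pCons_right)
        (simp add: mult_ac)
    then have "twist \<phi> r s g = g" unfolding p g_def .
    then have inv: "twist \<phi> r s (f - [:[:c:]:] * g) = f - [:[:c:]:] * g"
      using Suc.prems(2) by (simp only: rhom_diff[OF rhom_twist] rhom_mult[OF rhom_twist] twist_inner twist1_const)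
    have degg: "degree ([:[:c:]:] * g) \<le> Suc d"
      using degY[of "Suc d"] unfolding g_def
      by (metis (no_types, opaque_lifting) degree_smult_le mult_pCons_left mult_zero_left pCons_0_0 add.right_neutral order.trans)
    have cc: "c * cst ((r - s) ^ Suc d) = 1"
      using rs by (simp add: c_def field_simps flip: cst_mult power_mult_distrib del: power_Suc)
    have "coeff ([:[:c:]:] * g) (Suc d) = [:c:] * (p * coeff (?Y ^ Suc d) (Suc d))"
      by (simp add: g_def del: power_Suc)
    also have "\<dots> = p * [:c * cst ((r - s) ^ Suc d):]"
      unfolding topY by (simp add: mult_ac)
    also have "[:c * cst ((r - s) ^ Suc d):] = 1"
      unfolding cc by simp
    finally have "coeff (f - [:[:c:]:] * g) (Suc d) = 0"
      by (simp only: coeff_diff p_def mult_1_right diff_self)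
    moreover have "degree (f - [:[:c:]:] * g) \<le> Suc d"
      using Suc.prems(1) degg by (rule degree_diff_le)
    ultimately have "degree (f - [:[:c:]:] * g) \<le> d"
      by (metis degree_0 le_Suc_eq leading_coeff_0_iff le0)
    from Suc.IH[OF this inv] have "(f - [:[:c:]:] * g) + [:[:c:]:] * g \<in> pgen G"
      by (intro pgen.add pgen.mult pgen.const gG)
    then show ?case by simp
  qed
  with f show ?thesis by blast
qed

lemma invariants_semisimple:
  fixes \<phi> :: "'k::field_char_0 mpol"
  assumes "r \<noteq> s" "r \<noteq> 1 \<or> \<phi> = 0" "s \<noteq> 1 \<or> \<phi> = 0" "twist \<phi> r s f = f"
  shows "f \<in> pgen {[:eigX \<phi> s:] ^ i * eigY \<phi> r s ^ j | i j. s ^ i * r ^ j = 1}"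
    (is "_ \<in> pgen ?G")
proof (rule invariants_in_Y[OF assms(1,2) _ assms(4)])
  fix d p assume p: "[:cst (r ^ d):] * twist1 \<phi> s p = p"
  obtain q where q: "p = pcompose q (eigX \<phi> s)" "\<And>i. coeff q i \<noteq> 0 \<Longrightarrow> r ^ d * s ^ i = 1"
    using eigenvector_expansion[OF assms(3) p] by blast
  have "[:p:] * eigY \<phi> r s ^ d = (\<Sum>i\<le>degree (map_poly (\<lambda>c. [:c:]) q).
      [:[:coeff q i:]:] * ([:eigX \<phi> s:] ^ i * eigY \<phi> r s ^ d))"
    unfolding q(1) pcompose_as_sum rhom_sum[OF rhom_pconst] rhom_mult[OF rhom_pconst]
      rhom_power[OF rhom_pconst] sum_distrib_right mult.assoc ..
  also have "\<dots> \<in> pgen ?G"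
  proof (rule pgen_sum)
    fix i
    show "[:[:coeff q i:]:] * ([:eigX \<phi> s:] ^ i * eigY \<phi> r s ^ d)
      \<in> pgen ?G"
    proof (cases "coeff q i = 0")
      case False
      then have "s ^ i * r ^ d = 1" using q(2)[of i] by (simp add: mult.commute)
      then show ?thesis by (intro pgen.mult[OF pgen.const] pgen.incl) blast
    qed (simp add: pgen_zero)
  qed
  finally show "[:p:] * eigY \<phi> r s ^ d \<in> pgen ?G" .
qed

lemma invariants_translation:
  fixes \<phi> :: "'k::field_char_0 mpol"
  assumes "r \<noteq> 1" "\<phi> \<noteq> 0" "twist \<phi> r 1 f = f"
  shows "f \<in> pgen {eigY \<phi> r 1 ^ j | j. r ^ j = 1}"
proof (rule invariants_in_Y[OF assms(1) _ _ assms(3)])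
  show "r \<noteq> 1 \<or> \<phi> = 0" using assms(1) by simp
  fix d p assume p: "[:cst (r ^ d):] * twist1 \<phi> 1 p = p"
  show "[:p:] * eigY \<phi> r 1 ^ d \<in> pgen {eigY \<phi> r 1 ^ j | j. r ^ j = 1}"
  proof (cases "p = 0")
    case False
    have "coeff (twist1 \<phi> 1 p) (degree p) = lead_coeff p"
      using lead_coeff_comp[of "[:\<phi>, 1:]" p] by (simp add: twist1_pcompose degree_pcompose)
    then have "cst (r ^ d) * lead_coeff p = lead_coeff p"
      using arg_cong[OF p, of "\<lambda>x. coeff x (degree p)"] by simp
    then have "r ^ d = 1" using False by simp
    with p have "pcompose p [:\<phi>, 1:] = p" by (simp add: twist1_pcompose)
    then obtain c where "p = [:c:]" using translation_invariant_const assms(2) by blast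
    then show ?thesis using \<open>r ^ d = 1\<close>
      by (simp only:) (intro pgen.mult[OF pgen.const] pgen.incl, blast)
  qed (simp add: pgen_zero)
qed

text \<open>For \<open>r = s\<close> the linear part of the twist is a Jordan block. If an invariant had positive degree in
  \<open>h\<close>, with leading coefficient \<open>p\<close>, the next coefficient would have to solve an equation whose right
  hand side is a nonzero multiple of \<open>w p\<close>. In powers of \<open>X\<close> the twist is diagonal, and the coefficient
  just above the degree of \<open>p\<close> gives a contradiction: there the left hand side vanishes.\<close>

lemma invariants_jordan:
  fixes \<phi> :: "'k::field_char_0 mpol"
  assumes r: "r \<noteq> 1 \<or> \<phi> = 0" and f: "twist \<phi> r r f = f"
  shows "f \<in> pgen {[:eigX \<phi> r:] ^ i | i. r ^ i = 1}"
proof -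
  have "degree f = 0"
  proof (rule ccontr)
    assume "degree f \<noteq> 0"
    then obtain e where d: "degree f = Suc e" by (cases "degree f") auto
    define p where "p = coeff f (Suc e)"
    define b where "b = coeff f e"
    note p = conjunct2[OF coeff_twist_top[OF eq_refl[OF d], of \<phi> r r], unfolded f, folded p_def, symmetric]
    note b = coeff_twist_second[OF eq_refl[OF d], of \<phi> r r, unfolded f, folded p_def b_def, symmetric]
    have "p \<noteq> 0"
      unfolding p_def by (metis d degree_0 leading_coeff_0_iff nat.distinct(1))
    have "r \<noteq> 0" using p \<open>p \<noteq> 0\<close> by auto
    obtain q where q: "p = pcompose q (eigX \<phi> r)" "\<And>i. coeff q i \<noteq> 0 \<Longrightarrow> r ^ Suc e * r ^ i = 1"
      using eigenvector_expansion[OF r p] by blast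
    obtain q' where q': "b = pcompose q' (eigX \<phi> r)"
      "\<And>i. coeff (pcompose q' [:0, cst r:]) i = cst (r ^ i) * coeff q' i"
      "twist1 \<phi> r b = pcompose (pcompose q' [:0, cst r:]) (eigX \<phi> r)"
      using eigX_coordinates[OF r] by blast
    define \<kappa> where "\<kappa> = cst (1 / (r - 1)) * \<phi>"
    have w: "[:0, 1:] = pcompose [:- \<kappa>, 1:] (eigX \<phi> r)"
      by (simp add: eigX_def \<kappa>_def pcompose_pCons)
    have "[:cst r:] * b = [:cst (r ^ Suc e):] * twist1 \<phi> r b + of_nat (Suc e) * [:0, 1:] * ([:cst (r ^ Suc e):] * twist1 \<phi> r p)"
    proof -
      have "[:cst r:] * b = [:cst r:] * ([:cst (r ^ e):] * (twist1 \<phi> r b + of_nat (Suc e) * [:0, 1:] * twist1 \<phi> r p))"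
        by (simp only: b)
      then show ?thesis
        by (simp only: power_Suc cst_mult rhom_mult[OF rhom_pconst] distrib_left mult_ac)
    qed
    also have "of_nat (Suc e) = pcompose [:of_nat (Suc e):] (eigX \<phi> r)"
      by (simp only: pcompose_const of_nat_poly)
    finally have "pcompose ([:cst r:] * q') (eigX \<phi> r)
        = pcompose ([:cst (r ^ Suc e):] * pcompose q' [:0, cst r:] + [:of_nat (Suc e):] * [:- \<kappa>, 1:] * q) (eigX \<phi> r)"
      unfolding p by (simp only: w q(1) q'(1) q'(3)[unfolded q'(1)] pcompose_mult pcompose_add pcompose_const)
    then have eq: "[:cst r:] * q' = [:cst (r ^ Suc e):] * pcompose q' [:0, cst r:] + [:of_nat (Suc e):] * [:- \<kappa>, 1:] * q"
      by (rule pcompose_eigX_inj)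
    define i where "i = degree q"
    have "q \<noteq> 0" using q(1) \<open>p \<noteq> 0\<close> by auto
    then have i: "r ^ Suc e * r ^ i = 1" using q(2)[of i] by (simp add: i_def)
    have qi: "coeff q (Suc i) = 0" unfolding i_def by (rule coeff_eq_0) simp
    have "cst r * coeff q' (Suc i) = cst (r ^ Suc e) * (cst (r ^ Suc i) * coeff q' (Suc i)) + of_nat (Suc e) * coeff q i"
      using arg_cong[OF eq, of "\<lambda>x. coeff x (Suc i)"] qi q'(2)[of "Suc i"]
      by (simp add: of_nat_poly algebra_simps del: power_Suc of_nat_Suc)
    also have "cst (r ^ Suc e) * (cst (r ^ Suc i) * coeff q' (Suc i)) = cst (r ^ Suc e * r ^ i * r) * coeff q' (Suc i)"
      by (simp add: cst_mult mult_ac)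
    finally have "of_nat (Suc e) * coeff q i = 0"
      unfolding i by simp
    then have "coeff q i = 0" by (metis mult_eq_0_iff of_nat_neq_0)
    then show False using \<open>q \<noteq> 0\<close> by (simp add: i_def)
  qed
  then obtain c where c: "f = [:c:]" using degree_eq_zeroE by blast
  with f have "[:cst 1:] * twist1 \<phi> r c = c" by (simp add: twist_inner)
  then obtain q where q: "c = pcompose q (eigX \<phi> r)" "\<And>i. coeff q i \<noteq> 0 \<Longrightarrow> 1 * r ^ i = 1"
    using eigenvector_expansion[OF r] by blast
  have "f = (\<Sum>i\<le>degree (map_poly (\<lambda>c. [:c:]) q). [:[:coeff q i:]:] * [:eigX \<phi> r:] ^ i)"
    unfolding c q(1) pcompose_as_sum rhom_sum[OF rhom_pconst] rhom_mult[OF rhom_pconst]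
      rhom_power[OF rhom_pconst] ..
  also have "\<dots> \<in> pgen {[:eigX \<phi> r:] ^ i | i. r ^ i = 1}"
  proof (rule pgen_sum)
    fix i
    show "[:[:coeff q i:]:] * [:eigX \<phi> r:] ^ i \<in> pgen {[:eigX \<phi> r:] ^ i | i. r ^ i = 1}"
    proof (cases "coeff q i = 0")
      case False
      then have "r ^ i = 1" using q(2)[of i] by simp
      then show ?thesis by (intro pgen.mult[OF pgen.const] pgen.incl) blast
    qed (simp add: pgen_zero)
  qed
  finally show ?thesis .
qed

text \<open>The invariant \<open>w\<^sup>2 - \<phi> w - 2 \<phi> h\<close>, that is \<open>(du - ud)\<^sup>2 - \<phi> (du + ud)\<close>, for \<open>r = s = 1\<close>.\<close>

definition quadr :: "'k::field mpol \<Rightarrow> 'k mpol poly poly"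
  where "quadr \<phi> = [:[:0, - \<phi>, 1:], [:- 2 * \<phi>:]:]"

lemma twist_quadr: "twist \<phi> 1 1 (quadr \<phi>) = quadr \<phi>"
  by (simp add: quadr_def twist_lin twist1_pcompose pcompose_pCons algebra_simps)

lemma pcompose_pow: "pcompose (p ^ k) q = pcompose p q ^ k" for p q :: "'c::comm_ring_1 poly"
  by (induction k) (simp_all add: pcompose_mult pcompose_1)

text \<open>Divisibility by \<open>\<psi>\<close> passes from \<open>g \<circ> M\<close> to \<open>g\<close> one leading coefficient at a time, because \<open>M\<close> is
  monic.\<close>

lemma pcompose_monic_divisible:
  fixes M :: "'c::idom poly"
  assumes "lead_coeff M = 1" "degree M > 0" "pcompose g M = smult \<psi> c"
  shows "\<exists>g'. g = smult \<psi> g'"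
proof -
  have "degree g \<le> m \<Longrightarrow> pcompose g M = smult \<psi> c \<Longrightarrow> \<exists>g'. g = smult \<psi> g'" for m
  proof (induction m arbitrary: g c)
    case (0 g c)
    then obtain a where a: "g = [:a:]" using degree_eq_zeroE by auto
    then have "a = \<psi> * coeff c 0" using arg_cong[OF 0(2), of "\<lambda>x. coeff x 0"] by simp
    then have "g = smult \<psi> [:coeff c 0:]" using a by simp
    then show ?case by blast
  next
    case (Suc m g c)
    define a where "a = coeff c (Suc m * degree M)"
    have lead: "coeff g (Suc m) = \<psi> * a"
    proof (cases "degree g = Suc m")
      case True
      have "lead_coeff (pcompose g M) = lead_coeff g"
        using assms(1,2) by (simp add: lead_coeff_comp)
      then have "coeff (pcompose g M) (Suc m * degree M) = coeff g (Suc m)"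
        using True by (simp add: degree_pcompose)
      then show ?thesis using Suc.prems(2) by (simp add: a_def)
    next
      case False
      then have "degree g < Suc m" using Suc.prems(1) by simp
      moreover from this assms(2) have "degree (pcompose g M) < Suc m * degree M"
        by (simp only: degree_pcompose mult_less_cancel2)
      ultimately show ?thesis
        using Suc.prems(2) coeff_eq_0[of g "Suc m"] coeff_eq_0[of "pcompose g M" "Suc m * degree M"]
        by (simp add: a_def)
    qed
    define g1 where "g1 = g - smult \<psi> (smult a ([:0, 1:] ^ Suc m))"
    have "pcompose ([:0, 1:] ^ Suc m) M = M ^ Suc m"
      by (simp add: pcompose_pow pcompose_pCons)
    then have "pcompose g1 M = smult \<psi> (c - smult a (M ^ Suc m))"
      by (simp only: g1_def pcompose_diff pcompose_smult Suc.prems(2) smult_diff_right)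
    moreover have "degree g1 \<le> m"
    proof -
      have "degree g1 \<le> Suc m"
        unfolding g1_def using Suc.prems(1)
        by (intro degree_diff_le order.trans[OF degree_smult_le]) (simp_all add: degree_power_eq)
      moreover have "coeff ([:0, 1:] ^ Suc m :: 'c poly) (Suc m) = 1"
        by (metis coeff_monom monom_altdef smult_1_left)
      then have "coeff g1 (Suc m) = 0"
        unfolding g1_def by (simp add: lead del: power_Suc)
      ultimately show ?thesis
        by (metis degree_0 le_Suc_eq leading_coeff_0_iff le0)
    qed
    ultimately obtain g2 where "g1 = smult \<psi> g2" using Suc.IH by blast
    then have "g = smult \<psi> (g2 + smult a ([:0, 1:] ^ Suc m))"
      by (simp add: g1_def smult_add_right diff_eq_eq del: power_Suc)
    then show ?case by blast
  qed
  with assms(3) show ?thesis by blast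
qed

text \<open>The quadratic invariant has degree one in \<open>h\<close> with leading coefficient \<open>- 2 \<phi>\<close>, and leading
  coefficients of invariants lie in \<open>P\<close>, as they are invariant under the translation by \<open>\<phi>\<close>. Hence the degree
  in \<open>h\<close> of an invariant can be lowered after multiplication by powers of \<open>\<phi>\<close>, which shows that
  \<open>\<phi>\<^sup>N f\<close> is a polynomial in the quadratic invariant. It remains to cancel \<open>\<phi>\<^sup>N\<close>.\<close>

lemma invariants_unipotent:
  fixes \<phi> :: "'k::field_char_0 mpol"
  assumes \<phi>: "\<phi> \<noteq> 0" and f: "twist \<phi> 1 1 f = f"
  shows "f \<in> pgen {quadr \<phi>}"
proof -
  let ?Q = "quadr \<phi>"
  define K :: "'k mpol \<Rightarrow> 'k mpol poly poly" where "K c = [:[:c:]:]" for c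
  have K: "rhom K"
    unfolding K_def by (rule rhom_comp[OF rhom_pconst rhom_pconst])
  define E where "E = pev K ?Q"
  have E: "rhom E"
    unfolding E_def by (rule rhom_pev[OF K mult.commute])
  have E_const: "E [:c:] = K c" and E_var: "E [:0, 1:] = ?Q" for c
    by (simp_all only: E_def pev_const[OF K] pev_var[OF K])
  have inv_const: "\<exists>a. p = [:a:]" if "twist1 \<phi> 1 p = p" for p
    using that translation_invariant_const[of p \<phi>] \<phi> by (auto simp: twist1_pcompose)
  have degQ: "degree (?Q ^ d) \<le> d" and topQ: "coeff (?Q ^ d) d = [:(- 2 * \<phi>) ^ d:]" for d
  proof (induction d)
    case (Suc d)
    { case 1
      have "degree ?Q \<le> 1" by (simp add: quadr_def)
      then show ?case using order.trans[OF degree_mult_le add_mono[OF _ Suc(1)]] by fastforce }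
    { case 2
      have "coeff (?Q ^ d) (Suc d) = 0" using Suc(1) by (intro coeff_eq_0) simp
      then show ?case using Suc(2) by (simp add: quadr_def) }
  qed simp_all
  have K_twist: "twist \<phi> 1 1 (K c) = K c" for c
    by (simp add: K_def twist_simps)
  have "degree f \<le> d \<Longrightarrow> twist \<phi> 1 1 f = f \<Longrightarrow> \<exists>N g. K (\<phi> ^ N) * f = E g" for d
  proof (induction d arbitrary: f)
    case (0 f)
    then obtain c where c: "f = [:c:]" using degree_eq_zeroE by auto
    with 0(2) obtain a where "c = [:a:]" using inv_const by (auto simp: twist_inner)
    then have "K (\<phi> ^ 0) * f = E [:a:]"
      using c by (simp add: E_const K_def)
    then show ?case by blast
  next
    case (Suc d f)
    have "twist1 \<phi> 1 (coeff f (Suc d)) = coeff f (Suc d)"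
      using coeff_twist_top[OF Suc.prems(1), of \<phi> 1 1] Suc.prems(2) by simp
    then obtain a where a: "coeff f (Suc d) = [:a:]" using inv_const by blast
    define g where "g = K ((- 2 * \<phi>) ^ Suc d) * f - K a * ?Q ^ Suc d"
    have "twist \<phi> 1 1 g = g"
      by (simp only: g_def rhom_simps[OF rhom_twist] K_twist twist_quadr Suc.prems(2))
    moreover have "degree g \<le> d"
    proof -
      have "degree (K c * x) \<le> degree x" for c x
        unfolding K_def by (simp add: degree_smult_le)
      then have "degree g \<le> Suc d"
        unfolding g_def using Suc.prems(1) degQ[of "Suc d"] by (meson degree_diff_le order.trans)
      moreover have "coeff g (Suc d) = 0"
        unfolding g_def by (simp add: K_def a topQ mult.commute del: power_Suc)
      ultimately show ?thesis
        by (metis degree_0 le_Suc_eq leading_coeff_0_iff le0)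
    qed
    ultimately obtain N x where x: "K (\<phi> ^ N) * g = E x" using Suc.IH by blast
    define y where "y = x + [:\<phi> ^ N * a:] * [:0, 1:] ^ Suc d"
    have "E y = K (\<phi> ^ N) * (g + K a * ?Q ^ Suc d)"
      by (simp only: y_def rhom_simps[OF E] E_const E_var x[symmetric] rhom_mult[OF K] distrib_left mult.assoc)
    also have "\<dots> = K (\<phi> ^ N) * (K ((- 2 * \<phi>) ^ Suc d) * f)"
      by (simp only: g_def diff_add_cancel)
    also have "(- 2 * \<phi>) ^ Suc d = cst ((- 2) ^ Suc d) * \<phi> ^ Suc d"
    proof -
      have "(- 2 :: 'k mpol) = cst (- 2)"
        using rhom_add[OF rhom_cst, of 1 1] by (simp add: rhom_minus[OF rhom_cst])
      then show ?thesis by (simp only: power_mult_distrib cst_power)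
    qed
    finally have Ey: "E y = K (\<phi> ^ N) * (K (cst ((- 2) ^ Suc d) * \<phi> ^ Suc d) * f)" .
    have "cst ((- 1 / 2) ^ Suc d) * cst ((- 2 :: 'k) ^ Suc d) = 1"
      by (simp add: flip: cst_mult power_mult_distrib del: power_Suc)
    then have "K (cst ((- 1 / 2) ^ Suc d)) * K (cst ((- 2) ^ Suc d)) = 1"
      using rhom_mult[OF K] rhom_one[OF K] by metis
    moreover have "E ([:cst ((- 1 / 2) ^ Suc d):] * y)
        = (K (cst ((- 1 / 2) ^ Suc d)) * K (cst ((- 2) ^ Suc d))) * (K (\<phi> ^ (N + Suc d)) * f)"
      by (simp only: rhom_mult[OF E] E_const Ey power_add rhom_mult[OF K] mult_ac)
    ultimately have "K (\<phi> ^ (N + Suc d)) * f = E ([:cst ((- 1 / 2) ^ Suc d):] * y)"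
      by (simp only: mult_1_left)
    then show ?case by blast
  qed
  with f obtain N g where g: "K (\<phi> ^ N) * f = E g" by blast
  \<comment> \<open>For \<open>h = 0\<close> the quadratic invariant becomes the monic polynomial \<open>w\<^sup>2 - \<phi> w\<close>.\<close>
  have "poly (E x) 0 = pcompose x [:0, - \<phi>, 1:]" for x
    by (induction x rule: poly_ring_induct)
      (simp_all add: E_const E_var rhom_add[OF E] rhom_mult[OF E] pcompose_add pcompose_mult,
       simp_all add: K_def quadr_def pcompose_pCons)
  then have "pcompose g [:0, - \<phi>, 1:] = smult (\<phi> ^ N) (poly f 0)"
    using arg_cong[OF g, of "\<lambda>x. poly x 0"] by (simp add: K_def)
  then obtain g' where "g = smult (\<phi> ^ N) g'"
    using pcompose_monic_divisible[of "[:0, - \<phi>, 1:]" g] by auto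
  then have "E g = K (\<phi> ^ N) * E g'"
    using rhom_mult[OF E, of "[:\<phi> ^ N:]" g'] by (simp add: E_const)
  moreover have "K (\<phi> ^ N) \<noteq> 0" using \<phi> by (simp add: K_def)
  ultimately have "f = E g'" using g by simp
  moreover have "E x \<in> pgen {?Q}" for x
  proof (induction x rule: poly_ring_induct)
    case (const c)
    show ?case unfolding E_const K_def by (rule pgen.const)
  next
    case var
    show ?case unfolding E_var by (rule pgen.incl) simp
  qed (simp_all add: rhom_add[OF E] rhom_mult[OF E] pgen.add pgen.mult)
  ultimately show ?thesis by simp
qed

section \<open>The order of the twist\<close>

lemma twist_power_const: "(twist \<phi> r s ^^ k) [:[:c:]:] = [:[:c:]:]"
  by (induction k) (simp_all add: twist_simps)

lemma twist_power_eigenvector: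
  assumes "twist \<phi> r s x = [:[:cst a:]:] * x"
  shows "(twist \<phi> r s ^^ k) x = [:[:cst (a ^ k):]:] * x"
proof (induction k)
  case (Suc k)
  then show ?case
    by (simp add: rhom_mult[OF rhom_twist] twist_simps assms cst_mult mult.commute[of "cst a"] del: mult_pCons_left)
qed (simp flip: one_pCons)

lemma twist_order_eigenvalue:
  fixes x :: "'k::field_char_0 mpol poly poly"
  assumes "twist \<phi> r s x = [:[:cst a:]:] * x" "x \<noteq> 0" "(twist \<phi> r s ^^ k) x = x"
  shows "a ^ k = 1"
proof -
  have "([:[:cst (a ^ k):]:] - 1) * x = 0"
    using twist_power_eigenvector[OF assms(1), of k] assms(3) by (simp only: left_diff_distrib mult_1_left diff_self)
  then have "[:[:cst (a ^ k):]:] = 1" using assms(2) by simp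
  then show ?thesis by (simp add: one_pCons)
qed

lemma twist_translation_order:
  fixes \<phi> :: "'k::field_char_0 mpol"
  assumes "\<phi> \<noteq> 0" "(twist \<phi> r 1 ^^ k) [:[:0, 1:]:] = [:[:0, 1:]:]"
  shows "k = 0"
proof -
  have "(twist \<phi> r 1 ^^ k) [:[:0, 1:]:] = [:[:of_nat k * \<phi>, 1:]:]"
    by (induction k) (simp_all add: twist_inner twist1_lin algebra_simps)
  with assms show ?thesis by simp
qed

text \<open>The \<open>k\<close>-th power sends \<open>h\<close> to \<open>r\<^sup>k h + k r\<^sup>k\<^sup>-\<^sup>1 w\<close> up to an element of \<open>P\<close>.\<close>

lemma twist_jordan_order:
  fixes \<phi> :: "'k::field_char_0 mpol"
  assumes "(twist \<phi> r r ^^ k) [:0, 1:] = [:0, 1:]"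
  shows "k = 0"
proof (rule ccontr)
  assume "k \<noteq> 0"
  have "\<exists>a. (twist \<phi> r r ^^ k) [:0, 1:] = [:[:a, cst (of_nat k * r ^ (k - 1)):], [:cst (r ^ k):]:]"
  proof (induction k)
    case (Suc k)
    then obtain a where "(twist \<phi> r r ^^ k) [:0, 1:] = [:[:a, cst (of_nat k * r ^ (k - 1)):], [:cst (r ^ k):]:]"
      by blast
    moreover have "cst r * cst (of_nat k * r ^ (k - 1)) + cst (r ^ k) = cst (of_nat (Suc k) * r ^ k)"
      by (cases k) (simp_all add: algebra_simps flip: cst_mult rhom_add[OF rhom_cst])
    ultimately show ?case
      by (simp add: twist_lin twist1_lin twist1_const mult.commute[of r] flip: cst_mult)
  qed simp
  with assms have "cst (of_nat k * r ^ (k - 1)) = 0" "cst (r ^ k) = 1"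
    by (auto simp: one_pCons simp del: cst_eq_0 cst_eq_1)
  then have "of_nat k * r ^ (k - 1) = 0" "r ^ k = 1" by simp_all
  with \<open>k \<noteq> 0\<close> have "r = 0" by simp
  with \<open>r ^ k = 1\<close> \<open>k \<noteq> 0\<close> show False by (simp add: power_0_left)
qed

text \<open>For \<open>r \<noteq> s\<close> the two eigenvectors generate \<open>P[w][h]\<close>.\<close>

lemma twist_power_id:
  fixes \<phi> :: "'k::field_char_0 mpol"
  assumes "r \<noteq> s" "r \<noteq> 1 \<or> \<phi> = 0" "s \<noteq> 1 \<or> \<phi> = 0" "r ^ k = 1" "s ^ k = 1"
  shows "(twist \<phi> r s ^^ k) p = p"
proof -
  let ?t = "twist \<phi> r s ^^ k"
  note t = rhom_funpow[OF rhom_twist]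
  have X: "?t [:eigX \<phi> s:] = [:eigX \<phi> s:]" and Y: "?t (eigY \<phi> r s) = eigY \<phi> r s"
    using twist_power_eigenvector[OF twist_eigX[OF assms(3)], of k] twist_power_eigenvector[OF twist_eigY[OF assms(2)], of k]
    by (simp_all add: assms(4,5) flip: one_pCons)
  have inner: "?t [:[:0, 1:]:] = [:[:0, 1:]:]"
  proof -
    have w: "[:[:0, 1:]:] = [:eigX \<phi> s:] - [:[:cst (1 / (s - 1)) * \<phi>:]:]"
      by (simp add: eigX_def)
    show ?thesis by (simp only: w rhom_diff[OF t] X twist_power_const)
  qed
  have outer: "?t [:0, 1:] = [:0, 1:]"
  proof -
    have "cst (1 / (r - s)) * cst (r - s) = 1"
      using assms(1) by (intro cst_inverse') simp
    then have h: "[:0, 1:] = [:[:cst (1 / (r - s)):]:] * (eigY \<phi> r s - [:[:0, 1:]:] - [:[:cst (1 / (r - 1)) * \<phi>:]:])"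
      by (simp add: eigY_def)
    show ?thesis by (subst (1 2) h) (simp only: rhom_mult[OF t] rhom_diff[OF t] Y inner twist_power_const)
  qed
  show ?thesis
    by (induction p rule: poly2_ring_induct)
      (simp_all only: rhom_add[OF t] rhom_mult[OF t] inner outer twist_power_const)
qed

section \<open>Transfer to the quotient ring\<close>

text \<open>The rules mirror those of \<^const>\<open>generate_ring\<close>, so that the two closures correspond to each other
  step by step.\<close>

inductive_set alg_gen :: "'e::ring_1 set \<Rightarrow> 'e set" for G where
    one: "1 \<in> alg_gen G"
  | incl: "g \<in> G \<Longrightarrow> g \<in> alg_gen G"
  | minus: "x \<in> alg_gen G \<Longrightarrow> - x \<in> alg_gen G"
  | add: "x \<in> alg_gen G \<Longrightarrow> y \<in> alg_gen G \<Longrightarrow> x + y \<in> alg_gen G"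
  | mult: "x \<in> alg_gen G \<Longrightarrow> y \<in> alg_gen G \<Longrightarrow> x * y \<in> alg_gen G"

lemma alg_gen_zero: "0 \<in> alg_gen G"
  using alg_gen.add[OF alg_gen.one alg_gen.minus[OF alg_gen.one], of G] by simp

lemma alg_gen_sum: "(\<And>i. f i \<in> alg_gen G) \<Longrightarrow> (\<Sum>i\<in>I. f i) \<in> alg_gen G"
  by (induction I rule: infinite_finite_induct) (simp_all add: alg_gen_zero alg_gen.add)

lemma alg_gen_power: "x \<in> alg_gen G \<Longrightarrow> x ^ k \<in> alg_gen G"
  by (induction k) (simp_all add: alg_gen.one alg_gen.mult)

locale gdu_faithful = gdu_rep +
  assumes faithful: "\<And>x. h x = 0 \<longleftrightarrow> restr n x \<in> rel_ideal n \<alpha> \<beta> \<phi>" and phi: "\<phi> \<in> mpols n"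

lemma gdu_faithful_exists:
  fixes r s :: "'k::field_char_0"
  assumes "\<phi> \<in> mpols n" "r + s = \<alpha>" "r * s = - \<beta>"
  obtains \<Phi> :: "'k free \<Rightarrow> 'k free endo" where "gdu_faithful n \<alpha> \<beta> r s \<phi> \<Phi>"
proof -
  obtain \<Phi> :: "'k free \<Rightarrow> 'k free endo" where \<Phi>: "rhom \<Phi>"
    "\<And>x. x \<in> carrier (free_alg n) \<Longrightarrow> \<Phi> x = 0 \<longleftrightarrow> x \<in> rel_ideal n \<alpha> \<beta> \<phi>" "\<And>x. \<Phi> (restr n x) = \<Phi> x"
    using faithful_rep by blast
  have "relators n \<alpha> \<beta> \<phi> \<subseteq> rel_ideal n \<alpha> \<beta> \<phi>"
    unfolding rel_ideal_def by (rule ring.genideal_self[OF ring_free_alg relators_closed])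
  moreover have "\<Phi> x = 0 \<longleftrightarrow> restr n x \<in> rel_ideal n \<alpha> \<beta> \<phi>" for x
    using \<Phi>(2)[OF restr_closed] \<Phi>(3) by metis
  ultimately have "gdu_faithful n \<alpha> \<beta> r s \<phi> \<Phi>"
    using \<Phi> relators_closed assms by unfold_locales blast+
  then show thesis by (rule that)
qed

context gdu_faithful
begin

text \<open>The relations depend on \<open>r\<close> and \<open>s\<close> only through \<open>r + s\<close> and \<open>r s\<close>.\<close>

lemma swap: "gdu_faithful n \<alpha> \<beta> s r \<phi> h"
  using h relators restr roots faithful phi by unfold_locales (simp_all add: add.commute mult.commute)

abbreviation "A \<equiv> gdu_alg n \<alpha> \<beta> \<phi>"
abbreviation "q \<equiv> cls n \<alpha> \<beta> \<phi>"
abbreviation "F \<equiv> carrier (free_alg n :: 'a free ring)"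

lemma cls_hom: "ring_hom_ring (free_alg n) A q"
  unfolding gdu_alg_def cls_def by (rule ideal.rcos_ring_hom_ring[OF ideal_rel_ideal])

lemma neg_free: "x \<in> F \<Longrightarrow> \<ominus>\<^bsub>free_alg n\<^esub> x = - x"
  using ring_free_alg[of n]
  by (intro abelian_group.minus_equality) (auto simp: ring_def simp del: free_alg_simps(1) intro: free_alg_closed)

lemma cls_simps:
  "x \<in> F \<Longrightarrow> y \<in> F \<Longrightarrow> q x \<otimes>\<^bsub>A\<^esub> q y = q (x * y)"
  "x \<in> F \<Longrightarrow> y \<in> F \<Longrightarrow> q x \<oplus>\<^bsub>A\<^esub> q y = q (x + y)"
  "\<one>\<^bsub>A\<^esub> = q 1" "x \<in> F \<Longrightarrow> \<ominus>\<^bsub>A\<^esub> q x = q (- x)"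
proof -
  interpret ring_hom_ring "free_alg n" A q by (rule cls_hom)
  show "x \<in> F \<Longrightarrow> y \<in> F \<Longrightarrow> q x \<otimes>\<^bsub>A\<^esub> q y = q (x * y)"
    "x \<in> F \<Longrightarrow> y \<in> F \<Longrightarrow> q x \<oplus>\<^bsub>A\<^esub> q y = q (x + y)"
    "\<one>\<^bsub>A\<^esub> = q 1"
    using hom_mult[of x y] hom_add[of x y] hom_one by (simp_all del: free_alg_simps(1))
  show "\<ominus>\<^bsub>A\<^esub> q x = q (- x)" if "x \<in> F"
    using hom_a_inv[OF that] neg_free[OF that] by simp
qed

lemma cls_eq_iff: assumes "x \<in> F" "y \<in> F" shows "q x = q y \<longleftrightarrow> h x = h y"
proof -
  have "x \<ominus>\<^bsub>free_alg n\<^esub> y = x - y"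
    using assms by (simp add: a_minus_def neg_free del: free_alg_simps(1))
  then have "q x = q y \<longleftrightarrow> x - y \<in> rel_ideal n \<alpha> \<beta> \<phi>"
    unfolding cls_def
    using ring.quotient_eq_iff_same_a_r_cos[OF ring_free_alg ideal_rel_ideal assms] by metis
  also have "\<dots> \<longleftrightarrow> h (x - y) = 0"
    unfolding faithful using assms by (simp add: restr_id free_alg_closed del: free_alg_simps(1))
  finally show ?thesis by (simp add: rhom_diff[OF h])
qed

lemma carrier_A: "carrier A = q ` F"
  unfolding gdu_alg_def FactRing_def A_RCOSETS_def' cls_def by auto

lemma center_iff: assumes "x \<in> F" shows "q x \<in> ring_center A \<longleftrightarrow> (\<forall>y. h x * h y = h y * h x)"
proof -
  have "q x \<in> ring_center A \<longleftrightarrow> (\<forall>y\<in>F. q (x * y) = q (y * x))"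
    using assms by (simp add: ring_center_def carrier_A cls_simps del: free_alg_simps(1))
  also have "\<dots> \<longleftrightarrow> (\<forall>y\<in>F. h x * h y = h y * h x)"
    using assms by (auto simp: cls_eq_iff free_alg_closed rhom_mult[OF h] simp del: free_alg_simps(1))
  also have "\<dots> \<longleftrightarrow> (\<forall>y. h x * h y = h y * h x)"
    using restr restr_closed by metis
  finally show ?thesis .
qed

text \<open>Cosets of elements of the free algebra correspond to their images under the faithful \<open>h\<close>, so the
  centre may be computed in the image.\<close>

lemma center_eqI:
  assumes S: "S \<subseteq> F"
    and eq: "\<And>x. (\<forall>y. h x * h y = h y * h x) \<longleftrightarrow> h x \<in> alg_gen (h ` (range scal \<union> S))"
  shows "ring_center A = subalg_gen n \<alpha> \<beta> \<phi> S"
proof (rule Set.set_eqI)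
  fix a
  let ?G = "range scal \<union> S"
  have G: "?G \<subseteq> F" using S free_alg_closed(3) by blast
  have lift: "\<exists>x\<in>F. h x = e \<and> q x \<in> subalg_gen n \<alpha> \<beta> \<phi> S" if "e \<in> alg_gen (h ` ?G)" for e
    using that
  proof induction
    case one
    have "q 1 \<in> subalg_gen n \<alpha> \<beta> \<phi> S"
      unfolding subalg_gen_def cls_simps(3)[symmetric] by (rule generate_ring.one)
    then show ?case using rhom_one[OF h] free_alg_closed(1) by blast
  next
    case (incl g)
    then obtain x where x: "x \<in> ?G" "g = h x" by blast
    then have "q x \<in> subalg_gen n \<alpha> \<beta> \<phi> S"
      unfolding subalg_gen_def by (intro generate_ring.incl imageI)
    then show ?case using G x by blast
  next
    case (minus e)
    then obtain x where x: "x \<in> F" "h x = e" "q x \<in> subalg_gen n \<alpha> \<beta> \<phi> S" by blast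
    have "\<ominus>\<^bsub>A\<^esub> q x \<in> subalg_gen n \<alpha> \<beta> \<phi> S"
      using x(3) unfolding subalg_gen_def by (rule generate_ring.a_inv)
    then show ?case
      unfolding cls_simps(4)[OF x(1)] x(2)[symmetric]
      using rhom_minus[OF h, of x] free_alg_closed(5)[OF x(1)] by blast
  next
    case (add e e')
    then obtain x x' where x: "x \<in> F" "h x = e" "q x \<in> subalg_gen n \<alpha> \<beta> \<phi> S"
      and x': "x' \<in> F" "h x' = e'" "q x' \<in> subalg_gen n \<alpha> \<beta> \<phi> S" by blast
    have "q x \<oplus>\<^bsub>A\<^esub> q x' \<in> subalg_gen n \<alpha> \<beta> \<phi> S"
      using x(3) x'(3) unfolding subalg_gen_def by (rule generate_ring.eng_add)
    then show ?case
      unfolding cls_simps(2)[OF x(1) x'(1)] x(2)[symmetric] x'(2)[symmetric]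
      using rhom_add[OF h, of x x'] free_alg_closed(6)[OF x(1) x'(1)] by blast
  next
    case (mult e e')
    then obtain x x' where x: "x \<in> F" "h x = e" "q x \<in> subalg_gen n \<alpha> \<beta> \<phi> S"
      and x': "x' \<in> F" "h x' = e'" "q x' \<in> subalg_gen n \<alpha> \<beta> \<phi> S" by blast
    have "q x \<otimes>\<^bsub>A\<^esub> q x' \<in> subalg_gen n \<alpha> \<beta> \<phi> S"
      using x(3) x'(3) unfolding subalg_gen_def by (rule generate_ring.eng_mult)
    then show ?case
      unfolding cls_simps(1)[OF x(1) x'(1)] x(2)[symmetric] x'(2)[symmetric]
      using rhom_mult[OF h, of x x'] free_alg_closed(8)[OF x(1) x'(1)] by blast
  qed
  have unlift: "\<exists>x\<in>F. a = q x \<and> h x \<in> alg_gen (h ` ?G)" if "a \<in> subalg_gen n \<alpha> \<beta> \<phi> S" for a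
    using that unfolding subalg_gen_def
  proof induction
    case one
    have "h 1 \<in> alg_gen (h ` ?G)" unfolding rhom_one[OF h] by (rule alg_gen.one)
    then show ?case unfolding cls_simps(3) using free_alg_closed(1) by blast
  next
    case (incl a)
    then obtain x where x: "x \<in> ?G" "a = q x" by blast
    then have "h x \<in> alg_gen (h ` ?G)" by (intro alg_gen.incl imageI)
    then show ?case using G x by blast
  next
    case (a_inv a)
    then obtain x where x: "x \<in> F" "a = q x" "h x \<in> alg_gen (h ` ?G)" by blast
    show ?case
      using alg_gen.minus[OF x(3)] free_alg_closed(5)[OF x(1)] cls_simps(4)[OF x(1)]
      unfolding x(2) rhom_minus[OF h, symmetric] by blast
  next
    case (eng_add a b)
    then obtain x y where x: "x \<in> F" "a = q x" "h x \<in> alg_gen (h ` ?G)"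
      and y: "y \<in> F" "b = q y" "h y \<in> alg_gen (h ` ?G)" by blast
    show ?case
      using alg_gen.add[OF x(3) y(3)] free_alg_closed(6)[OF x(1) y(1)] cls_simps(2)[OF x(1) y(1)]
      unfolding x(2) y(2) rhom_add[OF h, symmetric] by blast
  next
    case (eng_mult a b)
    then obtain x y where x: "x \<in> F" "a = q x" "h x \<in> alg_gen (h ` ?G)"
      and y: "y \<in> F" "b = q y" "h y \<in> alg_gen (h ` ?G)" by blast
    show ?case
      using alg_gen.mult[OF x(3) y(3)] free_alg_closed(8)[OF x(1) y(1)] cls_simps(1)[OF x(1) y(1)]
      unfolding x(2) y(2) rhom_mult[OF h, symmetric] by blast
  qed
  show "a \<in> ring_center A \<longleftrightarrow> a \<in> subalg_gen n \<alpha> \<beta> \<phi> S"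
  proof
    assume a: "a \<in> ring_center A"
    then obtain x where x: "x \<in> F" "a = q x"
      unfolding ring_center_def carrier_A by blast
    with a have "h x \<in> alg_gen (h ` ?G)" using center_iff eq by blast
    then obtain y where "y \<in> F" "h y = h x" "q y \<in> subalg_gen n \<alpha> \<beta> \<phi> S" using lift by blast
    then show "a \<in> subalg_gen n \<alpha> \<beta> \<phi> S" using cls_eq_iff x by metis
  next
    assume "a \<in> subalg_gen n \<alpha> \<beta> \<phi> S"
    then obtain x where "x \<in> F" "a = q x" "h x \<in> alg_gen (h ` ?G)" using unlift by blast
    then show "a \<in> ring_center A" using center_iff eq by blast
  qed
qed

section \<open>The centre in terms of the twist\<close>

abbreviation gen_alg :: "'a free set \<Rightarrow> 'b set"
  where "gen_alg S \<equiv> alg_gen (h ` (range scal \<union> (S \<union> fts n)))"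

lemma T_in_gen_alg: "T p \<in> gen_alg S"
proof -
  have "tmon n (\<lambda>i. t i) e \<in> gen_alg S" for e
  proof -
    have prod: "(\<Prod>i\<leftarrow>xs. t i ^ Poly_Mapping.lookup e i) \<in> gen_alg S" if "set xs \<subseteq> {1..n}" for xs
      using that
    proof (induction xs)
      case (Cons i xs)
      then have "t i \<in> gen_alg S" by (intro alg_gen.incl) auto
      with Cons show ?case by (auto intro: alg_gen.mult alg_gen_power)
    qed (simp add: alg_gen.one)
    show ?thesis unfolding tmon_def by (rule prod) auto
  qed
  moreover have "C c \<in> gen_alg S" for c by (intro alg_gen.incl) blast
  ultimately have *: "C c * tmon n (\<lambda>i. t i) e \<in> gen_alg S" for c e by (intro alg_gen.mult)
  show ?thesis unfolding T_mlift mlift_def by (rule alg_gen_sum) (rule *)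
qed

lemma ev_pgen:
  assumes "f \<in> pgen G" "\<And>g. g \<in> G \<Longrightarrow> ev g \<in> gen_alg S"
  shows "ev f \<in> gen_alg S"
  using assms(1)
proof induction
  case (const c)
  show ?case unfolding ev_inner ev1_const by (rule T_in_gen_alg)
next
  case (incl g)
  then show ?case by (rule assms(2))
next
  case (add f g)
  show ?case unfolding rhom_add[OF rhom_ev] by (rule alg_gen.add) (rule add)+
next
  case (mult f g)
  show ?case unfolding rhom_mult[OF rhom_ev] by (rule alg_gen.mult) (rule mult)+
qed

lemma commutes_with_all:
  assumes "e * U = U * e" "e * D = D * e" "\<And>p. e * T p = T p * e"
  shows "e * h x = h x * e"
proof (induction x rule: rep_induct)
  case (mult x y)
  then show ?case by (metis mult.assoc)
qed (simp_all add: assms distrib_left distrib_right)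

lemma T_ev: "T p = ev [:[:p:]:]"
  by (simp add: ev_inner ev1_const)

lemma invariant_central:
  assumes "\<sigma> f = f" shows "ev f * h x = h x * ev f"
proof (rule commutes_with_all)
  show "ev f * U = U * ev f" using ev_U[of f] unfolding assms .
  show "ev f * D = D * ev f" using D_ev[of f] unfolding assms by (rule sym)
  show "ev f * T p = T p * ev f" for p unfolding T_ev by (rule ev_commute)
qed

lemma ev_U_power: "ev p * U ^ k = U ^ k * ev ((\<sigma> ^^ k) p)"
proof (induction k arbitrary: p)
  case (Suc k)
  have "ev p * U ^ Suc k = ev p * U * U ^ k" by (simp add: mult.assoc)
  also have "\<dots> = U * (ev (\<sigma> p) * U ^ k)" by (simp only: ev_U mult.assoc)
  also have "\<dots> = U ^ Suc k * ev ((\<sigma> ^^ Suc k) p)"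
    by (simp add: Suc mult.assoc funpow_swap1)
  finally show ?case .
qed simp

lemma D_power_ev: "D ^ k * ev p = ev ((\<sigma> ^^ k) p) * D ^ k"
proof (induction k arbitrary: p)
  case (Suc k)
  have "D ^ Suc k * ev p = D ^ k * (D * ev p)" by (simp add: power_Suc2 mult.assoc del: power_Suc)
  also have "\<dots> = D ^ k * ev (\<sigma> p) * D" by (simp only: D_ev mult.assoc)
  also have "\<dots> = ev ((\<sigma> ^^ Suc k) p) * D ^ Suc k"
    by (simp only: Suc power_Suc2 mult.assoc funpow_Suc_right o_apply)
  finally show ?case .
qed simp

text \<open>Both \<open>d u\<^sup>k\<close> and \<open>u\<^sup>k d\<close> are multiples of \<open>u\<^sup>k\<^sup>-\<^sup>1\<close>, with coefficients \<open>\<sigma>\<^sup>k(h)\<close> and \<open>h\<close>.\<close>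

lemma power_central:
  assumes id: "\<And>p. (\<sigma> ^^ k) p = p"
  shows "U ^ k * h x = h x * U ^ k" "D ^ k * h x = h x * D ^ k"
proof -
  have "U ^ k * D = D * U ^ k \<and> D ^ k * U = U * D ^ k"
  proof (cases k)
    case (Suc m)
    have id': "(\<sigma> ^^ m) (\<sigma> [:0, 1:]) = [:0, 1:]"
      using id[of "[:0, 1:]"] by (simp only: Suc funpow_Suc_right o_apply)
    have "D * U ^ k = D * U * U ^ m" by (simp only: Suc power_Suc mult.assoc)
    also have "\<dots> = U ^ m * (U * D)" by (simp only: DU_ev ev_U_power id' ev_outer)
    also have "\<dots> = U ^ k * D" by (simp only: Suc power_Suc2 mult.assoc)
    finally have UD: "U ^ k * D = D * U ^ k" by (rule sym)
    have "D ^ k * U = D ^ m * (D * U)" by (simp only: Suc power_Suc2 mult.assoc)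
    also have "\<dots> = U * D * D ^ m" by (simp only: DU_ev D_power_ev id' ev_outer)
    also have "\<dots> = U * D ^ k" by (simp only: Suc power_Suc mult.assoc)
    finally have "D ^ k * U = U * D ^ k" .
    with UD show ?thesis ..
  qed simp
  then have UD: "U ^ k * D = D * U ^ k" and DU: "D ^ k * U = U * D ^ k" by blast+
  show "U ^ k * h x = h x * U ^ k"
  proof (rule commutes_with_all)
    show "U ^ k * T p = T p * U ^ k" for p
      unfolding T_ev ev_U_power id ..
  qed (rule power_commutes UD)+
  show "D ^ k * h x = h x * D ^ k"
  proof (rule commutes_with_all)
    show "D ^ k * T p = T p * D ^ k" for p
      unfolding T_ev D_power_ev id ..
  qed (rule power_commutes DU)+
qed

lemma pev_in_gen_alg:
  assumes "\<And>k. coeff Z k \<noteq> 0 \<Longrightarrow> a ^ (m + k) \<in> gen_alg S" "\<And>k. ev (coeff Z k) \<in> gen_alg S"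
  shows "a ^ m * pev ev a Z \<in> gen_alg S"
  using assms
proof (induction Z arbitrary: m)
  case (pCons c Z)
  have "a ^ Suc m * pev ev a Z \<in> gen_alg S"
  proof (rule pCons.IH)
    show "a ^ (Suc m + k) \<in> gen_alg S" if "coeff Z k \<noteq> 0" for k
      using pCons.prems(1)[of "Suc k"] that by simp
    show "ev (coeff Z k) \<in> gen_alg S" for k
      using pCons.prems(2)[of "Suc k"] by simp
  qed
  moreover have "a ^ m * ev c \<in> gen_alg S"
    using pCons.prems(1)[of 0] pCons.prems(2)[of 0]
    by (cases "c = 0") (simp_all add: rhom_zero[OF rhom_ev] alg_gen_zero alg_gen.mult)
  ultimately show ?case
    by (simp add: pev_ev_pCons distrib_left power_commutes alg_gen.add flip: mult.assoc)
qed (simp add: pev_0 alg_gen_zero)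

text \<open>The centre is generated by the invariants of the twist together with the \<open>u\<^sup>k\<close> and \<open>d\<^sup>k\<close> for
  which its \<open>k\<close>-th power is the identity. If \<open>s = 0 \<noteq> r\<close>, this is to be applied with the roots exchanged.\<close>

lemma center_generated:
  assumes S: "S \<subseteq> F"
    and central: "\<And>x. x \<in> S \<Longrightarrow> (\<exists>f. \<sigma> f = f \<and> h x = ev f)
        \<or> (\<exists>k. (\<forall>p. (\<sigma> ^^ k) p = p) \<and> (h x = U ^ k \<or> h x = D ^ k))"
    and invariants: "\<And>f. \<sigma> f = f \<Longrightarrow> ev f \<in> gen_alg S"
    and powers: "\<And>k. k > 0 \<Longrightarrow> (\<And>p. (\<sigma> ^^ k) p = p) \<Longrightarrow> U ^ k \<in> gen_alg S \<and> D ^ k \<in> gen_alg S"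
    and nz: "r \<noteq> 0 \<and> s \<noteq> 0 \<or> r = 0"
  shows "ring_center A = subalg_gen n \<alpha> \<beta> \<phi> (S \<union> fts n)"
proof (rule center_eqI)
  have "ft i \<in> F" if "i \<in> {1..n}" for i
    using that by (intro free_alg_closed(4)) (simp add: gens_def)
  then show "S \<union> fts n \<subseteq> F" using S by blast
  fix x
  show "(\<forall>y. h x * h y = h y * h x) \<longleftrightarrow> h x \<in> gen_alg S"
  proof
    assume comm: "\<forall>y. h x * h y = h y * h x"
    show "h x \<in> gen_alg S"
    proof (cases "r = 0")
      case True
      have "gdu_rep n \<alpha> \<beta> 0 s \<phi> h" using gdu_rep_axioms True by simp
      then obtain c where c: "h x = gdu_rep.ev1 n 0 h c" "twist1 \<phi> s c = c"
        using central_normal_form_degenerate[of n \<alpha> \<beta> s \<phi> h x] faithful phi comm by blast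
      have "ev [:c:] = gdu_rep.ev1 n 0 h c" unfolding ev_inner using True by simp
      then have "h x = ev [:c:]" "\<sigma> [:c:] = [:c:]"
        using c by (simp_all add: twist_inner)
      then show ?thesis using invariants by simp
    next
      case False
      then have s: "s \<noteq> 0" using nz by simp
      obtain Z Y where ZY: "h x = pev ev U Z + D * pev ev D Y"
        "\<And>k. \<sigma> (coeff Z k) = coeff Z k" "\<And>k. \<sigma> (coeff Y k) = coeff Y k"
        "\<And>k p. coeff Z k \<noteq> 0 \<Longrightarrow> (\<sigma> ^^ k) p = p" "\<And>k p. coeff Y k \<noteq> 0 \<Longrightarrow> (\<sigma> ^^ Suc k) p = p"
        using central_normal_form[OF gdu_rep_axioms faithful phi False s] comm by blast
      have "U ^ 0 * pev ev U Z \<in> gen_alg S"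
      proof (rule pev_in_gen_alg)
        show "U ^ (0 + k) \<in> gen_alg S" if "coeff Z k \<noteq> 0" for k
          using powers[of k] ZY(4)[OF that] by (cases "k = 0") (simp_all add: alg_gen.one)
      qed (rule invariants, rule ZY(2))
      moreover have "D ^ 1 * pev ev D Y \<in> gen_alg S"
      proof (rule pev_in_gen_alg)
        show "D ^ (1 + k) \<in> gen_alg S" if "coeff Y k \<noteq> 0" for k
          using powers[of "Suc k"] ZY(5)[OF that] by simp
      qed (rule invariants, rule ZY(3))
      ultimately show ?thesis unfolding ZY(1) by (simp add: alg_gen.add)
    qed
  next
    have "e * h y = h y * e" if "e \<in> gen_alg S" for e y
      using that
    proof induction
      case (incl g)
      then consider c where "g = C c" | x where "x \<in> S" "g = h x" | i where "i \<in> {1..n}" "g = t i"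
        by blast
      then show ?case
      proof cases
        case 1
        then show ?thesis by (simp only: C_commute)
      next
        case 2
        then show ?thesis using central[of x] invariant_central power_central by metis
      next
        case 3
        then have "g = ev [:[:tvar i:]:]" by (simp add: ev_inner ev1_const T_tvar)
        then show ?thesis using invariant_central[OF twist_T] by simp
      qed
    next
      case (mult e e')
      then show ?case by (metis mult.assoc)
    qed (simp_all add: distrib_left distrib_right)
    moreover assume "h x \<in> gen_alg S"
    ultimately show "\<forall>y. h x * h y = h y * h x" by blast
  qed
qed

end

section \<open>Roots of unity\<close>

lemma primitive_root_dvd:
  assumes "primitive_root m x" "x ^ k = 1" shows "m dvd k"
proof -
  have x: "x ^ m = 1" "0 < m" and least: "\<And>k. 0 < k \<Longrightarrow> k < m \<Longrightarrow> x ^ k \<noteq> 1"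
    using assms(1) unfolding primitive_root_def by blast+
  have "x ^ k = x ^ (m * (k div m) + k mod m)"
    by (simp only: mult_div_mod_eq)
  also have "\<dots> = x ^ (k mod m)"
    by (simp only: power_add power_mult x power_one mult_1_left)
  finally have "x ^ (k mod m) = 1" using assms(2) by (simp only:)
  then have "k mod m = 0"
    using least[of "k mod m"] mod_less_divisor[OF x(2), of k] by blast
  then show ?thesis by (rule mod_0_imp_dvd)
qed

lemma primitive_root_power: "primitive_root m x \<Longrightarrow> m dvd k \<Longrightarrow> x ^ k = 1"
  by (elim dvdE) (simp add: primitive_root_def power_mult)

lemma primitive_root_imp: "primitive_root m x \<Longrightarrow> root_of_unity x"
  by (auto simp: primitive_root_def root_of_unity_def)

lemma primitive_root_one:
  assumes "primitive_root m x" shows "x = 1 \<longleftrightarrow> m = 1"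
proof
  assume "x = 1"
  then have "\<not> 1 < m" using assms unfolding primitive_root_def by (metis power_one zero_less_one)
  then show "m = 1" using assms by (simp add: primitive_root_def)
next
  assume "m = 1"
  then show "x = 1" using assms by (simp add: primitive_root_def)
qed

lemma root_of_unity_primitive:
  assumes "root_of_unity x" obtains m where "primitive_root m x"
proof -
  define m where "m = (LEAST k. k > 0 \<and> x ^ k = 1)"
  have "m > 0 \<and> x ^ m = 1"
    using assms LeastI_ex[of "\<lambda>k. k > 0 \<and> x ^ k = 1"] unfolding root_of_unity_def m_def by blast
  moreover have "\<forall>k. 0 < k \<and> k < m \<longrightarrow> x ^ k \<noteq> 1"
    using not_less_Least[of _ "\<lambda>k. k > 0 \<and> x ^ k = 1"] unfolding m_def by blast
  ultimately have "primitive_root m x" unfolding primitive_root_def by blast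
  then show thesis by (rule that)
qed

lemma not_root_of_unity: "\<not> root_of_unity x \<Longrightarrow> x ^ k = 1 \<Longrightarrow> k = 0"
  by (auto simp: root_of_unity_def)

lemma one_root_of_unity: "root_of_unity 1"
  unfolding root_of_unity_def by (rule exI[of _ 1]) simp

section \<open>The centre case by case\<close>

lemma gen_closed: "fu \<in> carrier (free_alg n :: 'k::field free ring)" "fd \<in> carrier (free_alg n :: 'k free ring)"
  by (rule free_alg_closed(4), simp add: gens_def)+

lemma du_elt_closed: "du_elt n \<phi> a b \<in> carrier (free_alg n :: 'k::field free ring)"
  unfolding du_elt_def by (intro free_alg_closed gen_closed mpol_eval_closed)

lemma alg_gen_power_dvd: "x ^ m \<in> alg_gen G \<Longrightarrow> m dvd k \<Longrightarrow> x ^ k \<in> alg_gen G"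
  by (elim dvdE) (simp add: power_mult alg_gen_power)

context gdu_faithful
begin

abbreviation "xi \<equiv> h (du_elt n \<phi> r s)"
abbreviation "eta \<equiv> h (du_elt n \<phi> s r)"

lemma h_du_elt: "h (du_elt n \<phi> a b) = D * U - C a * H + C (1 / (b - 1)) * T \<phi>"
  by (simp only: du_elt_def rhom_simps[OF h] mult.assoc)

lemma xi_eq: "xi = ev [:eigX \<phi> s:]"
proof -
  have "ev [:eigX \<phi> s:] = C (1 / (s - 1)) * T \<phi> + W"
    by (simp only: ev_inner eigX_def ev1_lin rhom_mult[OF rhom_T] T_cst rhom_one[OF rhom_T] mult_1_right)
  then show ?thesis by (simp add: h_du_elt mult.assoc)
qed

lemma eta_eq: "eta = ev (eigY \<phi> r s)"
proof -
  have "ev (eigY \<phi> r s) = C (1 / (r - 1)) * T \<phi> + W + H * C (r - s)"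
    by (simp only: ev_lin eigY_def ev1_lin ev1_const rhom_mult[OF rhom_T] T_cst rhom_one[OF rhom_T] mult_1_right)
  also have "H * C (r - s) = C r * H - C s * H"
    using C_commute[of "r - s" "fu * fd"] by (simp add: rhom_mult[OF h] rhom_diff[OF rhom_C] left_diff_distrib)
  finally show ?thesis by (simp add: h_du_elt mult.assoc)
qed

lemma monomial_eq: "xi ^ i * eta ^ j = ev ([:eigX \<phi> s:] ^ i * eigY \<phi> r s ^ j)"
  by (simp only: rhom_mult[OF rhom_ev] rhom_power[OF rhom_ev] xi_eq eta_eq)

lemma eta_xi_commute: "eta ^ j * xi ^ i = xi ^ i * eta ^ j"
  unfolding xi_eq eta_eq rhom_power[OF rhom_ev, symmetric] by (rule ev_commute)

text \<open>Two distinct roots with eigenvectors for both. The monomials and powers are allowed to be merely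
  generated by \<open>S\<close>, so that \<open>S\<close> can be adapted to the orders of the roots.\<close>

lemma center_semisimple_aux:
  assumes rs: "r \<noteq> s" and Y: "r \<noteq> 1 \<or> \<phi> = 0" and X: "s \<noteq> 1 \<or> \<phi> = 0" and S: "S \<subseteq> F"
    and central: "\<And>x. x \<in> S \<Longrightarrow> (\<exists>i j. s ^ i * r ^ j = 1 \<and> h x = xi ^ i * eta ^ j)
        \<or> (\<exists>k. r ^ k = 1 \<and> s ^ k = 1 \<and> (h x = U ^ k \<or> h x = D ^ k))"
    and monomials: "\<And>i j. s ^ i * r ^ j = 1 \<Longrightarrow> xi ^ i * eta ^ j \<in> gen_alg S"
    and powers: "\<And>k. k > 0 \<Longrightarrow> r ^ k = 1 \<Longrightarrow> s ^ k = 1 \<Longrightarrow> U ^ k \<in> gen_alg S \<and> D ^ k \<in> gen_alg S"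
    and nz: "r \<noteq> 0 \<and> s \<noteq> 0 \<or> r = 0"
  shows "ring_center A = subalg_gen n \<alpha> \<beta> \<phi> (S \<union> fts n)"
proof (rule center_generated[OF S _ _ _ nz])
  have inv: "\<sigma> ([:eigX \<phi> s:] ^ i * eigY \<phi> r s ^ j) = [:eigX \<phi> s:] ^ i * eigY \<phi> r s ^ j"
    if "s ^ i * r ^ j = 1" for i j
  proof -
    have "\<sigma> ([:eigX \<phi> s:] ^ i * eigY \<phi> r s ^ j)
        = [:[:cst s:]:] ^ i * [:[:cst r:]:] ^ j * ([:eigX \<phi> s:] ^ i * eigY \<phi> r s ^ j)"
      by (simp only: rhom_mult[OF rhom_twist] rhom_power[OF rhom_twist] twist_eigX[OF X] twist_eigY[OF Y]
          power_mult_distrib mult_ac)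
    also have "[:[:cst s:]:] ^ i * [:[:cst r:]:] ^ j = [:[:cst (s ^ i * r ^ j):]:]"
      by (simp add: poly_const_pow cst_mult cst_power mult.commute)
    finally show ?thesis unfolding that by (simp flip: one_pCons)
  qed
  show "(\<exists>f. \<sigma> f = f \<and> h x = ev f) \<or> (\<exists>k. (\<forall>p. (\<sigma> ^^ k) p = p) \<and> (h x = U ^ k \<or> h x = D ^ k))"
    if "x \<in> S" for x
    using central[OF that]
  proof (elim disjE exE conjE)
    fix i j assume "s ^ i * r ^ j = 1" "h x = xi ^ i * eta ^ j"
    then show ?thesis using inv monomial_eq by metis
  qed (use twist_power_id[OF rs Y X] in blast)+
  show "ev f \<in> gen_alg S" if "\<sigma> f = f" for f
  proof (rule ev_pgen[OF invariants_semisimple[OF rs Y X that]])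
    fix g assume "g \<in> {[:eigX \<phi> s:] ^ i * eigY \<phi> r s ^ j | i j. s ^ i * r ^ j = 1}"
    then obtain i j where "g = [:eigX \<phi> s:] ^ i * eigY \<phi> r s ^ j" "s ^ i * r ^ j = 1" by blast
    then show "ev g \<in> gen_alg S" by (simp only: monomial_eq[symmetric] monomials)
  qed
  show "U ^ k \<in> gen_alg S \<and> D ^ k \<in> gen_alg S" if "k > 0" "\<And>p. (\<sigma> ^^ k) p = p" for k
  proof (rule powers[OF \<open>k > 0\<close>])
    show "s ^ k = 1"
      by (rule twist_order_eigenvalue[OF twist_eigX[OF X] _ that(2)]) (simp add: eigX_def)
    show "r ^ k = 1"
      by (rule twist_order_eigenvalue[OF twist_eigY[OF Y] _ that(2)]) (simp add: eigY_def)
  qed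
qed

text \<open>If \<open>s = 0\<close>, the roots are exchanged, which exchanges the two eigenvectors; as these commute, the
  monomials remain the same.\<close>

lemma center_semisimple:
  assumes rs: "r \<noteq> s" and Y: "r \<noteq> 1 \<or> \<phi> = 0" and X: "s \<noteq> 1 \<or> \<phi> = 0" and S: "S \<subseteq> F"
    and central: "\<And>x. x \<in> S \<Longrightarrow> (\<exists>i j. s ^ i * r ^ j = 1 \<and> h x = xi ^ i * eta ^ j)
        \<or> (\<exists>k. r ^ k = 1 \<and> s ^ k = 1 \<and> (h x = U ^ k \<or> h x = D ^ k))"
    and monomials: "\<And>i j. s ^ i * r ^ j = 1 \<Longrightarrow> xi ^ i * eta ^ j \<in> gen_alg S"
    and powers: "\<And>k. k > 0 \<Longrightarrow> r ^ k = 1 \<Longrightarrow> s ^ k = 1 \<Longrightarrow> U ^ k \<in> gen_alg S \<and> D ^ k \<in> gen_alg S"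
  shows "ring_center A = subalg_gen n \<alpha> \<beta> \<phi> (S \<union> fts n)"
proof (cases "r \<noteq> 0 \<and> s \<noteq> 0 \<or> r = 0")
  case True
  show ?thesis by (rule center_semisimple_aux[OF assms True])
next
  case False
  interpret swapped: gdu_faithful n \<alpha> \<beta> s r \<phi> h by (rule swap)
  show ?thesis
  proof (rule swapped.center_semisimple_aux[OF rs[symmetric] X Y S])
    show "(\<exists>i j. r ^ i * s ^ j = 1 \<and> h x = eta ^ i * xi ^ j)
        \<or> (\<exists>k. s ^ k = 1 \<and> r ^ k = 1 \<and> (h x = U ^ k \<or> h x = D ^ k))" if "x \<in> S" for x
      using central[OF that] unfolding eta_xi_commute by (metis mult.commute)
    show "eta ^ i * xi ^ j \<in> gen_alg S" if "r ^ i * s ^ j = 1" for i j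
      unfolding eta_xi_commute using that by (intro monomials) (simp add: mult.commute)
    show "U ^ k \<in> gen_alg S \<and> D ^ k \<in> gen_alg S" if "k > 0" "s ^ k = 1" "r ^ k = 1" for k
      using powers that by blast
  qed (use False in auto)
qed

text \<open>Here \<open>w\<close> is translated by \<open>\<phi>\<close>, so the only invariants are those in the other eigenvector.\<close>

lemma center_translation:
  assumes s: "s = 1" and \<phi>: "\<phi> \<noteq> 0" and r: "r \<noteq> 1" and S: "S \<subseteq> F"
    and central: "\<And>x. x \<in> S \<Longrightarrow> \<exists>j. r ^ j = 1 \<and> h x = eta ^ j"
    and powers: "\<And>j. r ^ j = 1 \<Longrightarrow> eta ^ j \<in> gen_alg S"
  shows "ring_center A = subalg_gen n \<alpha> \<beta> \<phi> (S \<union> fts n)"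
proof (rule center_generated[OF S])
  have Y: "\<sigma> (eigY \<phi> r s ^ j) = [:[:cst (r ^ j):]:] * eigY \<phi> r s ^ j" for j
    using twist_eigY[of r \<phi> s, OF disjI1[OF r]]
    by (simp only: rhom_power[OF rhom_twist] power_mult_distrib cst_power poly_const_pow)
  show "(\<exists>f. \<sigma> f = f \<and> h x = ev f) \<or> (\<exists>k. (\<forall>p. (\<sigma> ^^ k) p = p) \<and> (h x = U ^ k \<or> h x = D ^ k))"
    if x: "x \<in> S" for x
  proof -
    obtain j where j: "r ^ j = 1" "h x = eta ^ j" using central[OF x] by blast
    have "\<sigma> (eigY \<phi> r s ^ j) = eigY \<phi> r s ^ j" using Y[of j] j(1) by (simp flip: one_pCons)
    moreover have "h x = ev (eigY \<phi> r s ^ j)" by (simp only: j(2) eta_eq rhom_power[OF rhom_ev])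
    ultimately show ?thesis by blast
  qed
  show "ev f \<in> gen_alg S" if "\<sigma> f = f" for f
  proof (rule ev_pgen)
    show "f \<in> pgen {eigY \<phi> r s ^ j | j. r ^ j = 1}"
      using invariants_translation[OF r \<phi>, of f] that unfolding s by blast
    show "ev g \<in> gen_alg S" if "g \<in> {eigY \<phi> r s ^ j | j. r ^ j = 1}" for g
    proof -
      from that obtain j where "g = eigY \<phi> r s ^ j" "r ^ j = 1" by blast
      then show ?thesis by (simp only: rhom_power[OF rhom_ev] eta_eq[symmetric] powers)
    qed
  qed
  show "U ^ k \<in> gen_alg S \<and> D ^ k \<in> gen_alg S" if "k > 0" "\<And>p. (\<sigma> ^^ k) p = p" for k
    using twist_translation_order[OF \<phi>, where r = r and k = k] that unfolding s by blast
qed (use s in simp)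

lemma center_jordan:
  assumes s: "s = r" and r: "r \<noteq> 1 \<or> \<phi> = 0" and S: "S \<subseteq> F"
    and central: "\<And>x. x \<in> S \<Longrightarrow> \<exists>j. r ^ j = 1 \<and> h x = xi ^ j"
    and powers: "\<And>j. r ^ j = 1 \<Longrightarrow> xi ^ j \<in> gen_alg S"
  shows "ring_center A = subalg_gen n \<alpha> \<beta> \<phi> (S \<union> fts n)"
proof (rule center_generated[OF S])
  have "s \<noteq> 1 \<or> \<phi> = 0" using r s by simp
  from twist_eigX[OF this, of r]
  have "\<sigma> ([:eigX \<phi> s:] ^ j) = [:[:cst s:]:] ^ j * [:eigX \<phi> s:] ^ j" for j
    by (simp only: rhom_power[OF rhom_twist] power_mult_distrib)
  moreover have "[:[:cst s:]:] ^ j = [:[:cst (s ^ j):]:]" for j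
    by (simp only: poly_const_pow cst_power)
  ultimately have X: "\<sigma> ([:eigX \<phi> s:] ^ j) = [:[:cst (s ^ j):]:] * [:eigX \<phi> s:] ^ j" for j
    by (simp only:)
  show "(\<exists>f. \<sigma> f = f \<and> h x = ev f) \<or> (\<exists>k. (\<forall>p. (\<sigma> ^^ k) p = p) \<and> (h x = U ^ k \<or> h x = D ^ k))"
    if x: "x \<in> S" for x
  proof -
    obtain j where j: "r ^ j = 1" "h x = xi ^ j" using central[OF x] by blast
    have "\<sigma> ([:eigX \<phi> s:] ^ j) = [:eigX \<phi> s:] ^ j" using X[of j] j(1) unfolding s[symmetric] by (simp flip: one_pCons)
    moreover have "h x = ev ([:eigX \<phi> s:] ^ j)" by (simp only: j(2) xi_eq rhom_power[OF rhom_ev])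
    ultimately show ?thesis by blast
  qed
  show "ev f \<in> gen_alg S" if "\<sigma> f = f" for f
  proof (rule ev_pgen)
    show "f \<in> pgen {[:eigX \<phi> s:] ^ j | j. r ^ j = 1}"
      using invariants_jordan[OF r, of f] that unfolding s by blast
    show "ev g \<in> gen_alg S" if "g \<in> {[:eigX \<phi> s:] ^ j | j. r ^ j = 1}" for g
    proof -
      from that obtain j where "g = [:eigX \<phi> s:] ^ j" "r ^ j = 1" by blast
      then show ?thesis by (simp only: rhom_power[OF rhom_ev] xi_eq[symmetric] powers)
    qed
  qed
  show "U ^ k \<in> gen_alg S \<and> D ^ k \<in> gen_alg S" if "k > 0" "\<And>p. (\<sigma> ^^ k) p = p" for k
    using twist_jordan_order[where \<phi> = \<phi> and r = r and k = k] that unfolding s by blast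
qed (use s in auto)

lemma center_unipotent:
  assumes r: "r = 1" and s: "s = 1" and \<phi>: "\<phi> \<noteq> 0"
  shows "ring_center A = subalg_gen n \<alpha> \<beta> \<phi>
    ({(fd * fu - fu * fd)^2 - mpol_eval n \<phi> * (fd * fu + fu * fd)} \<union> fts n)" (is "_ = subalg_gen _ _ _ _ ({?e} \<union> _)")
proof -
  have W: "W = D * U - U * D"
    using r rhom_one[OF rhom_C] by simp
  have identity: "w * (w - c) + x * (- c - c) = w * w - c * (w + x + x)"
    if "c * w = w * c" "c * x = x * c" for w x c :: 'b
    using that by (simp add: algebra_simps)
  have "ev1 [:0, - \<phi>, 1:] = W * (W - T \<phi>)"
    by (simp only: ev1_def pev_pCons[OF rhom_T] pev_0 rhom_simps[OF rhom_T] mult_zero_right mult_1_right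
        add_0_right add_0_left uminus_add_conv_diff)
  moreover have "T (- 2 * \<phi>) = - T \<phi> - T \<phi>"
    by (simp only: mult_minus_left rhom_minus[OF rhom_T] mult_2 rhom_add[OF rhom_T]) simp
  ultimately have "ev (quadr \<phi>) = W * (W - T \<phi>) + H * (- T \<phi> - T \<phi>)"
    by (simp only: quadr_def ev_lin ev1_const)
  also have "\<dots> = W * W - T \<phi> * (W + H + H)"
    by (rule identity[OF TW TH])
  also have "\<dots> = W * W - T \<phi> * (D * U + U * D)"
    unfolding W by (simp only: diff_add_cancel)
  also have "\<dots> = h ?e"
    unfolding W by (simp only: rhom_simps[OF h] power2_eq_square)
  finally have e: "h ?e = ev (quadr \<phi>)" by (rule sym)
  show ?thesis
  proof (rule center_generated)
    show "{?e} \<subseteq> F"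
      unfolding insert_subset
      by (intro conjI empty_subsetI free_alg_closed free_alg_power_closed gen_closed mpol_eval_closed)
    show "(\<exists>f. \<sigma> f = f \<and> h x = ev f) \<or> (\<exists>k. (\<forall>p. (\<sigma> ^^ k) p = p) \<and> (h x = U ^ k \<or> h x = D ^ k))"
      if "x \<in> {?e}" for x
    proof -
      have "\<sigma> (quadr \<phi>) = quadr \<phi>" unfolding r s by (rule twist_quadr)
      moreover have "h x = ev (quadr \<phi>)" using that e by (simp only: singleton_iff)
      ultimately show ?thesis by blast
    qed
    show "ev f \<in> gen_alg {?e}" if "\<sigma> f = f" for f
    proof (rule ev_pgen)
      show "f \<in> pgen {quadr \<phi>}" using invariants_unipotent[OF \<phi>, of f] that unfolding r s by blast
      show "ev g \<in> gen_alg {?e}" if "g \<in> {quadr \<phi>}" for g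
      proof -
        have "ev g = h ?e" using that e by (simp only: singleton_iff)
        then show ?thesis by (simp only:) (intro alg_gen.incl imageI UnI2 UnI1 singletonI)
      qed
    qed
    show "U ^ k \<in> gen_alg {?e} \<and> D ^ k \<in> gen_alg {?e}" if "k > 0" "\<And>p. (\<sigma> ^^ k) p = p" for k
      using twist_translation_order[OF \<phi>, where r = r and k = k] that unfolding s by blast
  qed (simp add: r s)
qed

lemma gen_in_gen_alg: "x \<in> S \<Longrightarrow> h x \<in> gen_alg S"
  by (intro alg_gen.incl) blast

lemma power_in_gen_alg:
  assumes "x ^ m \<in> S" "m dvd k" shows "h x ^ k \<in> gen_alg S"
proof (rule alg_gen_power_dvd[OF _ assms(2)])
  show "h x ^ m \<in> gen_alg S"
    unfolding rhom_power[OF h, symmetric] by (rule gen_in_gen_alg[OF assms(1)])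
qed

text \<open>In \<open>s\<^sup>i r\<^sup>j = 1\<close> the exponent \<open>i\<close> has to vanish, since \<open>s\<^sup>i\<close> is a root of unity.\<close>

lemma center_one_root:
  assumes m: "primitive_root m r" "m > 1 \<or> \<phi> = 0" and s: "\<not> root_of_unity s"
  shows "ring_center A = subalg_gen n \<alpha> \<beta> \<phi> ({du_elt n \<phi> s r ^ m} \<union> fts n)"
proof -
  have zero: "i = 0" if "s ^ i * r ^ j = 1" for i j
  proof -
    have "s ^ (i * m) = (s ^ i * r ^ j) ^ m"
      using primitive_root_power[OF m(1), of "j * m"] by (simp add: power_mult_distrib flip: power_mult)
    then have "i * m = 0"
      by (intro not_root_of_unity[OF s]) (simp only: that power_one)
    then show ?thesis using m(1) by (simp add: primitive_root_def)
  qed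
  show ?thesis
  proof (rule center_semisimple)
    show "r \<noteq> s" using primitive_root_imp[OF m(1)] s by blast
    show "r \<noteq> 1 \<or> \<phi> = 0" using primitive_root_one[OF m(1)] m(2) by auto
    show "s \<noteq> 1 \<or> \<phi> = 0" using s one_root_of_unity by blast
    show "{du_elt n \<phi> s r ^ m} \<subseteq> F"
      using free_alg_power_closed[OF du_elt_closed] by blast
    show "(\<exists>i j. s ^ i * r ^ j = 1 \<and> h x = xi ^ i * eta ^ j)
        \<or> (\<exists>k. r ^ k = 1 \<and> s ^ k = 1 \<and> (h x = U ^ k \<or> h x = D ^ k))" if "x \<in> {du_elt n \<phi> s r ^ m}" for x
    proof (intro disjI1 exI conjI)
      show "s ^ 0 * r ^ m = 1" using m(1) by (simp add: primitive_root_def)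
      show "h x = xi ^ 0 * eta ^ m" using that by (simp add: rhom_power[OF h])
    qed
    show "xi ^ i * eta ^ j \<in> gen_alg {du_elt n \<phi> s r ^ m}" if "s ^ i * r ^ j = 1" for i j
    proof -
      have "m dvd j" using zero[OF that] that primitive_root_dvd[OF m(1), of j] by simp
      then have "eta ^ j \<in> gen_alg {du_elt n \<phi> s r ^ m}" by (rule power_in_gen_alg[rotated]) simp
      then show ?thesis using zero[OF that] by simp
    qed
    show "U ^ k \<in> gen_alg {du_elt n \<phi> s r ^ m} \<and> D ^ k \<in> gen_alg {du_elt n \<phi> s r ^ m}"
      if "k > 0" "r ^ k = 1" "s ^ k = 1" for k
      using not_root_of_unity[OF s that(3)] that(1) by simp
  qed
qed

lemma center_no_root:
  assumes rs: "r \<noteq> s" and r: "\<not> root_of_unity r" and s: "\<not> root_of_unity s"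
  shows "ring_center A = subalg_gen n \<alpha> \<beta> \<phi>
    ({du_elt n \<phi> r s ^ j * du_elt n \<phi> s r ^ i | i j. r ^ i * s ^ j = 1} \<union> fts n)"
    (is "_ = subalg_gen _ _ _ _ (?S \<union> _)")
proof (rule center_semisimple[OF rs])
  show "r \<noteq> 1 \<or> \<phi> = 0" "s \<noteq> 1 \<or> \<phi> = 0" using r s one_root_of_unity by blast+
  show "?S \<subseteq> F"
    using free_alg_closed(8)[OF free_alg_power_closed[OF du_elt_closed] free_alg_power_closed[OF du_elt_closed]] by blast
  show "(\<exists>i j. s ^ i * r ^ j = 1 \<and> h x = xi ^ i * eta ^ j)
      \<or> (\<exists>k. r ^ k = 1 \<and> s ^ k = 1 \<and> (h x = U ^ k \<or> h x = D ^ k))" if x: "x \<in> ?S" for x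
  proof -
    obtain i j where "x = du_elt n \<phi> r s ^ j * du_elt n \<phi> s r ^ i" "r ^ i * s ^ j = 1" using x by blast
    then have "s ^ j * r ^ i = 1 \<and> h x = xi ^ j * eta ^ i"
      by (simp add: rhom_mult[OF h] rhom_power[OF h] mult.commute[of "s ^ j"])
    then show ?thesis by blast
  qed
  show "xi ^ i * eta ^ j \<in> gen_alg ?S" if "s ^ i * r ^ j = 1" for i j
  proof -
    have "r ^ j * s ^ i = 1" using that by (simp only: mult.commute)
    then have "du_elt n \<phi> r s ^ i * du_elt n \<phi> s r ^ j \<in> ?S" by blast
    from gen_in_gen_alg[OF this] show ?thesis by (simp only: rhom_mult[OF h] rhom_power[OF h])
  qed
  show "U ^ k \<in> gen_alg ?S \<and> D ^ k \<in> gen_alg ?S" if "k > 0" "r ^ k = 1" "s ^ k = 1" for k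
    using not_root_of_unity[OF s that(3)] that(1) by simp
qed

lemma center_two_roots:
  assumes rs: "r \<noteq> s" and m1: "primitive_root m1 r" "m1 > 1 \<or> \<phi> = 0"
    and m2: "primitive_root m2 s" "m2 > 1 \<or> \<phi> = 0"
  shows "ring_center A = subalg_gen n \<alpha> \<beta> \<phi> ({fd ^ lcm m1 m2, fu ^ lcm m1 m2}
    \<union> {du_elt n \<phi> r s ^ i * du_elt n \<phi> s r ^ j | i j. s ^ i * r ^ j = 1} \<union> fts n)"
    (is "_ = subalg_gen _ _ _ _ (?S \<union> _)")
proof (rule center_semisimple[OF rs])
  show "r \<noteq> 1 \<or> \<phi> = 0" using primitive_root_one[OF m1(1)] m1(2) by auto
  show "s \<noteq> 1 \<or> \<phi> = 0" using primitive_root_one[OF m2(1)] m2(2) by auto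
  show "?S \<subseteq> F"
    using free_alg_closed(8)[OF free_alg_power_closed[OF du_elt_closed] free_alg_power_closed[OF du_elt_closed]]
      free_alg_power_closed[OF gen_closed(1)] free_alg_power_closed[OF gen_closed(2)] by blast
  show "(\<exists>i j. s ^ i * r ^ j = 1 \<and> h x = xi ^ i * eta ^ j)
      \<or> (\<exists>k. r ^ k = 1 \<and> s ^ k = 1 \<and> (h x = U ^ k \<or> h x = D ^ k))" if x: "x \<in> ?S" for x
  proof -
    have "r ^ lcm m1 m2 = 1" "s ^ lcm m1 m2 = 1"
      by (rule primitive_root_power[OF m1(1) dvd_lcm1], rule primitive_root_power[OF m2(1) dvd_lcm2])
    moreover from x consider "h x = D ^ lcm m1 m2" | "h x = U ^ lcm m1 m2"
      | i j where "x = du_elt n \<phi> r s ^ i * du_elt n \<phi> s r ^ j" "s ^ i * r ^ j = 1"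
      using rhom_power[OF h] by blast
    ultimately show ?thesis
      by cases (use rhom_mult[OF h] rhom_power[OF h] in metis)+
  qed
  show "xi ^ i * eta ^ j \<in> gen_alg ?S" if "s ^ i * r ^ j = 1" for i j
  proof -
    have "du_elt n \<phi> r s ^ i * du_elt n \<phi> s r ^ j \<in> ?S" using that by blast
    from gen_in_gen_alg[OF this] show ?thesis by (simp only: rhom_mult[OF h] rhom_power[OF h])
  qed
  show "U ^ k \<in> gen_alg ?S \<and> D ^ k \<in> gen_alg ?S" if "k > 0" "r ^ k = 1" "s ^ k = 1" for k
  proof -
    have "lcm m1 m2 dvd k"
      using primitive_root_dvd[OF m1(1) that(2)] primitive_root_dvd[OF m2(1) that(3)] by (rule lcm_least)
    then show ?thesis
      by (intro conjI; elim power_in_gen_alg[rotated]; blast)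
  qed
qed

lemma center_translation_root:
  assumes "s = 1" "\<phi> \<noteq> 0" and m: "primitive_root m r" "m > 1"
  shows "ring_center A = subalg_gen n \<alpha> \<beta> \<phi> ({du_elt n \<phi> s r ^ m} \<union> fts n)"
proof (rule center_translation[OF assms(1,2)])
  show "r \<noteq> 1" using primitive_root_one[OF m(1)] m(2) by auto
  show "{du_elt n \<phi> s r ^ m} \<subseteq> F"
    using free_alg_power_closed[OF du_elt_closed] by blast
  show "\<exists>j. r ^ j = 1 \<and> h x = eta ^ j" if "x \<in> {du_elt n \<phi> s r ^ m}" for x
    using that m(1) rhom_power[OF h] by (intro exI[of _ m]) (simp add: primitive_root_def)
  show "eta ^ j \<in> gen_alg {du_elt n \<phi> s r ^ m}" if "r ^ j = 1" for j
    by (rule power_in_gen_alg[OF singletonI primitive_root_dvd[OF m(1) that]])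
qed

lemma center_translation_none:
  assumes "s = 1" "\<phi> \<noteq> 0" and r: "\<not> root_of_unity r"
  shows "ring_center A = subalg_gen n \<alpha> \<beta> \<phi> ({} \<union> fts n)"
proof (rule center_translation[OF assms(1,2)])
  show "r \<noteq> 1" using r one_root_of_unity by blast
  show "eta ^ j \<in> gen_alg {}" if "r ^ j = 1" for j
    using not_root_of_unity[OF r that] alg_gen.one by simp
qed simp_all

lemma center_jordan_root:
  assumes "s = r" and m: "primitive_root m r" "m > 1 \<or> \<phi> = 0"
  shows "ring_center A = subalg_gen n \<alpha> \<beta> \<phi> ({du_elt n \<phi> r s ^ m} \<union> fts n)"
proof (rule center_jordan[OF assms(1)])
  show "r \<noteq> 1 \<or> \<phi> = 0" using primitive_root_one[OF m(1)] m(2) by auto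
  show "{du_elt n \<phi> r s ^ m} \<subseteq> F"
    using free_alg_power_closed[OF du_elt_closed] by blast
  show "\<exists>j. r ^ j = 1 \<and> h x = xi ^ j" if "x \<in> {du_elt n \<phi> r s ^ m}" for x
    using that m(1) rhom_power[OF h] by (intro exI[of _ m]) (simp add: primitive_root_def)
  show "xi ^ j \<in> gen_alg {du_elt n \<phi> r s ^ m}" if "r ^ j = 1" for j
    by (rule power_in_gen_alg[OF singletonI primitive_root_dvd[OF m(1) that]])
qed

lemma center_jordan_none:
  assumes "s = r" and r: "\<not> root_of_unity r"
  shows "ring_center A = subalg_gen n \<alpha> \<beta> \<phi> ({} \<union> fts n)"
proof (rule center_jordan[OF assms(1)])
  show "r \<noteq> 1 \<or> \<phi> = 0" using r one_root_of_unity by blast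
  show "xi ^ j \<in> gen_alg {}" if "r ^ j = 1" for j
    using not_root_of_unity[OF r that] alg_gen.one by simp
qed simp_all

end

theorem theorem1p2:
  fixes n :: nat
    and \<alpha> \<beta> r s :: "'k::field_char_0"
    and \<phi> :: "'k mpol"
  assumes n: "n \<ge> 1"
    and phi: "\<phi> \<in> mpols n"
    and roots: "r + s = \<alpha>" "r * s = - \<beta>"
  shows
    "(\<forall>m. case1 \<phi> r s m \<longrightarrow>
        ring_center (gdu_alg n \<alpha> \<beta> \<phi>) =
          subalg_gen n \<alpha> \<beta> \<phi> ({du_elt n \<phi> r r ^ m} \<union> fts n)) \<and>
     (case2 \<alpha> \<beta> \<phi> \<longrightarrow>
        ring_center (gdu_alg n \<alpha> \<beta> \<phi>) =
          subalg_gen n \<alpha> \<beta> \<phi>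
              ({(fd * fu - fu * fd)^2 - mpol_eval n \<phi> * (fd * fu + fu * fd)} \<union> fts n)) \<and>
     (\<forall>m. case3 \<phi> r s m \<longrightarrow>
        ring_center (gdu_alg n \<alpha> \<beta> \<phi>) =
          subalg_gen n \<alpha> \<beta> \<phi> ({du_elt n \<phi> s r ^ m} \<union> fts n)) \<and>
     (\<forall>m. case4 \<phi> r s m \<longrightarrow>
        ring_center (gdu_alg n \<alpha> \<beta> \<phi>) =
          subalg_gen n \<alpha> \<beta> \<phi> ({du_elt n \<phi> r s ^ m} \<union> fts n)) \<and>
     (case5 r s \<longrightarrow>
        ring_center (gdu_alg n \<alpha> \<beta> \<phi>) =
          subalg_gen n \<alpha> \<beta> \<phi>
              ({du_elt n \<phi> r s ^ j * du_elt n \<phi> s r ^ i | i j. r ^ i * s ^ j = 1} \<union> fts n)) \<and>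
     (\<forall>m1 m2 m. case6 \<phi> r s m1 m2 \<and> m = lcm m1 m2 \<longrightarrow>
        ring_center (gdu_alg n \<alpha> \<beta> \<phi>) =
          subalg_gen n \<alpha> \<beta> \<phi>
              ({fd ^ m, fu ^ m} \<union>
               {du_elt n \<phi> r s ^ i * du_elt n \<phi> s r ^ j | i j. s ^ i * r ^ j = 1} \<union> fts n)) \<and>
     (\<forall>m. case7 \<phi> r s m \<longrightarrow>
        ring_center (gdu_alg n \<alpha> \<beta> \<phi>) =
          subalg_gen n \<alpha> \<beta> \<phi> ({du_elt n \<phi> r s ^ m} \<union> fts n)) \<and>
     (\<forall>m. case8 \<phi> r s m \<longrightarrow>
        ring_center (gdu_alg n \<alpha> \<beta> \<phi>) =
          subalg_gen n \<alpha> \<beta> \<phi> ({du_elt n \<phi> s r ^ m} \<union> fts n)) \<and>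
     ((\<nexists>m. case1 \<phi> r s m) \<and> \<not> case2 \<alpha> \<beta> \<phi> \<and> (\<nexists>m. case3 \<phi> r s m) \<and>
      (\<nexists>m. case4 \<phi> r s m) \<and> \<not> case5 r s \<and> (\<nexists>m1 m2. case6 \<phi> r s m1 m2) \<and>
      (\<nexists>m. case7 \<phi> r s m) \<and> (\<nexists>m. case8 \<phi> r s m) \<longrightarrow>
        ring_center (gdu_alg n \<alpha> \<beta> \<phi>) =
          subalg_gen n \<alpha> \<beta> \<phi> (fts n))"
proof -
  obtain \<Phi> :: "'k free \<Rightarrow> 'k free endo" where \<Phi>: "gdu_faithful n \<alpha> \<beta> r s \<phi> \<Phi>"
    using gdu_faithful_exists[OF phi roots] by blast
  interpret rs: gdu_faithful n \<alpha> \<beta> r s \<phi> \<Phi> by (fact \<Phi>)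
  interpret sr: gdu_faithful n \<alpha> \<beta> s r \<phi> \<Phi> by (rule rs.swap)
  have case2: "r = 1 \<and> s = 1 \<and> \<phi> \<noteq> 0" if "case2 \<alpha> \<beta> \<phi>"
  proof -
    from that have "r + s = 2" "r * s = 1" "\<phi> \<noteq> 0" using roots by (simp_all add: case2_def)
    then have s: "s = 2 - r" by (simp add: algebra_simps)
    have "(r - 1) * (r - 1) = 0"
      using \<open>r * s = 1\<close> unfolding s by (simp add: algebra_simps)
    then have "r = 1" by simp
    with s \<open>\<phi> \<noteq> 0\<close> show ?thesis by simp
  qed
  \<comment> \<open>If no other case applies, then either \<open>r = s\<close> is not a root of unity, or exactly one root is a root
    of unity and this root is \<open>1\<close> with \<open>\<phi> \<noteq> 0\<close>.\<close>
  have otherwise: "ring_center (gdu_alg n \<alpha> \<beta> \<phi>) = subalg_gen n \<alpha> \<beta> \<phi> ({} \<union> fts n)"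
    if no: "\<nexists>m. case1 \<phi> r s m" "\<not> case2 \<alpha> \<beta> \<phi>" "\<nexists>m. case3 \<phi> r s m" "\<nexists>m. case4 \<phi> r s m"
      "\<not> case5 r s" "\<nexists>m1 m2. case6 \<phi> r s m1 m2" "\<nexists>m. case7 \<phi> r s m" "\<nexists>m. case8 \<phi> r s m"
  proof -
    have order: "m > 1 \<or> m = 1" if "primitive_root m x" for m and x :: 'k
      using that by (auto simp: primitive_root_def)
    consider "r = s" | "r \<noteq> s" "root_of_unity r" "root_of_unity s"
      | "r \<noteq> s" "root_of_unity r" "\<not> root_of_unity s" | "r \<noteq> s" "\<not> root_of_unity r" "root_of_unity s"
      using no(5) unfolding case5_def by blast
    then show ?thesis
    proof cases
      case 1
      have "\<not> root_of_unity r"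
      proof
        assume "root_of_unity r"
        then obtain m where m: "primitive_root m r" by (rule root_of_unity_primitive)
        with no(1) 1 have "m = 1" "\<phi> \<noteq> 0" using order[OF m] unfolding case1_def by force+
        then have "r = 1" using primitive_root_one[OF m] by simp
        moreover have "\<alpha> = r + s" "\<beta> = - (r * s)" using roots by simp_all
        ultimately have "case2 \<alpha> \<beta> \<phi>" using 1 \<open>\<phi> \<noteq> 0\<close> by (simp add: case2_def)
        with no(2) show False by blast
      qed
      with 1 show ?thesis by (intro rs.center_jordan_none) simp_all
    next
      case 2
      obtain m1 m2 where m: "primitive_root m1 r" "primitive_root m2 s"
        using root_of_unity_primitive 2(2,3) by metis
      have "\<phi> \<noteq> 0" "m1 = 1 \<or> m2 = 1"
        using no(6) 2(1) m order[OF m(1)] order[OF m(2)] unfolding case6_def by blast+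
      moreover have "m1 \<noteq> 1" 
        using no(7) 2(1) m order[OF m(2)] primitive_root_one[OF m(1)] primitive_root_one[OF m(2)] \<open>\<phi> \<noteq> 0\<close>
        unfolding case7_def by metis
      moreover have "m2 \<noteq> 1" 
        using no(8) 2(1) m order[OF m(1)] primitive_root_one[OF m(1)] primitive_root_one[OF m(2)] \<open>\<phi> \<noteq> 0\<close>
        unfolding case8_def by metis
      ultimately show ?thesis by blast
    next
      case 3
      obtain m where m: "primitive_root m r" using root_of_unity_primitive 3(2) by metis
      have "m = 1" "\<phi> \<noteq> 0" using no(3) m 3(3) order[OF m] unfolding case3_def by blast+
      then show ?thesis
        using primitive_root_one[OF m] 3(3) by (intro sr.center_translation_none) simp_all
    next
      case 4
      obtain m where m: "primitive_root m s" using root_of_unity_primitive 4(3) by metis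
      have "m = 1" "\<phi> \<noteq> 0" using no(4) m 4(2) order[OF m] unfolding case4_def by blast+
      then show ?thesis
        using primitive_root_one[OF m] 4(2) by (intro rs.center_translation_none) simp_all
    qed
  qed
  show ?thesis
  proof (intro conjI allI impI)
    fix m assume "case1 \<phi> r s m"
    then have "s = r" "primitive_root m r" "m > 1 \<or> \<phi> = 0" by (auto simp: case1_def)
    then show "ring_center (gdu_alg n \<alpha> \<beta> \<phi>) = subalg_gen n \<alpha> \<beta> \<phi> ({du_elt n \<phi> r r ^ m} \<union> fts n)"
      using rs.center_jordan_root[of m] by metis
  next
    assume "case2 \<alpha> \<beta> \<phi>"
    then show "ring_center (gdu_alg n \<alpha> \<beta> \<phi>) = subalg_gen n \<alpha> \<beta> \<phi>
        ({(fd * fu - fu * fd)^2 - mpol_eval n \<phi> * (fd * fu + fu * fd)} \<union> fts n)"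
      using rs.center_unipotent case2 by blast
  next
    fix m assume "case3 \<phi> r s m"
    then show "ring_center (gdu_alg n \<alpha> \<beta> \<phi>) = subalg_gen n \<alpha> \<beta> \<phi> ({du_elt n \<phi> s r ^ m} \<union> fts n)"
      using rs.center_one_root[of m] unfolding case3_def by blast
  next
    fix m assume "case4 \<phi> r s m"
    then show "ring_center (gdu_alg n \<alpha> \<beta> \<phi>) = subalg_gen n \<alpha> \<beta> \<phi> ({du_elt n \<phi> r s ^ m} \<union> fts n)"
      using sr.center_one_root[of m] unfolding case4_def by blast
  next
    assume "case5 r s"
    then show "ring_center (gdu_alg n \<alpha> \<beta> \<phi>) = subalg_gen n \<alpha> \<beta> \<phi>
        ({du_elt n \<phi> r s ^ j * du_elt n \<phi> s r ^ i | i j. r ^ i * s ^ j = 1} \<union> fts n)"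
      unfolding case5_def by (intro rs.center_no_root) blast+
  next
    fix m1 m2 m assume a: "case6 \<phi> r s m1 m2 \<and> m = lcm m1 m2"
    then have m: "m = lcm m1 m2" by blast
    show "ring_center (gdu_alg n \<alpha> \<beta> \<phi>) = subalg_gen n \<alpha> \<beta> \<phi> ({fd ^ m, fu ^ m} \<union>
        {du_elt n \<phi> r s ^ i * du_elt n \<phi> s r ^ j | i j. s ^ i * r ^ j = 1} \<union> fts n)"
      unfolding m using a unfolding case6_def by (intro rs.center_two_roots) blast+
  next
    fix m assume "case7 \<phi> r s m"
    then show "ring_center (gdu_alg n \<alpha> \<beta> \<phi>) = subalg_gen n \<alpha> \<beta> \<phi> ({du_elt n \<phi> r s ^ m} \<union> fts n)"
      unfolding case7_def by (intro sr.center_translation_root) blast+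
  next
    fix m assume "case8 \<phi> r s m"
    then show "ring_center (gdu_alg n \<alpha> \<beta> \<phi>) = subalg_gen n \<alpha> \<beta> \<phi> ({du_elt n \<phi> s r ^ m} \<union> fts n)"
      unfolding case8_def by (intro rs.center_translation_root) blast+
  next
    assume "(\<nexists>m. case1 \<phi> r s m) \<and> \<not> case2 \<alpha> \<beta> \<phi> \<and> (\<nexists>m. case3 \<phi> r s m) \<and>
      (\<nexists>m. case4 \<phi> r s m) \<and> \<not> case5 r s \<and> (\<nexists>m1 m2. case6 \<phi> r s m1 m2) \<and>
      (\<nexists>m. case7 \<phi> r s m) \<and> (\<nexists>m. case8 \<phi> r s m)"
    then show "ring_center (gdu_alg n \<alpha> \<beta> \<phi>) = subalg_gen n \<alpha> \<beta> \<phi> (fts n)"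
      using otherwise by (simp only: Un_empty_left) blast
  qed
qed

end
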